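(* Let the geometric assumption, the CutFEM stability assumption and the covering assumption (all defined in the context) hold, let local and coarse solves be exact, and prescribe $\gamma=\gamma(p)\in(0,1]$ and an admissible $\gamma_D=\gamma_D(p)$. Let $c_A$ be the cut-independent coercivity constant in the CutFEM stability assumption, and let $\theta\in(0,1)$ be the damping of the semi-multiplicative sweep with error operator $E_{\mathrm{semi}}$ and local-stability constant $\omega$ (both defined in the context). Then $$\omega\le\overline\omega_\theta:=\max\{1,\,(1+c_A^{-1})\theta\}.$$ Consequently, for $\theta\le c_A/(1+c_A)$, $$\|E_{\mathrm{semi}}\|_{A_\ell}^2\le 1-\frac{\theta}{(2\cdot4^d+1)\,C_{\mathrm{sd}}(p)},$$ uniformly in $\ell$ and the cut configuration; the largest admissible damping $\theta=c_A/(1+c_A)$ gives the best bound.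
   Context: Meshes and spaces. $d\in\{2,3\}$, $p\ge1$; $\Omega\subset\mathbb R^d$ is a bounded domain with boundary $\Gamma$ and outward unit normal $n$. $\mathcal M_0,\dots,\mathcal M_L$ are nested Cartesian background grids covering $\Omega$: the cells of $\mathcal M_\ell$ are closed axis-parallel cubes of edge $h_\ell$, and $\mathcal M_\ell$ is the uniform dyadic refinement of $\mathcal M_{\ell-1}$, so $h_\ell=h_{\ell-1}/2$. Active cells: $\mathcal M_{\ell,\Omega}=\{K\in\mathcal M_\ell:K\cap\Omega\ne\emptyset\}$; $\Omega_\ell$ is their union. Cut (intersected) cells are those meeting $\Gamma$. $\mathbb Q_p(K)$: polynomials of degree at most $p$ in each variable. $V_\ell$: continuous functions on $\Omega_\ell$ that are in $\mathbb Q_p(K)$ on each active cell $K$, with nodal (Lagrange) basis $\phi_{\ell,i}$ at the tensor-product Gauss–Lobatto nodes $x_{\ell,i}$. $\mathbb F_G=\mathbb F_G^\ell$ (ghost faces): faces shared by two active cells at least one of which is cut. Forms. $A_\ell=a_\ell+g_\ell$ with $a_\ell(u,v)=(\nabla u,\nabla v)_\Omega-(\partial_n u,v)_\Gamma-(u,\partial_n v)_\Gamma+\gamma_D h_\ell^{-1}(u,v)_\Gamma$ and $g_\ell(u,v)=\gamma\sum_{F\in\mathbb F_G}\sum_{k=1}^p\frac{h_\ell^{2k-1}}{(k!)^2}(\llbracket\partial_n^k u\rrbracket,\llbracket\partial_n^k v\rrbracket)_F$, $\gamma\in(0,1]$ (on $F$, $n$ is a fixed unit normal and $\llbracket\cdot\rrbracket$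 the jump). $\gamma,\gamma_D$ are the same on all levels. $\|v\|_{A_\ell}^2:=A_\ell(v,v)$, and $\|\cdot\|_{A_\ell}$ of an operator on $V_\ell$ is the induced operator norm. The prolongation $\mathcal I_\ell:V_{\ell-1}\to V_\ell$ is restriction of functions to $\Omega_\ell$. Geometric assumption. $\Gamma$ is $C^2$ with positive reach $\delta_0>0$ (the closest-point projection onto $\Gamma$ is well defined and $C^1$ in the tube of radius $\delta_0$). On every level, if $\Gamma$ meets a cell $K$, then $\Gamma\cap K$ is a single curve (surface) intersecting $\partial K$ exactly twice (in a single closed curve if $d=3$), each closed face is intersected at most once, and $K\setminus\Gamma$ has exactly two connected components. $\Gamma$ contains no mesh vertex of any $\mathcal M_\ell$, $\Omega_\ell\subseteq\Omega_{\ell-1}$ for all $\ell$, and $c_R h_{\ell-1}\le\delta_0$ on every level used, with $c_R=24d+10\sqrt d$. CutFEM stability assumption. With $N_\ell(v)^2:=\|\nabla v\|_{0,\Omega}^2+h_\ell\|\partial_n v\|_{0,\Gamma}^2+h_\ell^{-1}\|v\|_{0,\Gamma}^2+g_\ell(v,v)$, one has for $u,v\in V_\ell$: $c_A N_\ell(v)^2\le A_\ell(v,v)$, $A_\ell(u,v)\le C_A N_\ell(u)N_\ell(v)$, and $|v|_{1,\Omega_\ell\setminus\Omega}^2\le C(|v|_{1,\Omega}^2+g_\ell(v,v))$, where $c_A,C_A,C>0$ are independent of $\ell$ and of the cut configuration. $\gamma_D$ is admissible if this assumption holds for it. Patches. Admissible vertices $\vartheta_1,\dots,\vartheta_J$ of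 $\mathcal M_\ell$: all grid vertices in $\Omega$ and all exterior vertices with at least one cut adjacent cell. $\widehat\omega_j$: union of the $2^d$ background cells sharing $\vartheta_j$; $\omega_j$: union of the active cells in $\widehat\omega_j$. For a basis function $\phi_{\ell,i}$, $\omega(i)$ is the union of all active cells containing $x_{\ell,i}$. Local spaces: $V^{\mathrm D}_{\ell,j}=\operatorname{span}\{\phi_{\ell,i}:x_{\ell,i}\in\operatorname{int}\widehat\omega_j\}$ or $V^{\mathrm{FR}}_{\ell,j}=\operatorname{span}\{\phi_{\ell,i}:\omega(i)\subseteq\omega_j\}$; $V_{\ell,j}$ denotes either. $V_{\ell,0}:=\mathcal I_\ell V_{\ell-1}$. $P_j$, $j=0,\dots,J$, is the $A_\ell$-orthogonal projection onto $V_{\ell,j}$. Covering assumption. For each nodal basis function $\phi_{\ell,i}$ of $V_\ell$ there is $j\in\{1,\dots,J\}$ with $\phi_{\ell,i}\in V_{\ell,j}$. Constant $C_{\mathrm{sd}}(p)$: independent of $\ell$ and the cut configuration, such that every $v\in V_\ell$ can be written $v=\sum_{j=0}^Jv_j$, $v_j\in V_{\ell,j}$, with $\sum_{j=0}^J\|v_j\|_{A_\ell}^2\le C_{\mathrm{sd}}(p)\|v\|_{A_\ell}^2$ (the paper proves such a constant exists under the stated assumptions). Semi-multiplicative sweep. All patches are colored with the standard $2^d$ geometric colors: the color of $\vartheta_j$ is the parity vector in $\{0,1\}^d$ of its integer grid index, so distinct same-color vertices have indices differing by even numbers in each coordinate. Patches having a cell that touches a ghost face (i.e. has a face in $\mathbb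 F_G$), the "cut and collar" patches, get $\theta_j:=\theta$; all other patches get $\theta_j:=1$. After the exact coarse correction $P_0$, colors are processed one after another (multiplicatively) and the patches within a color additively: $E_{\mathrm{semi}}:=\Bigl[\prod_{c}\bigl(I-\sum_{j\in c}\theta_jP_j\bigr)\Bigr](I-P_0)$, the product over the colors $c$ in a fixed order. Same-color patches share no degrees of freedom, so the color space is the direct sum $V_c=\bigoplus_{j\in c}V_{\ell,j}$, and the color update is the exact solve with the form $\tilde a_c(u,u):=\sum_{j\in c}\theta_j^{-1}\|u_j\|_{A_\ell}^2$ for $u=\sum_{j\in c}u_j$, $u_j\in V_{\ell,j}$. The local-stability constant $\omega$ is the smallest number such that $\|u\|_{A_\ell}^2\le\omega\,\tilde a_c(u,u)$ for all colors $c$ and all $u\in V_c$ and $\omega\ge1$ (the latter accounting for the exact coarse solve). *)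

theory Defs
  imports
    "HOL-Analysis.Analysis"
    "HOL-Library.Function_Algebras"
    "HOL-Computational_Algebra.Polynomial"
begin

text \<open>Real-valued functions on \<open>\<real>\<^sup>d\<close> form a real vector space pointwise; this makes
  \<^const>\<open>span\<close>, sums and differences available for finite element functions.\<close>

instantiation "fun" :: (type, real_vector) real_vector
begin

definition scaleR_fun_def: "scaleR r f = (\<lambda>x. r *\<^sub>R f x)"

instance
  by standard (simp_all add: scaleR_fun_def fun_eq_iff scaleR_add_right scaleR_add_left)

end

text \<open>\<open>s\<close>-dimensional Hausdorff measure (\<open>s \<ge> 1\<close>) on the Borel sets, normalised to agree with
  \<open>s\<close>-dimensional Lebesgue measure on flat pieces.\<close>

definition hausdorff_pre :: "nat \<Rightarrow> real \<Rightarrow> 'a::metric_space set \<Rightarrow> ennreal" where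
  "hausdorff_pre s \<delta> A =
     (INF C\<in>{C :: nat \<Rightarrow> 'a set. A \<subseteq> (\<Union>i. C i) \<and> (\<forall>i. bounded (C i) \<and> diameter (C i) \<le> \<delta>)}.
        (\<Sum>i. ennreal (unit_ball_vol (real s) * (diameter (C i) / 2) ^ s)))"

definition hausdorff_measure :: "nat \<Rightarrow> 'a::metric_space measure" where
  "hausdorff_measure s =
     measure_of UNIV (sets borel) (\<lambda>A. SUP \<delta>\<in>{0<..}. hausdorff_pre s \<delta> A)"

definition surface_measure :: "(real ^ 'd) measure" where
  "surface_measure = hausdorff_measure (CARD('d) - 1)"

text \<open>Near \<open>x\<close>, \<open>\<Omega>\<close> is the sublevel set \<open>{\<psi> < 0}\<close> of a \<open>C\<^sup>2\<close> function \<open>\<psi>\<close> with gradient field \<open>G\<close>.\<close>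

definition C2_defining_fun ::
  "(real ^ 'd) set \<Rightarrow> real ^ 'd \<Rightarrow> (real ^ 'd \<Rightarrow> real) \<Rightarrow> (real ^ 'd \<Rightarrow> real ^ 'd) \<Rightarrow> bool" where
  "C2_defining_fun \<Omega> x \<psi> G \<longleftrightarrow>
     (\<exists>U (H :: real ^ 'd \<Rightarrow> real ^ 'd ^ 'd). open U \<and> x \<in> U \<and>
        (\<forall>y\<in>U. (\<psi> has_derivative (\<lambda>v. G y \<bullet> v)) (at y)) \<and>
        (\<forall>y\<in>U. (G has_derivative (\<lambda>v. H y *v v)) (at y)) \<and>
        continuous_on U H \<and> G x \<noteq> 0 \<and>
        \<Omega> \<inter> U = {y \<in> U. \<psi> y < 0} \<and> frontier \<Omega> \<inter> U = {y \<in> U. \<psi> y = 0})"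

definition C2_boundary :: "(real ^ 'd) set \<Rightarrow> bool" where
  "C2_boundary \<Omega> \<longleftrightarrow> (\<forall>x\<in>frontier \<Omega>. \<exists>\<psi> G. C2_defining_fun \<Omega> x \<psi> G)"

definition outward_normal :: "(real ^ 'd) set \<Rightarrow> real ^ 'd \<Rightarrow> real ^ 'd" where
  "outward_normal \<Omega> x =
     (THE \<nu>. \<exists>\<psi> G. C2_defining_fun \<Omega> x \<psi> G \<and> \<nu> = G x /\<^sub>R norm (G x))"

definition C1_on :: "(real ^ 'd) set \<Rightarrow> (real ^ 'd \<Rightarrow> real ^ 'd) \<Rightarrow> bool" where
  "C1_on T f \<longleftrightarrow>
     (\<exists>D :: real ^ 'd \<Rightarrow> real ^ 'd ^ 'd.
        (\<forall>x\<in>T. (f has_derivative (\<lambda>v. D x *v v)) (at x)) \<and> continuous_on T D)"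

definition has_reach :: "(real ^ 'd) set \<Rightarrow> real \<Rightarrow> bool" where
  "has_reach \<Gamma> \<delta> \<longleftrightarrow>
     (\<exists>\<pi>. (\<forall>x. infdist x \<Gamma> < \<delta> \<longrightarrow>
              \<pi> x \<in> \<Gamma> \<and> dist x (\<pi> x) = infdist x \<Gamma> \<and>
              (\<forall>y\<in>\<Gamma>. dist x y = infdist x \<Gamma> \<longrightarrow> y = \<pi> x)) \<and>
          C1_on {x. infdist x \<Gamma> < \<delta>} \<pi>)"

text \<open>A configuration consists of the domain \<open>\<Omega>\<close>, the origin and edge length of the coarsest
  background grid, and the index \<open>L\<close> of the finest level. Grids are extended to all of \<open>\<real>\<^sup>d\<close>,
  which adds no cell meeting \<open>\<Omega>\<close>. Cells and vertices on level \<open>l\<close> are indexed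
  by \<open>\<int>\<^sup>d\<close>, a cell having the index of its lower corner.\<close>

record 'd cut_config =
  region :: "(real, 'd) vec set"
  origin :: "(real, 'd) vec"
  h_coarse :: real
  finest :: nat

definition mesh_size :: "('d::finite) cut_config \<Rightarrow> nat \<Rightarrow> real" where
  "mesh_size c l = h_coarse c / 2 ^ l"

definition vertex :: "('d::finite) cut_config \<Rightarrow> nat \<Rightarrow> int ^ 'd \<Rightarrow> real ^ 'd" where
  "vertex c l z = origin c + mesh_size c l *\<^sub>R (\<chi> i. real_of_int (z $ i))"

definition cell :: "('d::finite) cut_config \<Rightarrow> nat \<Rightarrow> int ^ 'd \<Rightarrow> (real ^ 'd) set" where
  "cell c l z = cbox (vertex c l z) (vertex c l (\<chi> i. z $ i + 1))"

definition active_cells :: "('d::finite) cut_config \<Rightarrow> nat \<Rightarrow> (int ^ 'd) set" where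
  "active_cells c l = {z. cell c l z \<inter> region c \<noteq> {}}"

definition active_region :: "('d::finite) cut_config \<Rightarrow> nat \<Rightarrow> (real ^ 'd) set" where
  "active_region c l = (\<Union>z\<in>active_cells c l. cell c l z)"

definition cut_cells :: "('d::finite) cut_config \<Rightarrow> nat \<Rightarrow> (int ^ 'd) set" where
  "cut_cells c l = {z. cell c l z \<inter> frontier (region c) \<noteq> {}}"

text \<open>Faces are indexed by pairs \<open>(z, i)\<close>: the face with normal \<open>e\<^sub>i\<close> between the cells \<open>z\<close>
  and \<open>z + e\<^sub>i\<close>.\<close>

definition face :: "('d::finite) cut_config \<Rightarrow> nat \<Rightarrow> (int ^ 'd) \<times> 'd \<Rightarrow> (real ^ 'd) set" where
  "face c l F = (case F of (z, i) \<Rightarrow> cell c l z \<inter> cell c l (z + axis i 1))"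

definition faces_of_cell :: "int ^ 'd \<Rightarrow> ((int ^ 'd) \<times> 'd) set" where
  "faces_of_cell z = (\<Union>i. {(z, i), (z - axis i 1, i)})"

definition ghost_faces :: "('d::finite) cut_config \<Rightarrow> nat \<Rightarrow> ((int ^ 'd) \<times> 'd) set" where
  "ghost_faces c l =
     {(z, i). z \<in> active_cells c l \<and> z + axis i 1 \<in> active_cells c l \<and>
              (z \<in> cut_cells c l \<or> z + axis i 1 \<in> cut_cells c l)}"

text \<open>How \<open>\<Gamma>\<close> may cut a cell \<open>z\<close> which it meets. In dimension 3, \<open>\<Gamma> \<inter> K\<close> is a piece of the surface
  \<open>\<Gamma>\<close>, so being a single surface means connectedness; a face is intersected at most once
  if its intersection with \<open>\<Gamma>\<close> is in one (possibly empty) piece.\<close>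

definition regular_cut :: "('d::finite) cut_config \<Rightarrow> nat \<Rightarrow> int ^ 'd \<Rightarrow> bool" where
  "regular_cut c l z \<longleftrightarrow>
     (let \<Gamma> = frontier (region c); K = cell c l z in
       (CARD('d) = 2 \<longrightarrow>
          (\<exists>\<gamma>. arc \<gamma> \<and> path_image \<gamma> = \<Gamma> \<inter> K) \<and>
          card (\<Gamma> \<inter> frontier K) = 2 \<and>
          (\<forall>F\<in>faces_of_cell z. card (\<Gamma> \<inter> face c l F) \<le> 1)) \<and>
       (CARD('d) = 3 \<longrightarrow>
          connected (\<Gamma> \<inter> K) \<and>
          (\<Gamma> \<inter> frontier K) homeomorphic (sphere 0 1 :: complex set) \<and>
          (\<forall>F\<in>faces_of_cell z. connected (\<Gamma> \<inter> face c l F))) \<and>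
       card (components (K - \<Gamma>)) = 2)"

definition c_R :: "'d::finite itself \<Rightarrow> real" where
  "c_R _ = 24 * real CARD('d) + 10 * sqrt (real CARD('d))"

definition geometric_assumption :: "('d::finite) cut_config \<Rightarrow> bool" where
  "geometric_assumption c \<longleftrightarrow>
     C2_boundary (region c) \<and>
     (\<forall>l\<le>finest c. \<forall>z\<in>cut_cells c l. regular_cut c l z) \<and>
     (\<forall>l\<le>finest c. \<forall>z. vertex c l z \<notin> frontier (region c)) \<and>
     (\<forall>l\<in>{1..finest c}. active_region c l \<subseteq> active_region c (l - 1)) \<and>
     (\<exists>\<delta>\<^sub>0>0. has_reach (frontier (region c)) \<delta>\<^sub>0 \<and>
        (\<forall>l\<in>{1..finest c}. c_R TYPE('d) * mesh_size c (l - 1) \<le> \<delta>\<^sub>0))"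

definition valid_config :: "('d::finite) cut_config \<Rightarrow> bool" where
  "valid_config c \<longleftrightarrow>
     open (region c) \<and> connected (region c) \<and> region c \<noteq> {} \<and> bounded (region c) \<and> h_coarse c > 0"

definition Qp :: "nat \<Rightarrow> (real ^ 'd \<Rightarrow> real) set" where
  "Qp p = {q. \<exists>a :: ('d \<Rightarrow> nat) \<Rightarrow> real.
              \<forall>x. q x = (\<Sum>\<alpha> | \<forall>i. \<alpha> i \<le> p. a \<alpha> * (\<Prod>i\<in>UNIV. (x $ i) ^ \<alpha> i))}"

text \<open>Functions on \<open>\<Omega>\<^sub>l\<close> are represented by their extension by zero to \<open>\<real>\<^sup>d\<close>.\<close>

definition fe_space :: "('d::finite) cut_config \<Rightarrow> nat \<Rightarrow> nat \<Rightarrow> (real ^ 'd \<Rightarrow> real) set" where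
  "fe_space c p l =
     {u. continuous_on (active_region c l) u \<and>
         (\<forall>z\<in>active_cells c l. \<exists>q\<in>Qp p. \<forall>x\<in>cell c l z. u x = q x) \<and>
         (\<forall>x. x \<notin> active_region c l \<longrightarrow> u x = 0)}"

definition legendre :: "nat \<Rightarrow> real poly" where
  "legendre p = smult (1 / (2 ^ p * fact p)) ((pderiv ^^ p) ([:-1, 0, 1:] ^ p))"

definition gauss_lobatto :: "nat \<Rightarrow> real set" where
  "gauss_lobatto p = {-1, 1} \<union> {\<xi>. poly (pderiv (legendre p)) \<xi> = 0}"

definition nodes :: "('d::finite) cut_config \<Rightarrow> nat \<Rightarrow> nat \<Rightarrow> (real ^ 'd) set" where
  "nodes c p l =
     {vertex c l z + mesh_size c l *\<^sub>R (\<chi> i. (1 + \<xi> $ i) / 2) | z \<xi>.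
        z \<in> active_cells c l \<and> (\<forall>i. \<xi> $ i \<in> gauss_lobatto p)}"

definition nodal_basis ::
  "('d::finite) cut_config \<Rightarrow> nat \<Rightarrow> nat \<Rightarrow> real ^ 'd \<Rightarrow> (real ^ 'd \<Rightarrow> real)" where
  "nodal_basis c p l x =
     (THE v. v \<in> fe_space c p l \<and> (\<forall>y\<in>nodes c p l. v y = (if y = x then 1 else 0)))"

definition cell_poly ::
  "('d::finite) cut_config \<Rightarrow> nat \<Rightarrow> nat \<Rightarrow> (real ^ 'd \<Rightarrow> real) \<Rightarrow> int ^ 'd \<Rightarrow> (real ^ 'd \<Rightarrow> real)" where
  "cell_poly c p l u z = (THE q. q \<in> Qp p \<and> (\<forall>x\<in>cell c l z. q x = u x))"

definition dir_deriv :: "nat \<Rightarrow> real ^ 'd \<Rightarrow> (real ^ 'd \<Rightarrow> real) \<Rightarrow> real ^ 'd \<Rightarrow> real" where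
  "dir_deriv k \<nu> q x = (deriv ^^ k) (\<lambda>t. q (x + t *\<^sub>R \<nu>)) 0"

text \<open>The piecewise gradient. In the interior of a cell this is the classical gradient; where
  several active cells meet, the one-sided gradients are averaged, so that the gradient is defined
  everywhere on \<open>\<Omega>\<^sub>l\<close> and linear in the function.\<close>

definition fe_grad ::
  "('d::finite) cut_config \<Rightarrow> nat \<Rightarrow> nat \<Rightarrow> (real ^ 'd \<Rightarrow> real) \<Rightarrow> real ^ 'd \<Rightarrow> real ^ 'd" where
  "fe_grad c p l u x =
     (let Z = {z \<in> active_cells c l. x \<in> cell c l z}
      in (\<Sum>z\<in>Z. \<chi> i. dir_deriv 1 (axis i 1) (cell_poly c p l u z) x) /\<^sub>R real (card Z))"

definition fe_normal_deriv ::
  "('d::finite) cut_config \<Rightarrow> nat \<Rightarrow> nat \<Rightarrow> (real ^ 'd \<Rightarrow> real) \<Rightarrow> real ^ 'd \<Rightarrow> real" where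
  "fe_normal_deriv c p l u x = outward_normal (region c) x \<bullet> fe_grad c p l u x"

definition L2_Gamma ::
  "('d::finite) cut_config \<Rightarrow> (real ^ 'd \<Rightarrow> real) \<Rightarrow> (real ^ 'd \<Rightarrow> real) \<Rightarrow> real" where
  "L2_Gamma c u v = (LINT x:frontier (region c)|surface_measure. u x * v x)"

definition grad_form ::
  "('d::finite) cut_config \<Rightarrow> nat \<Rightarrow> nat \<Rightarrow> (real ^ 'd) set \<Rightarrow>
   (real ^ 'd \<Rightarrow> real) \<Rightarrow> (real ^ 'd \<Rightarrow> real) \<Rightarrow> real" where
  "grad_form c p l S u v = (LINT x:S|lborel. fe_grad c p l u x \<bullet> fe_grad c p l v x)"

definition nitsche_form ::
  "('d::finite) cut_config \<Rightarrow> nat \<Rightarrow> real \<Rightarrow> nat \<Rightarrow>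
   (real ^ 'd \<Rightarrow> real) \<Rightarrow> (real ^ 'd \<Rightarrow> real) \<Rightarrow> real" where
  "nitsche_form c p \<gamma>D l u v =
     grad_form c p l (region c) u v
     - L2_Gamma c (fe_normal_deriv c p l u) v
     - L2_Gamma c u (fe_normal_deriv c p l v)
     + \<gamma>D / mesh_size c l * L2_Gamma c u v"

definition normal_jump ::
  "('d::finite) cut_config \<Rightarrow> nat \<Rightarrow> nat \<Rightarrow> nat \<Rightarrow> (int ^ 'd) \<times> 'd \<Rightarrow>
   (real ^ 'd \<Rightarrow> real) \<Rightarrow> real ^ 'd \<Rightarrow> real" where
  "normal_jump c p l k F u x =
     (case F of (z, i) \<Rightarrow>
        dir_deriv k (axis i 1) (cell_poly c p l u (z + axis i 1)) x
        - dir_deriv k (axis i 1) (cell_poly c p l u z) x)"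

definition ghost_form ::
  "('d::finite) cut_config \<Rightarrow> nat \<Rightarrow> real \<Rightarrow> nat \<Rightarrow>
   (real ^ 'd \<Rightarrow> real) \<Rightarrow> (real ^ 'd \<Rightarrow> real) \<Rightarrow> real" where
  "ghost_form c p \<gamma> l u v =
     \<gamma> * (\<Sum>F\<in>ghost_faces c l. \<Sum>k=1..p.
            mesh_size c l ^ (2 * k - 1) / (fact k)\<^sup>2 *
            (LINT x:face c l F|surface_measure. normal_jump c p l k F u x * normal_jump c p l k F v x))"

definition A_form ::
  "('d::finite) cut_config \<Rightarrow> nat \<Rightarrow> real \<Rightarrow> real \<Rightarrow> nat \<Rightarrow>
   (real ^ 'd \<Rightarrow> real) \<Rightarrow> (real ^ 'd \<Rightarrow> real) \<Rightarrow> real" where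
  "A_form c p \<gamma> \<gamma>D l u v = nitsche_form c p \<gamma>D l u v + ghost_form c p \<gamma> l u v"

definition A_norm ::
  "('d::finite) cut_config \<Rightarrow> nat \<Rightarrow> real \<Rightarrow> real \<Rightarrow> nat \<Rightarrow> (real ^ 'd \<Rightarrow> real) \<Rightarrow> real" where
  "A_norm c p \<gamma> \<gamma>D l v = sqrt (A_form c p \<gamma> \<gamma>D l v v)"

definition A_opnorm ::
  "('d::finite) cut_config \<Rightarrow> nat \<Rightarrow> real \<Rightarrow> real \<Rightarrow> nat \<Rightarrow>
   ((real ^ 'd \<Rightarrow> real) \<Rightarrow> (real ^ 'd \<Rightarrow> real)) \<Rightarrow> real" where
  "A_opnorm c p \<gamma> \<gamma>D l E =
     (SUP v\<in>fe_space c p l - {0}. A_norm c p \<gamma> \<gamma>D l (E v) / A_norm c p \<gamma> \<gamma>D l v)"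

definition N_norm ::
  "('d::finite) cut_config \<Rightarrow> nat \<Rightarrow> real \<Rightarrow> nat \<Rightarrow> (real ^ 'd \<Rightarrow> real) \<Rightarrow> real" where
  "N_norm c p \<gamma> l v =
     sqrt (grad_form c p l (region c) v v
           + mesh_size c l * L2_Gamma c (fe_normal_deriv c p l v) (fe_normal_deriv c p l v)
           + L2_Gamma c v v / mesh_size c l
           + ghost_form c p \<gamma> l v v)"

text \<open>Independence of the level and of the cut configuration is expressed by fixing the constants
  before a whole family \<open>\<C>\<close> of configurations; the same holds for \<open>stable_decomposition\<close> below.\<close>

definition cutfem_stability ::
  "('d::finite) cut_config set \<Rightarrow> nat \<Rightarrow> real \<Rightarrow> real \<Rightarrow> real \<Rightarrow> real \<Rightarrow> real \<Rightarrow> bool" where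
  "cutfem_stability \<C> p \<gamma> \<gamma>D cA CA CE \<longleftrightarrow>
     cA > 0 \<and> CA > 0 \<and> CE > 0 \<and>
     (\<forall>c\<in>\<C>. \<forall>l\<le>finest c. \<forall>u\<in>fe_space c p l. \<forall>v\<in>fe_space c p l.
        cA * (N_norm c p \<gamma> l v)\<^sup>2 \<le> A_form c p \<gamma> \<gamma>D l v v \<and>
        A_form c p \<gamma> \<gamma>D l u v \<le> CA * N_norm c p \<gamma> l u * N_norm c p \<gamma> l v \<and>
        grad_form c p l (active_region c l - region c) v v
          \<le> CE * (grad_form c p l (region c) v v + ghost_form c p \<gamma> l v v))"

definition adm_vertices :: "('d::finite) cut_config \<Rightarrow> nat \<Rightarrow> (int ^ 'd) set" where
  "adm_vertices c l =
     {j. vertex c l j \<in> region c \<or>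
         (vertex c l j \<notin> closure (region c) \<and> (\<exists>z\<in>cut_cells c l. vertex c l j \<in> cell c l z))}"

definition full_patch :: "('d::finite) cut_config \<Rightarrow> nat \<Rightarrow> int ^ 'd \<Rightarrow> (real ^ 'd) set" where
  "full_patch c l j = (\<Union>z\<in>{z. vertex c l j \<in> cell c l z}. cell c l z)"

definition patch_cells :: "('d::finite) cut_config \<Rightarrow> nat \<Rightarrow> int ^ 'd \<Rightarrow> (int ^ 'd) set" where
  "patch_cells c l j = {z \<in> active_cells c l. vertex c l j \<in> cell c l z}"

definition patch :: "('d::finite) cut_config \<Rightarrow> nat \<Rightarrow> int ^ 'd \<Rightarrow> (real ^ 'd) set" where
  "patch c l j = (\<Union>z\<in>patch_cells c l j. cell c l z)"

definition node_patch :: "('d::finite) cut_config \<Rightarrow> nat \<Rightarrow> real ^ 'd \<Rightarrow> (real ^ 'd) set" where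
  "node_patch c l x = (\<Union>z\<in>{z \<in> active_cells c l. x \<in> cell c l z}. cell c l z)"

datatype patch_kind = Dirichlet | Full_Residual

definition local_space ::
  "patch_kind \<Rightarrow> ('d::finite) cut_config \<Rightarrow> nat \<Rightarrow> nat \<Rightarrow> int ^ 'd \<Rightarrow> (real ^ 'd \<Rightarrow> real) set" where
  "local_space \<kappa> c p l j =
     span (nodal_basis c p l `
       {x \<in> nodes c p l. case \<kappa> of Dirichlet \<Rightarrow> x \<in> interior (full_patch c l j)
                                 | Full_Residual \<Rightarrow> node_patch c l x \<subseteq> patch c l j})"

definition prolongation ::
  "('d::finite) cut_config \<Rightarrow> nat \<Rightarrow> (real ^ 'd \<Rightarrow> real) \<Rightarrow> (real ^ 'd \<Rightarrow> real)" where
  "prolongation c l v = (\<lambda>x. if x \<in> active_region c l then v x else 0)"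

definition coarse_space :: "('d::finite) cut_config \<Rightarrow> nat \<Rightarrow> nat \<Rightarrow> (real ^ 'd \<Rightarrow> real) set" where
  "coarse_space c p l = prolongation c l ` fe_space c p (l - 1)"

definition A_proj ::
  "('d::finite) cut_config \<Rightarrow> nat \<Rightarrow> real \<Rightarrow> real \<Rightarrow> nat \<Rightarrow> (real ^ 'd \<Rightarrow> real) set \<Rightarrow>
   (real ^ 'd \<Rightarrow> real) \<Rightarrow> (real ^ 'd \<Rightarrow> real)" where
  "A_proj c p \<gamma> \<gamma>D l S v = (THE w. w \<in> S \<and> (\<forall>s\<in>S. A_form c p \<gamma> \<gamma>D l (v - w) s = 0))"

definition covering_assumption ::
  "patch_kind \<Rightarrow> ('d::finite) cut_config \<Rightarrow> nat \<Rightarrow> bool" where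
  "covering_assumption \<kappa> c p \<longleftrightarrow>
     (\<forall>l\<in>{1..finest c}. \<forall>x\<in>nodes c p l. \<exists>j\<in>adm_vertices c l.
        nodal_basis c p l x \<in> local_space \<kappa> c p l j)"

definition stable_decomposition ::
  "patch_kind \<Rightarrow> ('d::finite) cut_config set \<Rightarrow> nat \<Rightarrow> real \<Rightarrow> real \<Rightarrow> real \<Rightarrow> bool" where
  "stable_decomposition \<kappa> \<C> p \<gamma> \<gamma>D Csd \<longleftrightarrow>
     Csd > 0 \<and>
     (\<forall>c\<in>\<C>. \<forall>l\<in>{1..finest c}. \<forall>v\<in>fe_space c p l.
        \<exists>v0\<in>coarse_space c p l. \<exists>w.
          (\<forall>j\<in>adm_vertices c l. w j \<in> local_space \<kappa> c p l j) \<and>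
          v = v0 + (\<Sum>j\<in>adm_vertices c l. w j) \<and>
          (A_norm c p \<gamma> \<gamma>D l v0)\<^sup>2 + (\<Sum>j\<in>adm_vertices c l. (A_norm c p \<gamma> \<gamma>D l (w j))\<^sup>2)
            \<le> Csd * (A_norm c p \<gamma> \<gamma>D l v)\<^sup>2)"

text \<open>Colours are parity vectors of the grid index, encoded as Boolean vectors.\<close>

definition vertex_color :: "int ^ 'd \<Rightarrow> bool ^ 'd" where
  "vertex_color j = (\<chi> i. odd (j $ i))"

definition color_class :: "('d::finite) cut_config \<Rightarrow> nat \<Rightarrow> bool ^ 'd \<Rightarrow> (int ^ 'd) set" where
  "color_class c l col = {j \<in> adm_vertices c l. vertex_color j = col}"

definition cut_or_collar :: "('d::finite) cut_config \<Rightarrow> nat \<Rightarrow> int ^ 'd \<Rightarrow> bool" where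
  "cut_or_collar c l j \<longleftrightarrow> (\<exists>z\<in>patch_cells c l j. faces_of_cell z \<inter> ghost_faces c l \<noteq> {})"

definition damping :: "('d::finite) cut_config \<Rightarrow> nat \<Rightarrow> real \<Rightarrow> int ^ 'd \<Rightarrow> real" where
  "damping c l \<theta> j = (if cut_or_collar c l j then \<theta> else 1)"

definition color_step ::
  "patch_kind \<Rightarrow> ('d::finite) cut_config \<Rightarrow> nat \<Rightarrow> real \<Rightarrow> real \<Rightarrow> real \<Rightarrow> nat \<Rightarrow> bool ^ 'd \<Rightarrow>
   (real ^ 'd \<Rightarrow> real) \<Rightarrow> (real ^ 'd \<Rightarrow> real)" where
  "color_step \<kappa> c p \<gamma> \<gamma>D \<theta> l col v =
     v - (\<Sum>j\<in>color_class c l col.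
            damping c l \<theta> j *\<^sub>R A_proj c p \<gamma> \<gamma>D l (local_space \<kappa> c p l j) v)"

text \<open>The list \<open>cols\<close> is the order of the factors of the operator product from left to right;
  the coarse correction acts first.\<close>

definition E_semi ::
  "patch_kind \<Rightarrow> ('d::finite) cut_config \<Rightarrow> nat \<Rightarrow> real \<Rightarrow> real \<Rightarrow> real \<Rightarrow> (bool ^ 'd) list \<Rightarrow> nat \<Rightarrow>
   (real ^ 'd \<Rightarrow> real) \<Rightarrow> (real ^ 'd \<Rightarrow> real)" where
  "E_semi \<kappa> c p \<gamma> \<gamma>D \<theta> cols l =
     foldr (\<lambda>col E. color_step \<kappa> c p \<gamma> \<gamma>D \<theta> l col \<circ> E) cols
       (\<lambda>v. v - A_proj c p \<gamma> \<gamma>D l (coarse_space c p l) v)"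

text \<open>An element of the colour space is given by its components \<open>u\<^sub>j\<close>, which it determines
  uniquely because the colour space is the direct sum of the local spaces.\<close>

definition local_stability_const ::
  "patch_kind \<Rightarrow> ('d::finite) cut_config \<Rightarrow> nat \<Rightarrow> real \<Rightarrow> real \<Rightarrow> real \<Rightarrow> nat \<Rightarrow> real" where
  "local_stability_const \<kappa> c p \<gamma> \<gamma>D \<theta> l =
     (LEAST \<omega>. 1 \<le> \<omega> \<and>
        (\<forall>col. \<forall>u. (\<forall>j\<in>color_class c l col. u j \<in> local_space \<kappa> c p l j) \<longrightarrow>
           (A_norm c p \<gamma> \<gamma>D l (\<Sum>j\<in>color_class c l col. u j))\<^sup>2
             \<le> \<omega> * (\<Sum>j\<in>color_class c l col.
                      inverse (damping c l \<theta> j) * (A_norm c p \<gamma> \<gamma>D l (u j))\<^sup>2)))"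

end

theory Submission
  imports Defs
begin

text \<open>
  Each visit to a colour replaces the error \<open>w\<close> by \<open>w - T w\<close>, where \<open>T\<close> is the sum of the damped
  patch projections of that colour. If the local-stability constant is \<open>1\<close>, then
  \<open>\<parallel>T w\<parallel>\<^sup>2 \<le> A (T w) w\<close>, so that the step lowers the squared energy norm by at least \<open>A (T w) w\<close>.
  The stable decomposition bounds \<open>\<parallel>v\<parallel>\<^sup>2\<close> by the energies \<open>A (T v) v\<close> that all colours see in the
  \<^emph>\<open>initial\<close> error. Replacing the initial error by the current one costs a factor that grows
  quadratically in the number \<open>N\<close> of colours, because the error has moved by the sum of the
  previous corrections. With \<open>N = 2\<^sup>d\<close> this factor is at most \<open>2 \<cdot> 4\<^sup>d + 1\<close>; damping costs the further
  factor \<open>1 / \<theta>\<close>. This argument is \<open>multiplicative_Schwarz\<close>, in an abstract inner product space.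

  The local-stability constant is bounded in \<open>color_class_stability\<close>. Two patches of one colour
  share no cell. Hence the Nitsche part of the form splits into the contributions of the single
  patches: on \<open>\<Gamma>\<close> the products of functions and normal derivatives vanish pointwise, and in the volume
  the products of gradients vanish off the cell boundaries, which are null sets. A ghost face touches
  two cells, hence at most two patches of one colour, and \<open>(a + b)\<^sup>2 \<le> 2 (a\<^sup>2 + b\<^sup>2)\<close> loses a factor \<open>2\<close>
  in the ghost penalty. The excess, one copy of \<open>g(u\<^sub>j, u\<^sub>j)\<close>, is at most \<open>A(u\<^sub>j, u\<^sub>j) / c\<^sub>A\<close> by
  coercivity, and it is zero for patches away from the ghost faces. So the damping \<open>\<theta>\<close> on the
  remaining patches has to absorb the factor \<open>1 + 1 / c\<^sub>A\<close>, and \<open>\<theta> \<le> c\<^sub>A / (1 + c\<^sub>A)\<close> does so.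

  For this to be meaningful, the discrete form must be an inner product on the finite element space.
  Bilinearity needs all integrals to exist, hence a boundary of finite surface measure and a
  continuous normal field. Definiteness (\<open>A_positive\<close>) needs more: a function of zero energy is
  constant on the active mesh, and it is zero only because \<open>\<Gamma>\<close> has \<^emph>\<open>positive\<close> surface measure. So
  Hausdorff measure is shown to be a Borel measure, the measure of \<open>\<Gamma>\<close> is bounded above by covering
  Lipschitz graphs and below by projecting \<open>\<Gamma>\<close> onto a coordinate hyperplane. Finally the nodal basis
  functions have to exist and to vanish on cells that do not contain their node; this rests on the
  unisolvence of tensor-product polynomials and on the fact that there are exactly \<open>p + 1\<close>
  Gauss-Lobatto points, all in \<open>[-1, 1]\<close>.
\<close>

section \<open>Multiplicative Schwarz methods in an inner product space\<close>

text \<open>The form is constrained on the subspace \<open>V\<close> only, because the finite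
  element forms are defined for arbitrary functions but are bilinear only on finite element
  functions.\<close>

locale inner_product_on =
  fixes V :: "'a::real_vector set" and A :: "'a \<Rightarrow> 'a \<Rightarrow> real"
  assumes subspace_V: "subspace V"
    and A_add: "\<lbrakk>u \<in> V; v \<in> V; w \<in> V\<rbrakk> \<Longrightarrow> A (u + v) w = A u w + A v w"
    and A_scale: "\<lbrakk>u \<in> V; w \<in> V\<rbrakk> \<Longrightarrow> A (r *\<^sub>R u) w = r * A u w"
    and A_sym: "\<lbrakk>u \<in> V; w \<in> V\<rbrakk> \<Longrightarrow> A u w = A w u"
    and A_pos: "\<lbrakk>v \<in> V; v \<noteq> 0\<rbrakk> \<Longrightarrow> 0 < A v v"
begin

lemma V_closed:
  shows "0 \<in> V"
    and "u \<in> V \<Longrightarrow> v \<in> V \<Longrightarrow> u + v \<in> V"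
    and "u \<in> V \<Longrightarrow> v \<in> V \<Longrightarrow> u - v \<in> V"
    and "u \<in> V \<Longrightarrow> r *\<^sub>R u \<in> V"
    and "(\<And>j. j \<in> J \<Longrightarrow> f j \<in> V) \<Longrightarrow> sum f J \<in> V"
  using subspace_V
  by (auto intro: subspace_0 subspace_add subspace_diff subspace_scale subspace_sum)

lemma A_zero: "w \<in> V \<Longrightarrow> A 0 w = 0"
  using A_scale[of 0 w 0] V_closed(1) by simp

lemma A_diff: "\<lbrakk>u \<in> V; v \<in> V; w \<in> V\<rbrakk> \<Longrightarrow> A (u - v) w = A u w - A v w"
  using A_add[of u "(-1) *\<^sub>R v" w] A_scale[of v w "-1"] V_closed(4)[of v "-1"] by simp

lemma A_sum: "(\<And>j. j \<in> J \<Longrightarrow> f j \<in> V) \<Longrightarrow> w \<in> V \<Longrightarrow> A (sum f J) w = (\<Sum>j\<in>J. A (f j) w)"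
proof (induction J rule: infinite_finite_induct)
  case (insert j J)
  then show ?case by (simp add: A_add V_closed(5))
qed (simp_all add: A_zero)

lemma A_nonneg: "v \<in> V \<Longrightarrow> 0 \<le> A v v"
  using A_pos[of v] A_zero[of v] by (cases "v = 0") auto

lemma A_square_diff:
  assumes "u \<in> V" "v \<in> V"
  shows "A (u - v) (u - v) = A u u - 2 * A u v + A v v"
proof -
  have "A (u - v) (u - v) = A u (u - v) - A v (u - v)" using assms by (simp add: A_diff V_closed)
  also have "A u (u - v) = A (u - v) u" using assms by (intro A_sym V_closed)
  also have "A v (u - v) = A (u - v) v" using assms by (intro A_sym V_closed)
  finally show ?thesis using assms A_sym[of v u] by (simp add: A_diff)
qed

lemma A_square_add:
  assumes "u \<in> V" "v \<in> V"
  shows "A (u + v) (u + v) = A u u + 2 * A u v + A v v"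
  using A_square_diff[of u "(-1) *\<^sub>R v"] assms A_sym[of u v] A_sym[of v "- v"] A_sym[of u "- v"]
    V_closed(4)[of v "-1"] A_scale[of v _ "-1"] by simp

text \<open>The weighted inequality replaces Cauchy-Schwarz throughout: with a suitable
  \<open>t\<close> it gives the same constants without square roots.\<close>

lemma Young:
  assumes "u \<in> V" "v \<in> V" "0 < t"
  shows "A u v \<le> t / 2 * A u u + 1 / (2 * t) * A v v"
proof -
  have "0 \<le> A (t *\<^sub>R u - v) (t *\<^sub>R u - v)"
    using assms by (intro A_nonneg V_closed)
  also have "\<dots> = t\<^sup>2 * A u u - 2 * t * A u v + A v v"
    using assms A_sym[of u "t *\<^sub>R u"] by (simp add: A_square_diff V_closed A_scale power2_eq_square)
  finally show ?thesis using assms(3) by (simp add: field_simps power2_eq_square)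
qed

definition orth_proj :: "'a set \<Rightarrow> 'a \<Rightarrow> 'a" where
  "orth_proj S v = (THE w. w \<in> S \<and> (\<forall>s\<in>S. A (v - w) s = 0))"

text \<open>Gram-Schmidt: to enlarge \<open>B\<close> by \<open>b\<close>, correct the
  projection along the component \<open>e\<close> of \<open>b\<close> that is orthogonal to the
  old span.\<close>

lemma orth_proj_exists:
  assumes "finite B" "B \<subseteq> V" "v \<in> V"
  shows "\<exists>w\<in>span B. \<forall>s\<in>span B. A (v - w) s = 0"
  using assms
proof (induction B arbitrary: v rule: finite_induct)
  case empty
  then show ?case using A_sym[of v 0] A_zero V_closed(1) by simp
next
  case (insert b B)
  have sub: "span B \<subseteq> V" using insert.prems subspace_V by (simp add: span_minimal)
  obtain w where w: "w \<in> span B" "\<forall>s\<in>span B. A (v - w) s = 0"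
    using insert by blast
  obtain b0 where b0: "b0 \<in> span B" "\<forall>s\<in>span B. A (b - b0) s = 0"
    using insert by blast
  define e where "e = b - b0"
  have e: "e \<in> V" using insert.prems b0 sub by (auto simp: e_def intro: V_closed)
  have ve: "v \<in> V" "w \<in> V" using insert.prems w sub by auto
  define t where "t = A (v - w) e / A e e"
  have te: "t * A e e = A (v - w) e"
  proof (cases "e = 0")
    case True
    then show ?thesis using ve A_zero[of "v - w"] A_sym[of "v - w" 0] V_closed(1,3) by (simp add: A_zero)
  qed (use A_pos[of e] e in \<open>simp add: t_def\<close>)
  have sp: "span B \<subseteq> span (insert b B)" by (simp add: span_mono subset_insertI)
  have eB: "e \<in> span (insert b B)"
    unfolding e_def using b0(1) sp by (intro span_diff) (auto simp: span_base)
  have "A (v - (w + t *\<^sub>R e)) s = 0" if s: "s \<in> span (insert b B)" for s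
  proof -
    obtain k where k: "s - k *\<^sub>R b \<in> span B" using s span_breakdown_eq[of s b B] by blast
    define s' where "s' = s - k *\<^sub>R b + k *\<^sub>R b0"
    have s': "s' \<in> span B" unfolding s'_def using k b0(1) by (intro span_add span_scale)
    have ss: "s = s' + k *\<^sub>R e" by (simp add: s'_def e_def algebra_simps)
    have V: "s' \<in> V" "v - w \<in> V" "t *\<^sub>R e \<in> V" "k *\<^sub>R e \<in> V" "v - w - t *\<^sub>R e \<in> V"
      using s' sub ve e by (auto intro!: V_closed)
    have "A (v - (w + t *\<^sub>R e)) s = A (v - w - t *\<^sub>R e) s" by (simp add: algebra_simps)
    also have "\<dots> = A (v - w - t *\<^sub>R e) s' + A (v - w - t *\<^sub>R e) (k *\<^sub>R e)"
      unfolding ss using V by (metis A_add A_sym V_closed(2))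
    also have "A (v - w - t *\<^sub>R e) s' = A (v - w) s' - t * A e s'"
      using V e by (simp add: A_diff A_scale)
    also have "\<dots> = 0" using w(2) b0(2) s' by (simp add: e_def)
    also have "A (v - w - t *\<^sub>R e) (k *\<^sub>R e) = k * A e (v - w - t *\<^sub>R e)"
      using V e by (metis A_scale A_sym)
    also have "A e (v - w - t *\<^sub>R e) = A (v - w) e - t * A e e"
      using V e A_sym[of e "v - w - t *\<^sub>R e"] by (simp add: A_diff A_scale)
    finally show ?thesis using te by simp
  qed
  moreover have "w + t *\<^sub>R e \<in> span (insert b B)"
    using w(1) sp eB by (intro span_add span_scale) auto
  ultimately show ?case by blast
qed

end

locale finite_inner_product = inner_product_on +
  fixes B0 :: "'a set"
  assumes finite_dim: "finite B0" "V \<subseteq> span B0"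
begin

lemma orth_proj:
  assumes "subspace S" "S \<subseteq> V" "v \<in> V"
  shows "orth_proj S v \<in> S" "s \<in> S \<Longrightarrow> A (orth_proj S v) s = A v s"
proof -
  obtain B where B: "B \<subseteq> S" "independent B" "S \<subseteq> span B"
    using maximal_independent_subset by blast
  have fin: "finite B"
    using independent_span_bound[of B0 B] B assms(2) finite_dim by blast
  have S: "span B = S" using B assms(1) by (simp add: span_minimal subset_antisym)
  obtain w where w: "w \<in> S" "\<forall>s\<in>S. A (v - w) s = 0"
    using orth_proj_exists[of B v] fin B assms(2,3) S by auto
  have uniq: "w' = w" if w': "w' \<in> S" "\<forall>s\<in>S. A (v - w') s = 0" for w'
  proof (rule ccontr)
    assume "w' \<noteq> w"
    have V: "v \<in> V" "w \<in> V" "w' \<in> V" using w w' assms by auto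
    have d: "w' - w \<in> S" using w w' assms(1) by (simp add: subspace_diff)
    have "A (w' - w) (w' - w) = A ((v - w) - (v - w')) (w' - w)" by (simp add: algebra_simps)
    also have "\<dots> = 0" using V w w' d by (subst A_diff) (auto intro: V_closed)
    finally show False using A_pos[of "w' - w"] \<open>w' \<noteq> w\<close> V by (auto intro: V_closed)
  qed
  have *: "orth_proj S v = w"
    unfolding orth_proj_def by (rule the_equality) (use w uniq in blast)+
  show "orth_proj S v \<in> S" using * w by simp
  show "A (orth_proj S v) s = A v s" if "s \<in> S"
  proof -
    have "v \<in> V" "w \<in> V" "s \<in> V" using w that assms by auto
    then have "A v s - A w s = 0" using w(2) that A_diff[of v w s] by simp
    then show ?thesis by (simp add: *)
  qed
qed

text \<open>The hypothesis \<open>stab\<close> is local stability with constant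
  \<open>1\<close>. Let \<open>D\<close> be the decrease of the squared norm after the coarse
  correction and \<open>n\<close> colours. By induction on the colours, the total displacement
  satisfies \<open>\<parallel>v - E v\<parallel>\<^sup>2 \<le> (n + 1) D\<close>, and the energies
  of the initial error satisfy \<open>\<parallel>P\<^sub>0 v\<parallel>\<^sup>2 + \<Sum> A (T v) v
  \<le> (1 + n (n + 3) / 2) D\<close>. The stable decomposition bounds
  \<open>\<parallel>v\<parallel>\<^sup>2\<close> by \<open>Csd / \<theta>\<close> times the
  left-hand side, and \<open>n (n + 3) / 2 \<le> 2 n\<^sup>2\<close> for integers
  \<open>n\<close>.\<close>

theorem multiplicative_Schwarz:
  fixes W :: "'j \<Rightarrow> 'a set" and Cl :: "'c \<Rightarrow> 'j set" and \<theta>s :: "'j \<Rightarrow> real"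
  assumes W: "\<And>j. subspace (W j)" "\<And>j. W j \<subseteq> V"
    and W0: "subspace W0" "W0 \<subseteq> V"
    and \<theta>s: "\<And>j. \<theta> \<le> \<theta>s j" "\<And>j. \<theta>s j \<le> 1" and \<theta>: "0 < \<theta>"
    and stab: "\<And>col u. \<forall>j\<in>Cl col. u j \<in> W j \<Longrightarrow>
       A (\<Sum>j\<in>Cl col. u j) (\<Sum>j\<in>Cl col. u j) \<le> (\<Sum>j\<in>Cl col. inverse (\<theta>s j) * A (u j) (u j))"
    and v: "v \<in> V" and v0: "v0 \<in> W0" and w: "\<And>col j. j \<in> Cl col \<Longrightarrow> w j \<in> W j"
    and dec: "v = v0 + (\<Sum>col\<in>set cols. \<Sum>j\<in>Cl col. w j)"
    and Csd: "A v0 v0 + (\<Sum>col\<in>set cols. \<Sum>j\<in>Cl col. A (w j) (w j)) \<le> Csd * A v v" "0 < Csd"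
    and cols: "distinct cols"
  defines "step \<equiv> \<lambda>col v. v - (\<Sum>j\<in>Cl col. \<theta>s j *\<^sub>R orth_proj (W j) v)"
  defines "E \<equiv> \<lambda>cs. foldr (\<lambda>col E. step col \<circ> E) cs (\<lambda>v. v - orth_proj W0 v)"
  shows "E cols v \<in> V"
    and "A (E cols v) (E cols v) \<le> (1 - \<theta> / ((2 * (real (length cols))\<^sup>2 + 1) * Csd)) * A v v"
proof -
  define P where "P = (\<lambda>j. orth_proj (W j))"
  define P0 where "P0 = orth_proj W0"
  define T where "T = (\<lambda>col x. \<Sum>j\<in>Cl col. \<theta>s j *\<^sub>R P j x)"
  define a where "a = (\<lambda>col x. \<Sum>j\<in>Cl col. \<theta>s j * A (P j x) (P j x))"
  have \<theta>pos: "0 < \<theta>s j" for j using \<theta> \<theta>s(1)[of j] by linarith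
  have P: "P j x \<in> W j" "P j x \<in> V" and PA: "s \<in> W j \<Longrightarrow> A (P j x) s = A x s" if "x \<in> V" for j x s
    using orth_proj[OF W that] W(2)[of j] by (auto simp: P_def)
  have P0: "P0 x \<in> V" and P0A: "s \<in> W0 \<Longrightarrow> A (P0 x) s = A x s" "P0 x \<in> W0" if "x \<in> V" for x s
    using orth_proj[OF W0 that] W0(2) by (auto simp: P0_def)
  have T: "T col x \<in> V" if "x \<in> V" for col x
    unfolding T_def using P(2)[OF that] by (intro V_closed)
  have step: "step col x = x - T col x" for col x
    by (simp add: step_def T_def P_def)
  have a_nonneg: "0 \<le> a col x" if "x \<in> V" for col x
    unfolding a_def using that P \<theta>pos by (intro sum_nonneg mult_nonneg_nonneg A_nonneg) (auto intro: less_imp_le)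
  have A_T: "A (T col x) y = (\<Sum>j\<in>Cl col. \<theta>s j * A (P j x) (P j y))" if "x \<in> V" "y \<in> V" for col x y
  proof -
    have "A (P j x) y = A (P j x) (P j y)" for j
      using PA[OF that(2) P(1)[OF that(1)]] P(2) that A_sym by metis
    then show ?thesis unfolding T_def using that P
      by (subst A_sum) (auto simp: A_scale intro: V_closed)
  qed
  have T_small: "A (T col x) (T col x) \<le> a col x" if "x \<in> V" for col x
  proof -
    have "\<forall>j\<in>Cl col. \<theta>s j *\<^sub>R P j x \<in> W j" using P(1)[OF that] W(1) by (auto intro: subspace_scale)
    from stab[OF this] have "A (T col x) (T col x) \<le> (\<Sum>j\<in>Cl col. inverse (\<theta>s j) * A (\<theta>s j *\<^sub>R P j x) (\<theta>s j *\<^sub>R P j x))"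
      by (simp add: T_def)
    also have "\<dots> = a col x" unfolding a_def
    proof (rule sum.cong)
      fix j
      have "A (\<theta>s j *\<^sub>R P j x) (\<theta>s j *\<^sub>R P j x) = \<theta>s j * (\<theta>s j * A (P j x) (P j x))"
        using P(2)[OF that, of j] A_sym[of "P j x" "\<theta>s j *\<^sub>R P j x"] by (simp add: A_scale V_closed)
      then show "inverse (\<theta>s j) * A (\<theta>s j *\<^sub>R P j x) (\<theta>s j *\<^sub>R P j x) = \<theta>s j * A (P j x) (P j x)"
        using \<theta>pos[of j] by simp
    qed simp
    finally show ?thesis .
  qed
  have a_le: "a col x \<le> A x x" if "x \<in> V" for col x
    using Young[OF T[OF that, of col] that, of 1] T_small[OF that, of col] A_T[OF that that, of col]
    by (simp add: a_def)
  have decrease: "A (x - T col x) (x - T col x) \<le> A x x - a col x" if "x \<in> V" for col x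
    using T_small[OF that, of col] A_T[OF that that, of col] T[OF that] that A_sym[of x "T col x"]
    by (simp add: A_square_diff a_def)
  \<comment> \<open>The energy that a colour sees in the initial error \<open>x\<close>, in
    terms of the current error \<open>y\<close> and the displacement \<open>x - y\<close>. The
    weights \<open>1 : n + 1\<close> are those for which the induction below closes.\<close>
  have a_split: "a col x \<le> (n + 2) * (a col y + A (x - y) (x - y) / (n + 1))"
    if xy: "x \<in> V" "y \<in> V" and n: "0 \<le> n" for col x y and n :: real
  proof -
    have z: "x - y \<in> V" using xy by (rule V_closed)
    have beta: "A (T col x) u \<le> t / 2 * a col x + 1 / (2 * t) * a col u" if "u \<in> V" "0 < t" for u t
    proof -
      have "A (T col x) u = (\<Sum>j\<in>Cl col. \<theta>s j * A (P j x) (P j u))" using A_T xy that by simp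
      also have "\<dots> \<le> (\<Sum>j\<in>Cl col. \<theta>s j * (t / 2 * A (P j x) (P j x) + 1 / (2 * t) * A (P j u) (P j u)))"
        using \<theta>pos P xy that by (intro sum_mono mult_left_mono Young) (auto intro: less_imp_le)
      also have "\<dots> = t / 2 * a col x + 1 / (2 * t) * a col u"
        unfolding a_def sum_distrib_left sum.distrib[symmetric] by (intro sum.cong) (auto simp: algebra_simps)
      finally show ?thesis .
    qed
    have "a col x = A (T col x) (y + (x - y))" using A_T[OF xy(1) xy(1)] by (simp add: a_def)
    also have "\<dots> = A (T col x) y + A (T col x) (x - y)"
      using T[OF xy(1), of col] xy(2) z by (metis A_add A_sym V_closed(2))
    also have "\<dots> \<le> (1 / (n + 2)) / 2 * a col x + 1 / (2 * (1 / (n + 2))) * a col y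
        + (((n + 1) / (n + 2)) / 2 * a col x + 1 / (2 * ((n + 1) / (n + 2))) * a col (x - y))"
      using n by (intro add_mono beta xy z) auto
    also have "\<dots> = a col x / 2 + (n + 2) / 2 * (a col y + a col (x - y) / (n + 1))"
      using n by (simp add: divide_simps) (simp add: algebra_simps)
    finally have "a col x \<le> (n + 2) * (a col y + a col (x - y) / (n + 1))"
      unfolding times_divide_eq_left by argo
    also have "\<dots> \<le> (n + 2) * (a col y + A (x - y) (x - y) / (n + 1))"
      using n a_le[OF z, of col] by (intro mult_left_mono add_left_mono divide_right_mono) auto
    finally show ?thesis .
  qed
  have main: "E cs v \<in> V \<and>
      A (v - E cs v) (v - E cs v) \<le> (real (length cs) + 1) * (A v v - A (E cs v) (E cs v)) \<and>
      A (P0 v) (P0 v) + (\<Sum>col\<in>set cs. a col v)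
        \<le> (1 + real (length cs) * (real (length cs) + 3) / 2) * (A v v - A (E cs v) (E cs v))"
    if "distinct cs" for cs
    using that
  proof (induction cs)
    case Nil
    have "A (v - P0 v) (v - P0 v) = A v v - A (P0 v) (P0 v)"
      using v P0[OF v] P0A[OF v] by (simp add: A_square_diff A_sym[of v "P0 v"])
    then show ?case using v P0[OF v] by (simp add: E_def P0_def[symmetric] V_closed)
  next
    case (Cons col cs)
    define x n D D' where "x = E cs v" and "n = real (length cs)"
      and "D = A v v - A x x" and "D' = A v v - A (x - T col x) (x - T col x)"
    have E: "E (col # cs) v = x - T col x" by (simp add: E_def x_def step)
    have x: "x \<in> V" and IH1: "A (v - x) (v - x) \<le> (n + 1) * D"
      and IH2: "A (P0 v) (P0 v) + (\<Sum>col\<in>set cs. a col v) \<le> (1 + n * (n + 3) / 2) * D"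
      using Cons by (auto simp: x_def n_def D_def)
    have n: "0 \<le> n" by (simp add: n_def)
    have z: "v - x \<in> V" "T col x \<in> V" using v x T by (auto intro: V_closed)
    have DD: "D + a col x \<le> D'" using decrease[OF x, of col] by (simp add: D_def D'_def)
    have q: "A (v - x) (v - x) / (n + 1) \<le> D" using IH1 n by (simp add: field_simps)
    have "A (v - (x - T col x)) (v - (x - T col x)) = A (v - x + T col x) (v - x + T col x)"
      by (simp add: algebra_simps)
    also have "\<dots> \<le> A (v - x) (v - x)
        + 2 * ((1 / (n + 1)) / 2 * A (v - x) (v - x) + 1 / (2 * (1 / (n + 1))) * A (T col x) (T col x))
        + A (T col x) (T col x)"
      using Young[OF z, of "1 / (n + 1)"] n unfolding A_square_add[OF z]
      by (intro add_mono mult_left_mono order_refl) auto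
    also have "\<dots> = (n + 2) * (A (v - x) (v - x) / (n + 1) + A (T col x) (T col x))"
      using n by (simp add: divide_simps) (simp add: algebra_simps)
    also have "\<dots> \<le> (n + 2) * D'"
      using n q DD T_small[OF x, of col] by (intro mult_left_mono) auto
    finally have 1: "A (v - (x - T col x)) (v - (x - T col x)) \<le> (n + 2) * D'" .
    have "a col v \<le> (n + 2) * (a col x + A (v - x) (v - x) / (n + 1))"
      by (rule a_split[OF v x n])
    also have "\<dots> \<le> (n + 2) * D'"
      using n q DD by (intro mult_left_mono) auto
    finally have 2: "a col v \<le> (n + 2) * D'" .
    have "(1 + n * (n + 3) / 2) * D \<le> (1 + n * (n + 3) / 2) * D'"
      using n DD a_nonneg[OF x, of col] by (intro mult_left_mono) auto
    then have "A (P0 v) (P0 v) + (\<Sum>col\<in>set (col # cs). a col v)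
        \<le> (1 + n * (n + 3) / 2) * D' + (n + 2) * D'"
      using IH2 2 Cons.prems by simp
    also have "\<dots> = (1 + (n + 1) * ((n + 1) + 3) / 2) * D'" by (simp add: field_simps)
    finally show ?case using 1 x z unfolding E D'_def
      by (simp add: n_def V_closed add.commute)
  qed
  define n D where "n = real (length cols)" and "D = A v v - A (E cols v) (E cols v)"
  define X where "X = A (P0 v) (P0 v) + (\<Sum>col\<in>set cols. a col v)"
  have v0V: "v0 \<in> V" and wV: "\<And>col j. j \<in> Cl col \<Longrightarrow> w j \<in> V" using v0 w W W0 by blast+
  \<comment> \<open>With this weight in Young's inequality exactly half of \<open>A v
    v\<close> is absorbed into the left-hand side.\<close>
  define t where "t = Csd / \<theta>"
  have t: "0 < t" using Csd \<theta> by (simp add: t_def)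
  have "A v v = A (v0 + (\<Sum>col\<in>set cols. \<Sum>j\<in>Cl col. w j)) v" using dec by simp
  also have "\<dots> = A v0 v + (\<Sum>col\<in>set cols. \<Sum>j\<in>Cl col. A (w j) v)"
    using v v0V wV
    by (simp add: A_add A_sum[of "set cols" "\<lambda>col. sum w (Cl col)"] A_sum[of _ w] V_closed)
  also have "\<dots> = A (P0 v) v0 + (\<Sum>col\<in>set cols. \<Sum>j\<in>Cl col. A (P j v) (w j))"
  proof (intro arg_cong2[of _ _ _ _ "(+)"] sum.cong refl)
    show "A v0 v = A (P0 v) v0" using P0A(1)[OF v v0] A_sym[OF v0V v] by simp
    show "A (w j) v = A (P j v) (w j)" if "j \<in> Cl col" for col j
      using PA[OF v w[OF that]] A_sym[OF wV[OF that] v] by simp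
  qed
  also have "\<dots> \<le> (t / 2 * A (P0 v) (P0 v) + 1 / (2 * t) * (A v0 v0 / \<theta>)) +
      (\<Sum>col\<in>set cols. \<Sum>j\<in>Cl col. t / 2 * (\<theta>s j * A (P j v) (P j v)) + 1 / (2 * t) * (A (w j) (w j) / \<theta>))"
  proof (intro add_mono sum_mono)
    have \<theta>1: "\<theta> \<le> 1" using \<theta>s[of undefined] by linarith
    have "A v0 v0 * \<theta> \<le> A v0 v0 * 1" using A_nonneg[OF v0V] \<theta>1 by (intro mult_left_mono)
    then have "A v0 v0 \<le> A v0 v0 / \<theta>" using \<theta> by (simp add: field_simps)
    then have "1 / (2 * t) * A v0 v0 \<le> 1 / (2 * t) * (A v0 v0 / \<theta>)"
      using t by (intro mult_left_mono) auto
    then show "A (P0 v) v0 \<le> t / 2 * A (P0 v) (P0 v) + 1 / (2 * t) * (A v0 v0 / \<theta>)"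
      using Young[OF P0[OF v] v0V t] by linarith
    fix col j assume j: "j \<in> Cl col"
    have "0 < t * \<theta>s j" using t \<theta>pos by simp
    from Young[OF P(2)[OF v] wV[OF j] this]
    have "A (P j v) (w j) \<le> t * \<theta>s j / 2 * A (P j v) (P j v) + 1 / (2 * (t * \<theta>s j)) * A (w j) (w j)" .
    also have "1 / (2 * (t * \<theta>s j)) * A (w j) (w j) = 1 / (2 * t) * (A (w j) (w j) / \<theta>s j)" by simp
    also have "\<dots> \<le> 1 / (2 * t) * (A (w j) (w j) / \<theta>)"
      using t \<theta> \<theta>s(1)[of j] A_nonneg[OF wV[OF j]] by (intro mult_left_mono divide_left_mono) auto
    finally show "A (P j v) (w j) \<le> t / 2 * (\<theta>s j * A (P j v) (P j v)) + 1 / (2 * t) * (A (w j) (w j) / \<theta>)"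
      by (simp add: mult.assoc)
  qed
  also have "\<dots> = t / 2 * X + 1 / (2 * t) * ((A v0 v0 + (\<Sum>col\<in>set cols. \<Sum>j\<in>Cl col. A (w j) (w j))) / \<theta>)"
    unfolding X_def a_def
    by (simp add: sum.distrib sum_distrib_left sum_divide_distrib add_divide_distrib algebra_simps)
  also have "\<dots> \<le> t / 2 * X + 1 / (2 * t) * (Csd * A v v / \<theta>)"
    using t \<theta> Csd(1) by (intro add_left_mono mult_left_mono divide_right_mono) auto
  also have "\<dots> = t / 2 * X + A v v / 2" using Csd(2) \<theta> by (simp add: t_def)
  finally have "A v v \<le> t * X" by simp
  also have X: "X \<le> (1 + n * (n + 3) / 2) * D"
    using main[OF cols] by (simp add: X_def n_def D_def)
  then have "t * X \<le> t * ((1 + n * (n + 3) / 2) * D)" using t by (intro mult_left_mono) auto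
  also have "\<dots> \<le> t * ((2 * n\<^sup>2 + 1) * D)"
  proof -
    have "0 \<le> X" unfolding X_def using a_nonneg[OF v] A_nonneg[OF P0[OF v]] by (intro add_nonneg_nonneg sum_nonneg) auto
    then have "0 \<le> (1 + n * (n + 3) / 2) * D" using X by linarith
    moreover have "0 < 1 + n * (n + 3) / 2" by (simp add: n_def add_pos_nonneg)
    ultimately have "0 \<le> D" by (simp add: zero_le_mult_iff)
    moreover have "1 + n * (n + 3) / 2 \<le> 2 * n\<^sup>2 + 1"
    proof (cases "cols = []")
      case False
      then have "1 \<le> n" by (simp add: n_def Suc_le_eq)
      then have "n * 1 \<le> n * n" by (intro mult_left_mono) auto
      then show ?thesis by (simp add: power2_eq_square field_simps)
    qed (simp add: n_def)
    ultimately show ?thesis using t by (intro mult_left_mono mult_right_mono) auto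
  qed
  finally have "A v v * \<theta> \<le> Csd * ((2 * n\<^sup>2 + 1) * D)" using \<theta> by (simp add: t_def field_simps)
  moreover have "0 < (2 * n\<^sup>2 + 1) * Csd" using Csd by (simp add: add_nonneg_pos)
  ultimately have "\<theta> / ((2 * n\<^sup>2 + 1) * Csd) * A v v \<le> D" by (simp add: field_simps)
  then show "A (E cols v) (E cols v) \<le> (1 - \<theta> / ((2 * (real (length cols))\<^sup>2 + 1) * Csd)) * A v v"
    by (simp add: n_def D_def algebra_simps)
  show "E cols v \<in> V" using main[OF cols] by simp
qed

end

section \<open>Hausdorff measure as a Borel measure\<close>

text \<open>Caratheodory's criterion. For a closed set \<open>F\<close>, the part of
  \<open>X\<close> at distance at least \<open>1 / (n + 1)\<close> from \<open>F\<close> is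
  separated from \<open>X \<inter> F\<close>, so only the thin remainder has to be shown to have
  small outer measure. It is a union of rings \<open>R\<close>; rings of equal parity are
  separated from each other, so the sum of their outer measures is at most \<open>2 f X\<close>
  and its tail tends to zero.\<close>

lemma metric_outer_measure_borel:
  fixes f :: "'a::metric_space set \<Rightarrow> ennreal"
  assumes outer: "outer_measure_space UNIV f"
    and sep: "\<And>A B r. 0 < r \<Longrightarrow> (\<And>a b. a \<in> A \<Longrightarrow> b \<in> B \<Longrightarrow> r \<le> dist a b) \<Longrightarrow> f A + f B \<le> f (A \<union> B)"
  shows "measure_space UNIV (sets borel) f"
proof -
  have f0: "f {} = 0" and mono: "\<And>A B. A \<subseteq> B \<Longrightarrow> f A \<le> f B"
    and csub: "countably_subadditive UNIV f"
    using outer by (auto simp: outer_measure_space_def positive_def increasing_def)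
  interpret Pow: sigma_algebra UNIV "UNIV :: 'a set set"
    using sigma_algebra_Pow[of "UNIV :: 'a set"] by simp
  have sub: "f (A \<union> B) \<le> f A + f B" for A B
  proof -
    have "subadditive UNIV f"
      by (rule Pow.countably_subadditive_subadditive[OF _ csub]) (simp add: positive_def f0)
    then have "f (A \<union> (B - A)) \<le> f A + f (B - A)" unfolding subadditive_def by blast
    also have "\<dots> \<le> f A + f B" by (intro add_left_mono mono) auto
    finally show ?thesis by simp
  qed
  have usub: "f (\<Union>n. A n) \<le> (\<Sum>n. f (A n))" for A :: "nat \<Rightarrow> 'a set"
  proof -
    have "f (\<Union>n. disjointed A n) \<le> (\<Sum>n. f (disjointed A n))"
      using csub disjoint_family_disjointed[of A] by (auto simp: countably_subadditive_def)
    also have "\<dots> \<le> (\<Sum>n. f (A n))" by (intro suminf_le mono disjointed_subset) auto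
    finally show ?thesis by (simp add: UN_disjointed_eq)
  qed
  have closed: "F \<in> lambda_system UNIV UNIV f" if F: "closed F" for F
  proof (cases "F = {}")
    case True
    then show ?thesis by (simp add: lambda_system_def f0)
  next
    case False
    have "f (X \<inter> F) + f (X - F) \<le> f X" for X
    proof (cases "f X = \<infinity>")
      case True
      then show ?thesis by simp
    next
      case fin: False
      define Y where "Y = (\<lambda>n::nat. {x \<in> X. 1 / real (n + 1) \<le> infdist x F})"
      define R where "R = (\<lambda>n. Y (Suc n) - Y n)"
      have Y_mono: "Y m \<subseteq> Y n" if "m \<le> n" for m n
      proof -
        have "1 / real (n + 1) \<le> 1 / real (m + 1)" using that by (intro divide_left_mono) auto
        then show ?thesis by (auto simp: Y_def)
      qed
      have sepR: "f A + f (R n) \<le> f (A \<union> R n)" if "A \<subseteq> Y m" "m < n" for A m n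
      proof (rule sep[of "1 / real (m + 1) - 1 / real (n + 1)"])
        show "0 < 1 / real (m + 1) - 1 / real (n + 1)" using that by (simp add: frac_less2)
        fix a b assume ab: "a \<in> A" "b \<in> R n"
        then have "1 / real (m + 1) \<le> infdist a F" using that by (auto simp: Y_def)
        moreover have "infdist b F < 1 / real (n + 1)" using ab by (auto simp: Y_def R_def)
        ultimately show "1 / real (m + 1) - 1 / real (n + 1) \<le> dist a b"
          using infdist_triangle[of a F b] by linarith
      qed
      \<comment> \<open>Rings whose indices differ by at least two lie at a positive distance;
        \<open>i\<close> selects the parity.\<close>
      have alternate: "(\<Sum>k<K. f (R (2 * k + i))) \<le> f (\<Union>k<K. R (2 * k + i))" for K i
      proof (induction K)
        case (Suc K)
        show ?case
        proof (cases "K = 0")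
          case True
          then show ?thesis by (simp add: lessThan_Suc)
        next
          case False
          have "(\<Union>k<K. R (2 * k + i)) \<subseteq> Y (2 * K + i - 1)"
          proof (intro UN_least)
            fix k assume "k \<in> {..<K}"
            then have "Suc (2 * k + i) \<le> 2 * K + i - 1" by auto
            then show "R (2 * k + i) \<subseteq> Y (2 * K + i - 1)" using Y_mono by (auto simp: R_def)
          qed
          from sepR[OF this, of "2 * K + i"] False Suc show ?thesis
            by (simp add: lessThan_Suc Un_commute add.commute)
               (meson add_left_mono order_trans)
        qed
      qed (simp add: f0)
      have half: "(\<Sum>k<K. f (R (2 * k + i))) \<le> f X" for K i
        by (rule order_trans[OF alternate]) (auto intro!: mono simp: R_def Y_def)
      have partial: "(\<Sum>k<N. f (R k)) \<le> 2 * f X" for N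
      proof -
        have "(\<Sum>k<N. f (R k)) \<le> (\<Sum>k<2 * N. f (R k))" by (intro sum_mono2) auto
        also have "\<dots> = (\<Sum>k<N. f (R (2 * k + 0))) + (\<Sum>k<N. f (R (2 * k + 1)))"
          by (induction N) (auto simp: algebra_simps)
        also have "\<dots> \<le> f X + f X" by (intro add_mono half)
        finally show ?thesis by (simp add: mult_2)
      qed
      have fR: "f (R k) < \<infinity>" for k
      proof -
        have "R k \<subseteq> X" by (auto simp: R_def Y_def)
        from mono[OF this] fin show ?thesis by (metis infinity_ennreal_def le_less_trans less_top)
      qed
      define r where "r = (\<lambda>k. enn2real (f (R k)))"
      have r: "f (R k) = ennreal (r k)" "0 \<le> r k" for k using fR[of k] by (auto simp: r_def)
      have fX: "f X = ennreal (enn2real (f X))" using fin by (simp add: less_top)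
      have "summable r"
      proof (rule summableI_nonneg_bounded[of _ "2 * enn2real (f X)"])
        fix n
        have "ennreal (\<Sum>k<n. r k) = (\<Sum>k<n. f (R k))" using r by simp
        also have "\<dots> \<le> ennreal (2 * enn2real (f X))"
          using partial[of n] fX by (simp add: ennreal_mult)
        finally show "(\<Sum>k<n. r k) \<le> 2 * enn2real (f X)" by (simp add: ennreal_le_iff)
      qed (rule r)
      show ?thesis
      proof (rule ennreal_le_epsilon)
        fix e :: real assume e: "0 < e"
        obtain N where N: "norm (\<Sum>i. r (i + N)) < e"
          using suminf_exist_split[OF e \<open>summable r\<close>] by blast
        have "X - F \<subseteq> Y N \<union> (\<Union>m. R (m + N))"
        proof
          fix x assume x: "x \<in> X - F"
          then have "0 < infdist x F" using F False in_closed_iff_infdist_zero infdist_nonneg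
            by (metis DiffD2 less_eq_real_def)
          then obtain n where n: "1 / real (n + 1) \<le> infdist x F"
            using reals_Archimedean[of "infdist x F"] by (auto simp: inverse_eq_divide intro: less_imp_le)
          define k where "k = (LEAST k. x \<in> Y k)"
          have k: "x \<in> Y k" unfolding k_def using x n by (intro LeastI[of "\<lambda>k. x \<in> Y k" n]) (auto simp: Y_def)
          show "x \<in> Y N \<union> (\<Union>m. R (m + N))"
          proof (cases "k \<le> N")
            case True
            then show ?thesis using Y_mono k by blast
          next
            case False
            then obtain m where m: "k = Suc (m + N)" by (metis add.commute less_imp_Suc_add linorder_not_le)
            have "x \<notin> Y (m + N)" using not_less_Least[of "m + N" "\<lambda>k. x \<in> Y k"] m by (simp add: k_def)
            then show ?thesis using k m by (auto simp: R_def)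
          qed
        qed
        then have "f (X - F) \<le> f (Y N \<union> (\<Union>m. R (m + N)))" by (rule mono)
        also have "\<dots> \<le> f (Y N) + (\<Sum>m. f (R (m + N)))"
          by (rule order_trans[OF sub]) (intro add_left_mono usub)
        also have "(\<Sum>m. f (R (m + N))) = ennreal (\<Sum>m. r (m + N))"
          unfolding r using \<open>summable r\<close> r(2) by (intro suminf_ennreal2) (auto simp: summable_iff_shift)
        also have "\<dots> \<le> ennreal e" using N by (intro ennreal_leI) auto
        finally have "f (X \<inter> F) + f (X - F) \<le> f (X \<inter> F) + f (Y N) + e"
          by (simp add: add.assoc add_left_mono)
        also have "f (X \<inter> F) + f (Y N) \<le> f (X \<inter> F \<union> Y N)"
        proof (rule sep[of "1 / real (N + 1)"])
          fix a b assume "a \<in> X \<inter> F" "b \<in> Y N"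
          then show "1 / real (N + 1) \<le> dist a b"
            using infdist_le[of a F b] by (auto simp: Y_def dist_commute)
        qed simp
        also have "\<dots> \<le> f X" by (rule mono) (auto simp: Y_def)
        finally show "f (X \<inter> F) + f (X - F) \<le> f X + ennreal e" by (simp add: add_right_mono)
      qed
    qed
    moreover have "f X \<le> f (X \<inter> F) + f (X - F)" for X
      using sub[of "X \<inter> F" "X - F"] by (simp add: Int_Diff_Un)
    ultimately show ?thesis
      by (auto simp: Pow.lambda_system_eq intro: antisym)
  qed
  have ms: "measure_space UNIV (lambda_system UNIV UNIV f) f"
    by (rule Pow.caratheodory_lemma[OF outer])
  then interpret L: sigma_algebra UNIV "lambda_system UNIV UNIV f"
    by (simp add: measure_space_def)
  have "sigma_sets UNIV (Collect closed) \<subseteq> lambda_system UNIV UNIV f"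
    using closed by (intro L.sigma_sets_subset) auto
  then have "sets borel \<subseteq> lambda_system UNIV UNIV f" by (simp add: borel_eq_closed)
  then show ?thesis
    using ms by (rule measure_down[rotated 2]) (metis sets.sigma_algebra_axioms space_borel)
qed

definition hausdorff_outer :: "nat \<Rightarrow> 'a::metric_space set \<Rightarrow> ennreal" where
  "hausdorff_outer s A = (SUP \<delta>\<in>{0<..}. hausdorff_pre s \<delta> A)"

text \<open>Requiring \<open>1 \<le> s\<close> where this is used makes the gauge of the empty
  set zero; for \<open>s = 0\<close> it would be \<open>1\<close> because \<open>0 ^ 0 =
  1\<close>.\<close>

definition hausdorff_gauge :: "nat \<Rightarrow> 'a::metric_space set \<Rightarrow> ennreal" where
  "hausdorff_gauge s C = ennreal (unit_ball_vol (real s) * (diameter C / 2) ^ s)"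

lemma hausdorff_gauge_empty: "1 \<le> s \<Longrightarrow> hausdorff_gauge s {} = 0"
  by (simp add: hausdorff_gauge_def power_0_left)

lemma hausdorff_pre_le:
  assumes "A \<subseteq> (\<Union>i. C i)" "\<And>i. bounded (C i)" "\<And>i. diameter (C i) \<le> \<delta>"
  shows "hausdorff_pre s \<delta> A \<le> (\<Sum>i. hausdorff_gauge s (C i))"
  unfolding hausdorff_pre_def hausdorff_gauge_def using assms by (intro INF_lower) auto

lemma hausdorff_pre_approx:
  assumes "hausdorff_pre s \<delta> A < e"
  obtains C :: "nat \<Rightarrow> 'a::metric_space set" where "A \<subseteq> (\<Union>i. C i)" "\<And>i. bounded (C i)" "\<And>i. diameter (C i) \<le> \<delta>"
    "(\<Sum>i. hausdorff_gauge s (C i)) < e"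
  using assms unfolding hausdorff_pre_def hausdorff_gauge_def INF_less_iff by auto

lemma hausdorff_pre_greatest:
  assumes "\<And>C. A \<subseteq> (\<Union>i. C i) \<Longrightarrow> (\<And>i. bounded (C i)) \<Longrightarrow> (\<And>i. diameter (C i) \<le> \<delta>) \<Longrightarrow>
     x \<le> (\<Sum>i. hausdorff_gauge s (C i))"
  shows "x \<le> hausdorff_pre s \<delta> (A :: 'a::metric_space set)"
  unfolding hausdorff_pre_def using assms by (intro INF_greatest) (auto simp: hausdorff_gauge_def)

lemma hausdorff_pre_finite_cover:
  fixes C :: "'i \<Rightarrow> 'a::metric_space set"
  assumes s: "1 \<le> s" and "finite I" "A \<subseteq> (\<Union>i\<in>I. C i)" "\<And>i. i \<in> I \<Longrightarrow> bounded (C i)"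
    "\<And>i. i \<in> I \<Longrightarrow> diameter (C i) \<le> \<delta>" "0 \<le> \<delta>"
  shows "hausdorff_pre s \<delta> A \<le> (\<Sum>i\<in>I. hausdorff_gauge s (C i))"
proof -
  obtain h where h: "bij_betw h {..<card I} I"
    using ex_bij_betw_nat_finite[OF \<open>finite I\<close>] by (auto simp: atLeast0LessThan)
  define D where "D = (\<lambda>n. if n < card I then C (h n) else {})"
  have hI: "h n \<in> I" if "n < card I" for n using h that by (auto simp: bij_betw_def)
  have "A \<subseteq> (\<Union>n. D n)"
  proof
    fix x assume "x \<in> A"
    then obtain i where i: "i \<in> I" "x \<in> C i" using assms by auto
    then obtain n where "n < card I" "h n = i" using h unfolding bij_betw_def by (metis imageE lessThan_iff)
    then show "x \<in> (\<Union>n. D n)" using i by (auto simp: D_def)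
  qed
  then have "hausdorff_pre s \<delta> A \<le> (\<Sum>n. hausdorff_gauge s (D n))"
    using assms hI by (intro hausdorff_pre_le) (auto simp: D_def)
  also have "\<dots> = (\<Sum>n<card I. hausdorff_gauge s (D n))"
    using s by (intro suminf_finite) (auto simp: D_def hausdorff_gauge_empty)
  also have "\<dots> = (\<Sum>n<card I. hausdorff_gauge s (C (h n)))" by (simp add: D_def)
  also have "\<dots> = (\<Sum>i\<in>I. hausdorff_gauge s (C i))"
    by (rule sum.reindex_bij_betw[OF h])
  finally show ?thesis .
qed

lemma hausdorff_pre_mono: "A \<subseteq> B \<Longrightarrow> hausdorff_pre s \<delta> A \<le> hausdorff_pre s \<delta> B"
  unfolding hausdorff_pre_def by (rule INF_superset_mono) auto

lemma hausdorff_pre_subadditive: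
  fixes A :: "nat \<Rightarrow> 'a::metric_space set"
  shows "hausdorff_pre s \<delta> (\<Union>n. A n) \<le> (\<Sum>n. hausdorff_pre s \<delta> (A n))"
proof (rule ennreal_le_epsilon)
  fix e :: real assume e: "0 < e" and fin: "(\<Sum>n. hausdorff_pre s \<delta> (A n)) < top"
  have "\<exists>C. A n \<subseteq> (\<Union>i. C i) \<and> (\<forall>i. bounded (C i) \<and> diameter (C i) \<le> \<delta>) \<and>
      (\<Sum>i. hausdorff_gauge s (C i)) \<le> hausdorff_pre s \<delta> (A n) + e * (1/2)^Suc n" for n
  proof -
    have "hausdorff_pre s \<delta> (A n) < hausdorff_pre s \<delta> (A n) + e * (1/2)^Suc n"
      using e ennreal_suminf_lessD[OF fin, of n] by auto
    from hausdorff_pre_approx[OF this] show ?thesis by (metis less_imp_le)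
  qed
  then obtain C :: "nat \<Rightarrow> nat \<Rightarrow> 'a set" where C: "\<And>n. A n \<subseteq> (\<Union>i. C n i)"
    "\<And>n i. bounded (C n i)" "\<And>n i. diameter (C n i) \<le> \<delta>"
    "\<And>n. (\<Sum>i. hausdorff_gauge s (C n i)) \<le> hausdorff_pre s \<delta> (A n) + e * (1/2)^Suc n"
    by metis
  define D where "D = case_prod C \<circ> prod_decode"
  have "(\<Union>n. A n) \<subseteq> (\<Union>i. D i)"
    using C(1) by (auto simp: D_def subset_eq) (metis prod.case prod_encode_inverse)
  then have "hausdorff_pre s \<delta> (\<Union>n. A n) \<le> (\<Sum>i. hausdorff_gauge s (D i))"
    using C by (intro hausdorff_pre_le) (auto simp: D_def split: prod.split)
  also have "\<dots> = (\<Sum>n. \<Sum>i. hausdorff_gauge s (C n i))"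
    using suminf_ennreal_2dimen[of "\<lambda>n. \<Sum>i. hausdorff_gauge s (C n i)" "\<lambda>x. hausdorff_gauge s (case_prod C x)"]
    by (simp add: D_def comp_def)
  also have "\<dots> \<le> (\<Sum>n. hausdorff_pre s \<delta> (A n) + e * (1/2) ^ Suc n)"
    by (intro suminf_le C) auto
  also have "\<dots> = (\<Sum>n. hausdorff_pre s \<delta> (A n)) + (\<Sum>n. ennreal e * ennreal ((1/2) ^ Suc n))"
    using e by (subst suminf_add[symmetric]) (auto simp del: ennreal_suminf_cmult simp add: ennreal_mult[symmetric])
  also have "\<dots> = (\<Sum>n. hausdorff_pre s \<delta> (A n)) + e"
    unfolding ennreal_suminf_cmult
    by (subst suminf_ennreal_eq[OF zero_le_power power_half_series]) auto
  finally show "hausdorff_pre s \<delta> (\<Union>n. A n) \<le> (\<Sum>n. hausdorff_pre s \<delta> (A n)) + e" .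
qed

text \<open>A covering set of diameter at most \<open>\<delta> < r\<close> cannot meet both
  \<open>A\<close> and \<open>B\<close>, so a cover of the union splits into covers of the two
  parts.\<close>

lemma hausdorff_pre_separated:
  fixes A B :: "'a::metric_space set"
  assumes s: "1 \<le> s" and \<delta>: "0 < \<delta>" "\<delta> < r" and r: "\<And>a b. a \<in> A \<Longrightarrow> b \<in> B \<Longrightarrow> r \<le> dist a b"
  shows "hausdorff_pre s \<delta> A + hausdorff_pre s \<delta> B \<le> hausdorff_pre s \<delta> (A \<union> B)"
proof (rule hausdorff_pre_greatest)
  fix C :: "nat \<Rightarrow> 'a set"
  assume C: "A \<union> B \<subseteq> (\<Union>i. C i)" "\<And>i. bounded (C i)" "\<And>i. diameter (C i) \<le> \<delta>"
  define restr where "restr = (\<lambda>S i. if C i \<inter> S = {} then {} else C i)"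
  have pre: "hausdorff_pre s \<delta> S \<le> (\<Sum>i. hausdorff_gauge s (restr S i))" if "S \<subseteq> (\<Union>i. C i)" for S
  proof (rule hausdorff_pre_le)
    show "S \<subseteq> (\<Union>i. restr S i)"
    proof
      fix x assume x: "x \<in> S"
      then obtain i where "x \<in> C i" using \<open>S \<subseteq> (\<Union>i. C i)\<close> by blast
      with x have "x \<in> restr S i" by (auto simp: restr_def)
      then show "x \<in> (\<Union>i. restr S i)" by blast
    qed
  qed (use C \<delta> in \<open>auto simp: restr_def\<close>)
  have "hausdorff_gauge s (restr A i) + hausdorff_gauge s (restr B i) \<le> hausdorff_gauge s (C i)" for i
  proof -
    have "C i \<inter> A = {} \<or> C i \<inter> B = {}"
    proof (rule ccontr)
      assume "\<not> ?thesis"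
      then obtain a b where "a \<in> C i" "a \<in> A" "b \<in> C i" "b \<in> B" by auto
      then show False
        using r[of a b] diameter_bounded_bound[OF C(2), of a i b] C(3)[of i] \<delta> by auto
    qed
    then show ?thesis using s by (auto simp: restr_def hausdorff_gauge_empty)
  qed
  then have "(\<Sum>i. hausdorff_gauge s (restr A i) + hausdorff_gauge s (restr B i)) \<le> (\<Sum>i. hausdorff_gauge s (C i))"
    by (intro suminf_le) auto
  then have "(\<Sum>i. hausdorff_gauge s (restr A i)) + (\<Sum>i. hausdorff_gauge s (restr B i)) \<le> (\<Sum>i. hausdorff_gauge s (C i))"
    by (simp add: suminf_add)
  then show "hausdorff_pre s \<delta> A + hausdorff_pre s \<delta> B \<le> (\<Sum>i. hausdorff_gauge s (C i))"
    using C(1) by (elim order_trans[rotated]) (intro add_mono pre; auto)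
qed

lemma hausdorff_pre_antimono: "\<delta> \<le> \<delta>' \<Longrightarrow> hausdorff_pre s \<delta>' A \<le> hausdorff_pre s \<delta> A"
  unfolding hausdorff_pre_def by (rule INF_superset_mono) (auto intro: order_trans)

lemma outer_measure_space_hausdorff:
  assumes "1 \<le> s"
  shows "outer_measure_space UNIV (hausdorff_outer s :: 'a::metric_space set \<Rightarrow> ennreal)"
  unfolding outer_measure_space_def
proof (intro conjI)
  have "hausdorff_pre s \<delta> ({} :: 'a set) \<le> 0" if "0 < \<delta>" for \<delta>
    using hausdorff_pre_le[of "{}" "\<lambda>_. {}" \<delta> s] that assms by (simp add: hausdorff_gauge_empty)
  then have "hausdorff_outer s ({} :: 'a set) \<le> 0"
    unfolding hausdorff_outer_def by (intro SUP_least) auto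
  then show "positive UNIV (hausdorff_outer s :: 'a set \<Rightarrow> ennreal)" by (simp add: positive_def)
  show "increasing UNIV (hausdorff_outer s :: 'a set \<Rightarrow> ennreal)"
    unfolding increasing_def hausdorff_outer_def by (auto intro!: SUP_mono' hausdorff_pre_mono)
  show "countably_subadditive UNIV (hausdorff_outer s :: 'a set \<Rightarrow> ennreal)"
    unfolding countably_subadditive_def
  proof (intro allI impI)
    fix A :: "nat \<Rightarrow> 'a set"
    show "hausdorff_outer s (\<Union>n. A n) \<le> (\<Sum>n. hausdorff_outer s (A n))"
      unfolding hausdorff_outer_def
    proof (rule SUP_least)
      fix \<delta> :: real assume "\<delta> \<in> {0<..}"
      then show "hausdorff_pre s \<delta> (\<Union>n. A n) \<le> (\<Sum>n. SUP \<delta>\<in>{0<..}. hausdorff_pre s \<delta> (A n))"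
        by (intro order_trans[OF hausdorff_pre_subadditive] suminf_le SUP_upper) auto
    qed
  qed
qed

lemma hausdorff_outer_separated:
  fixes A B :: "'a::metric_space set"
  assumes s: "1 \<le> s" and r: "0 < r" "\<And>a b. a \<in> A \<Longrightarrow> b \<in> B \<Longrightarrow> r \<le> dist a b"
  shows "hausdorff_outer s A + hausdorff_outer s B \<le> hausdorff_outer s (A \<union> B)"
proof -
  have "hausdorff_pre s \<delta> A + hausdorff_pre s \<delta>' B \<le> hausdorff_outer s (A \<union> B)"
    if \<delta>: "0 < \<delta>" "0 < \<delta>'" for \<delta> \<delta>'
  proof -
    define \<eta> where "\<eta> = min (min \<delta> \<delta>') (r / 2)"
    have \<eta>: "0 < \<eta>" "\<eta> < r" "\<eta> \<le> \<delta>" "\<eta> \<le> \<delta>'"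
      using \<delta> r(1) by (simp_all add: \<eta>_def min_less_iff_disj)
    have "hausdorff_pre s \<delta> A + hausdorff_pre s \<delta>' B \<le> hausdorff_pre s \<eta> A + hausdorff_pre s \<eta> B"
      using \<eta> by (intro add_mono hausdorff_pre_antimono)
    also have "\<dots> \<le> hausdorff_pre s \<eta> (A \<union> B)"
      using hausdorff_pre_separated[OF s \<eta>(1,2)] r by blast
    also have "\<dots> \<le> hausdorff_outer s (A \<union> B)"
      unfolding hausdorff_outer_def using \<eta> by (intro SUP_upper) auto
    finally show ?thesis .
  qed
  then have "hausdorff_pre s \<delta> A + hausdorff_outer s B \<le> hausdorff_outer s (A \<union> B)" if "0 < \<delta>" for \<delta>
    unfolding hausdorff_outer_def[of s B] using that
    by (subst ennreal_SUP_add_right) (auto intro!: SUP_least)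
  then show ?thesis
    unfolding hausdorff_outer_def[of s A]
    by (subst ennreal_SUP_add_left[symmetric]) (auto intro!: SUP_least)
qed

lemma sets_hausdorff_measure [measurable_cong]: "sets (hausdorff_measure s) = sets borel"
  unfolding hausdorff_measure_def by (metis sets.sigma_sets_eq sets_measure_of_conv space_borel sets.space_closed)

lemma emeasure_hausdorff_measure:
  fixes A :: "'a::metric_space set"
  assumes "1 \<le> s" "A \<in> sets borel"
  shows "emeasure (hausdorff_measure s) A = hausdorff_outer s A"
proof -
  have "measure_space UNIV (sets borel) (hausdorff_outer s :: 'a set \<Rightarrow> ennreal)"
    using metric_outer_measure_borel outer_measure_space_hausdorff hausdorff_outer_separated assms(1) by blast
  then show ?thesis
    using assms(2) unfolding hausdorff_measure_def hausdorff_outer_def[abs_def]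
    by (simp add: emeasure_measure_of_sigma measure_space_def)
qed

section \<open>Boundary measure and outward normal of a C2 domain\<close>

text \<open>On such a set the coordinate \<open>i\<close> is a Lipschitz function of the others.
  Cutting the other \<open>s = CARD('d) - 1\<close> coordinates into \<open>N\<close> intervals
  each gives \<open>N ^ s\<close> pieces of diameter at most \<open>c / N\<close>, and the powers
  of \<open>N\<close> cancel in the gauge sum.\<close>

lemma hausdorff_outer_Lipschitz_finite:
  fixes S :: "(real ^ 'd) set"
  assumes dim: "2 \<le> CARD('d)" and S: "bounded S" and L: "0 \<le> L"
    and lip: "\<And>y y'. y \<in> S \<Longrightarrow> y' \<in> S \<Longrightarrow> \<bar>y $ i - y' $ i\<bar> \<le> L * (\<Sum>k\<in>UNIV - {i}. \<bar>y $ k - y' $ k\<bar>)"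
  shows "hausdorff_outer (CARD('d) - 1) S < \<infinity>"
proof -
  define s where "s = CARD('d) - 1"
  have s: "1 \<le> s" "card (UNIV - {i}) = s" using dim by (auto simp: s_def)
  obtain R0 where R0: "\<And>y. y \<in> S \<Longrightarrow> norm y \<le> R0" using S by (auto simp: bounded_iff)
  define R where "R = \<bar>R0\<bar> + 1"
  have R: "0 < R" "\<bar>y $ k\<bar> < R" if "y \<in> S" for y k
    using R0[OF that] component_le_norm_cart[of y k] by (auto simp: R_def)
  have Rpos: "0 < R" by (simp add: R_def)
  define c where "c = (1 + L) * (real s * (2 * R))"
  have c: "0 < c" using s L Rpos by (simp add: c_def add_pos_nonneg)
  define K where "K = unit_ball_vol (real s) * (c / 2) ^ s"
  have "hausdorff_pre s \<delta> S \<le> ennreal K" if \<delta>: "0 < \<delta>" for \<delta>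
  proof -
    obtain N0 :: nat where N0: "c / \<delta> \<le> real N0" using real_arch_simple by blast
    \<comment> \<open>Large enough that the pieces have diameter at most
      \<open>\<delta>\<close>.\<close>
    define N where "N = max 1 N0"
    have N: "1 \<le> N" "c / real N \<le> \<delta>"
    proof -
      show "1 \<le> N" by (simp add: N_def)
      have "c / \<delta> \<le> real N" using N0 by (simp add: N_def)
      then show "c / real N \<le> \<delta>" using \<delta> \<open>1 \<le> N\<close> by (simp add: field_simps)
    qed
    define t where "t = (\<lambda>(y::real^'d) k. (y $ k + R) * real N / (2 * R))"
    define I where "I = PiE (UNIV - {i}) (\<lambda>_. {..<N})"
    define C where "C = (\<lambda>m. {y \<in> S. \<forall>k\<in>UNIV - {i}. nat \<lfloor>t y k\<rfloor> = m k})"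
    have t: "0 \<le> t y k" "t y k < real N" if "y \<in> S" for y k
    proof -
      have y: "-R < y $ k" "y $ k < R" using R(2)[OF that, of k] by auto
      then show "0 \<le> t y k" using Rpos by (simp add: t_def)
      have "(y $ k + R) * real N < (2 * R) * real N" using y N by (intro mult_strict_right_mono) auto
      then show "t y k < real N" using Rpos by (simp add: t_def divide_less_eq mult.commute)
    qed
    have finI: "finite I" by (simp add: I_def finite_PiE)
    have cardI: "card I = N ^ s" by (simp add: I_def card_PiE s(2))
    have cover: "S \<subseteq> (\<Union>m\<in>I. C m)"
    proof
      fix y assume y: "y \<in> S"
      have "nat \<lfloor>t y k\<rfloor> < N" for k using t[OF y, of k] by (simp add: nat_less_iff floor_less_iff)
      then have "restrict (\<lambda>k. nat \<lfloor>t y k\<rfloor>) (UNIV - {i}) \<in> I" by (auto simp: I_def)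
      moreover have "y \<in> C (restrict (\<lambda>k. nat \<lfloor>t y k\<rfloor>) (UNIV - {i}))" using y by (simp add: C_def)
      ultimately show "y \<in> (\<Union>m\<in>I. C m)" by blast
    qed
    have bdd: "bounded (C m)" for m by (rule bounded_subset[OF S]) (auto simp: C_def)
    have diam: "diameter (C m) \<le> c / real N" for m
    proof (rule diameter_le)
      show "C m \<noteq> {} \<or> 0 \<le> c / real N" using c by simp
      fix y y' assume yy: "y \<in> C m" "y' \<in> C m"
      then have S': "y \<in> S" "y' \<in> S" by (auto simp: C_def)
      have comp: "\<bar>y $ k - y' $ k\<bar> \<le> 2 * R / real N" if k: "k \<in> UNIV - {i}" for k
      proof -
        have "nat \<lfloor>t y k\<rfloor> = nat \<lfloor>t y' k\<rfloor>" using yy k unfolding C_def by auto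
        then have "\<lfloor>t y k\<rfloor> = \<lfloor>t y' k\<rfloor>" using t[OF S'(1), of k] t[OF S'(2), of k]
          by (simp add: eq_nat_nat_iff)
        then have "\<bar>t y k - t y' k\<bar> \<le> 1" by linarith
        moreover have "t y k - t y' k = (y $ k - y' $ k) * (real N / (2 * R))"
          unfolding t_def diff_divide_distrib[symmetric] by (simp add: left_diff_distrib[symmetric])
        ultimately have "\<bar>y $ k - y' $ k\<bar> * (real N / (2 * R)) \<le> 1"
          using Rpos by (simp add: abs_mult)
        then show ?thesis using Rpos N by (simp add: field_simps)
      qed
      then have sum: "(\<Sum>k\<in>UNIV - {i}. \<bar>y $ k - y' $ k\<bar>) \<le> real s * (2 * R / real N)"
        using sum_bounded_above[of "UNIV - {i}" "\<lambda>k. \<bar>y $ k - y' $ k\<bar>" "2 * R / real N"] s(2) by simp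
      have "norm (y - y') \<le> (\<Sum>k\<in>UNIV. \<bar>(y - y') $ k\<bar>)" by (rule norm_le_l1_cart)
      also have "\<dots> = \<bar>y $ i - y' $ i\<bar> + (\<Sum>k\<in>UNIV - {i}. \<bar>y $ k - y' $ k\<bar>)"
        by (subst sum.remove[of _ i]) auto
      also have "\<dots> \<le> (1 + L) * (\<Sum>k\<in>UNIV - {i}. \<bar>y $ k - y' $ k\<bar>)"
        using lip[OF S'] by (simp add: algebra_simps)
      also have "\<dots> \<le> (1 + L) * (real s * (2 * R / real N))"
        using L sum by (intro mult_left_mono) auto
      also have "\<dots> = c / real N" by (simp add: c_def)
      finally show "norm (y - y') \<le> c / real N" .
    qed
    have "hausdorff_pre s \<delta> S \<le> (\<Sum>m\<in>I. hausdorff_gauge s (C m))"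
      using s finI cover bdd order_trans[OF diam N(2)] \<delta> by (intro hausdorff_pre_finite_cover) auto
    also have "\<dots> \<le> (\<Sum>m\<in>I. ennreal (unit_ball_vol (real s) * (c / real N / 2) ^ s))"
      unfolding hausdorff_gauge_def using diam diameter_ge_0[OF bdd] 
      by (intro sum_mono ennreal_leI mult_left_mono power_mono divide_right_mono) auto
    also have "\<dots> = ennreal (real (N ^ s) * (unit_ball_vol (real s) * (c / real N / 2) ^ s))"
      using c by (simp add: cardI ennreal_mult' ennreal_of_nat_eq_real_of_nat del: of_nat_power)
    also have "real (N ^ s) * (unit_ball_vol (real s) * (c / real N / 2) ^ s) = K"
      using N by (simp add: K_def power_divide)
    finally show ?thesis .
  qed
  then have "hausdorff_outer s S \<le> ennreal K"
    unfolding hausdorff_outer_def by (intro SUP_least) auto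
  then show ?thesis unfolding s_def[symmetric] by (simp add: le_less_trans)
qed

lemma frontier_on_axis_line:
  fixes \<Omega> :: "(real ^ 'd) set"
  assumes "bounded \<Omega>" "x \<in> \<Omega>"
  shows "\<exists>t. x + t *\<^sub>R axis i 1 \<in> frontier \<Omega>"
proof -
  obtain B where B: "\<And>y. y \<in> \<Omega> \<Longrightarrow> norm y \<le> B" using assms(1) by (auto simp: bounded_iff)
  define T where "T = B + norm x + 1"
  have "\<bar>T\<bar> = norm (T *\<^sub>R axis i 1 :: real ^ 'd)" by simp
  also have "\<dots> \<le> norm (x + T *\<^sub>R axis i 1) + norm x"
    using norm_triangle_ineq4[of "x + T *\<^sub>R axis i 1" x] by simp
  finally have "x + T *\<^sub>R axis i 1 \<notin> \<Omega>" using B[of "x + T *\<^sub>R axis i 1"] by (auto simp: T_def)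
  moreover have "connected (closed_segment x (x + T *\<^sub>R axis i 1))" by simp
  ultimately obtain z where z: "z \<in> closed_segment x (x + T *\<^sub>R axis i 1)" "z \<in> frontier \<Omega>"
    using connected_Int_frontier[of "closed_segment x (x + T *\<^sub>R axis i 1)" \<Omega>] assms(2) by blast
  then obtain u where "z = (1 - u) *\<^sub>R x + u *\<^sub>R (x + T *\<^sub>R axis i 1)" by (auto simp: closed_segment_def)
  then have "z = x + (u * T) *\<^sub>R axis i 1" by (simp add: algebra_simps)
  then show ?thesis using z(2) by blast
qed

text \<open>Unit length in direction \<open>i\<close> turns the volume into the area of the
  projection along that direction.\<close>

lemma emeasure_box_flat:
  fixes a :: "real ^ 'd"
  assumes "0 \<le> r"
  shows "emeasure lborel (cbox (\<chi> k. if k = i then 0 else a $ k - r) (\<chi> k. if k = i then 1 else a $ k + r))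
     = ennreal ((2 * r) ^ (CARD('d) - 1))" (is "emeasure lborel ?Q = _")
proof -
  have "?Q \<noteq> {}" using assms by (auto simp: interval_ne_empty_cart)
  then have "measure lborel ?Q = (\<Prod>k\<in>UNIV. if k = i then 1 else 2 * r)"
    by (subst content_cbox_cart) (simp_all, intro prod.cong, auto)
  also have "\<dots> = (\<Prod>k\<in>UNIV - {i}. 2 * r)"
    by (subst prod.remove[of _ i]) (auto intro!: prod.cong)
  also have "\<dots> = (2 * r) ^ (CARD('d) - 1)" by simp
  finally have m: "measure lborel ?Q = (2 * r) ^ (CARD('d) - 1)" .
  have "emeasure lborel ?Q \<noteq> top"
    using emeasure_lborel_cbox_finite[of "\<chi> k. if k = i then 0 else a $ k - r" "\<chi> k. if k = i then 1 else a $ k + r"] by auto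
  then show ?thesis by (simp add: emeasure_eq_ennreal_measure m)
qed

text \<open>Every line through \<open>\<Omega>\<close> in direction \<open>i\<close> meets the
  frontier, so the projection of the frontier along that direction contains the projection of a
  ball. A covering set of diameter \<open>D\<close> projects into a cube of side \<open>2
  D\<close>; comparing volumes gives the bound.\<close>

lemma hausdorff_outer_frontier_pos:
  fixes \<Omega> :: "(real ^ 'd) set"
  assumes dim: "2 \<le> CARD('d)" and \<Omega>: "open \<Omega>" "bounded \<Omega>" "\<Omega> \<noteq> {}"
  shows "0 < hausdorff_outer (CARD('d) - 1) (frontier \<Omega>)"
proof -
  define s where "s = CARD('d) - 1"
  have s: "1 \<le> s" using dim by (simp add: s_def)
  obtain i :: 'd where True by blast
  obtain x0 where x0: "x0 \<in> \<Omega>" using \<Omega> by blast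
  obtain \<epsilon> where \<epsilon>: "0 < \<epsilon>" "ball x0 \<epsilon> \<subseteq> \<Omega>" using \<Omega>(1) x0 by (auto simp: open_contains_ball)
  define e where "e = \<epsilon> / (2 * real CARD('d))"
  have e: "0 < e" using \<epsilon> by (simp add: e_def)
  define box where "box = (\<lambda>a r. cbox (\<chi> k. if k = i then 0 else (a::real^'d) $ k - r) (\<chi> k. if k = i then 1 else a $ k + r))"
  have box: "x \<in> box a r \<longleftrightarrow> 0 \<le> x $ i \<and> x $ i \<le> 1 \<and> (\<forall>k. k \<noteq> i \<longrightarrow> \<bar>x $ k - a $ k\<bar> \<le> r)" for x a r
  proof -
    have "x \<in> box a r \<longleftrightarrow> (\<forall>k. (if k = i then 0 \<le> x $ k \<and> x $ k \<le> 1 else \<bar>x $ k - a $ k\<bar> \<le> r))"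
      unfolding box_def mem_box_cart by (intro all_cong1) auto
    also have "\<dots> \<longleftrightarrow> 0 \<le> x $ i \<and> x $ i \<le> 1 \<and> (\<forall>k. k \<noteq> i \<longrightarrow> \<bar>x $ k - a $ k\<bar> \<le> r)" by metis
    finally show ?thesis .
  qed
  define \<kappa> where "\<kappa> = unit_ball_vol (real s) / 4 ^ s"
  have \<kappa>: "0 < \<kappa>" by (simp add: \<kappa>_def unit_ball_vol_pos)
  have "ennreal (\<kappa> * (2 * e) ^ s) \<le> hausdorff_pre s 1 (frontier \<Omega>)"
  proof (rule hausdorff_pre_greatest)
    fix C :: "nat \<Rightarrow> (real^'d) set"
    assume C: "frontier \<Omega> \<subseteq> (\<Union>j. C j)" "\<And>j. bounded (C j)"
    define y where "y = (\<lambda>j. SOME y. y \<in> C j)"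
    define B where "B = (\<lambda>j. if C j = {} then {} else box (y j) (diameter (C j)))"
    have yC: "y j \<in> C j" if "C j \<noteq> {}" for j using that by (auto simp: y_def intro: someI_ex)
    have "box x0 e \<subseteq> (\<Union>j. B j)"
    proof
      fix x assume x: "x \<in> box x0 e"
      define x' where "x' = (\<chi> k. if k = i then x0 $ i else x $ k)"
      have "norm (x' - x0) \<le> (\<Sum>k\<in>UNIV. \<bar>(x' - x0) $ k\<bar>)" by (rule norm_le_l1_cart)
      also have "\<dots> \<le> (\<Sum>k\<in>(UNIV::'d set). e)"
        using x e by (intro sum_mono) (auto simp: x'_def box)
      also have "\<dots> < \<epsilon>" using \<epsilon> by (simp add: e_def)
      finally have "x' \<in> \<Omega>" using \<epsilon> by (auto simp: dist_norm norm_minus_commute)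
      then obtain t where t: "x' + t *\<^sub>R axis i 1 \<in> frontier \<Omega>"
        using frontier_on_axis_line[OF \<Omega>(2)] by blast
      then obtain j where j: "x' + t *\<^sub>R axis i 1 \<in> C j" using C(1) by blast
      have "\<bar>x $ k - y j $ k\<bar> \<le> diameter (C j)" if "k \<noteq> i" for k
      proof -
        have "\<bar>(x' + t *\<^sub>R axis i 1 - y j) $ k\<bar> \<le> norm (x' + t *\<^sub>R axis i 1 - y j)"
          by (rule component_le_norm_cart)
        also have "\<dots> \<le> diameter (C j)"
          using diameter_bounded_bound[OF C(2) j yC] j by (auto simp: dist_norm)
        finally show ?thesis using that by (simp add: x'_def axis_def)
      qed
      then show "x \<in> (\<Union>j. B j)" using x j by (auto simp: B_def box intro!: exI[of _ j])
    qed
    moreover have meas: "box a r \<in> sets lborel" for a r by (simp add: box_def)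
    ultimately have "emeasure lborel (box x0 e) \<le> emeasure lborel (\<Union>j. B j)"
      by (intro emeasure_mono) (auto simp: B_def)
    also have "\<dots> \<le> (\<Sum>j. emeasure lborel (B j))"
      using meas by (intro emeasure_subadditive_countably) (auto simp: B_def)
    also have "\<dots> \<le> (\<Sum>j. ennreal ((2 * diameter (C j)) ^ s))"
      using diameter_ge_0[OF C(2)] s emeasure_box_flat[of _ i]
      by (intro suminf_le) (auto simp: B_def box_def s_def)
    finally have "ennreal ((2 * e) ^ s) \<le> (\<Sum>j. ennreal ((2 * diameter (C j)) ^ s))"
      using emeasure_box_flat[of e i x0] e by (simp add: box_def s_def)
    then have "ennreal \<kappa> * ennreal ((2 * e) ^ s) \<le> ennreal \<kappa> * (\<Sum>j. ennreal ((2 * diameter (C j)) ^ s))"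
      by (rule mult_left_mono) simp
    also have "\<dots> = (\<Sum>j. ennreal \<kappa> * ennreal ((2 * diameter (C j)) ^ s))" by simp
    also have "\<dots> = (\<Sum>j. hausdorff_gauge s (C j))"
    proof (rule arg_cong[where f = suminf], rule ext)
      fix j
      have "\<kappa> * (2 * diameter (C j)) ^ s = unit_ball_vol (real s) * ((2 * diameter (C j)) / 4) ^ s"
        unfolding \<kappa>_def power_divide by simp
      then show "ennreal \<kappa> * ennreal ((2 * diameter (C j)) ^ s) = hausdorff_gauge s (C j)"
        using \<kappa> diameter_ge_0[OF C(2), of j] by (simp add: hausdorff_gauge_def ennreal_mult[symmetric])
    qed
    finally show "ennreal (\<kappa> * (2 * e) ^ s) \<le> (\<Sum>j. hausdorff_gauge s (C j))"
      using \<kappa> e by (simp add: ennreal_mult)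
  qed
  also have "\<dots> \<le> hausdorff_outer s (frontier \<Omega>)"
    unfolding hausdorff_outer_def by (intro SUP_upper) auto
  finally have "ennreal (\<kappa> * (2 * e) ^ s) \<le> hausdorff_outer s (frontier \<Omega>)" .
  moreover have "0 < ennreal (\<kappa> * (2 * e) ^ s)" using \<kappa> e by simp
  ultimately show ?thesis unfolding s_def[symmetric] by (rule less_le_trans[rotated])
qed

lemma C2_defining_fun_continuous:
  assumes "C2_defining_fun \<Omega> x \<psi> G"
  obtains U where "open U" "x \<in> U" "continuous_on U G" "G x \<noteq> 0"
    "\<And>y. y \<in> U \<Longrightarrow> (\<psi> has_derivative (\<lambda>v. G y \<bullet> v)) (at y)"
    "\<Omega> \<inter> U = {y \<in> U. \<psi> y < 0}" "frontier \<Omega> \<inter> U = {y \<in> U. \<psi> y = 0}"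
    "\<And>y. y \<in> U \<Longrightarrow> G y \<noteq> 0 \<Longrightarrow> C2_defining_fun \<Omega> y \<psi> G"
proof -
  obtain U H where U: "open U" "x \<in> U" "G x \<noteq> 0"
    "\<forall>y\<in>U. (\<psi> has_derivative (\<lambda>v. G y \<bullet> v)) (at y)"
    "\<forall>y\<in>U. (G has_derivative (\<lambda>v. H y *v v)) (at y)" "continuous_on U H"
    "\<Omega> \<inter> U = {y \<in> U. \<psi> y < 0}" "frontier \<Omega> \<inter> U = {y \<in> U. \<psi> y = 0}"
    using assms unfolding C2_defining_fun_def by blast
  moreover have "continuous_on U G"
    using U(5) by (meson continuous_at_imp_continuous_on has_derivative_continuous)
  moreover have "C2_defining_fun \<Omega> y \<psi> G" if "y \<in> U" "G y \<noteq> 0" for y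
    unfolding C2_defining_fun_def using that U by (intro exI[of _ U] exI[of _ H]) auto
  ultimately show thesis using that by blast
qed

lemma C2_defining_fun_nonzero: "C2_defining_fun \<Omega> x \<psi> G \<Longrightarrow> G x \<noteq> 0"
  unfolding C2_defining_fun_def by blast

text \<open>Moving from \<open>x\<close> in a direction that decreases one defining function
  leads into \<open>\<Omega>\<close>, where the other one is negative as well.\<close>

lemma inward_direction_derivative_nonpos:
  assumes "C2_defining_fun \<Omega> x \<psi> G" "C2_defining_fun \<Omega> x \<psi>' G'" "x \<in> frontier \<Omega>" "G x \<bullet> v < 0"
  shows "G' x \<bullet> v \<le> 0"
proof (rule ccontr)
  assume "\<not> G' x \<bullet> v \<le> 0"
  then have pos: "0 < G' x \<bullet> v" by simp
  obtain U where U: "open U" "x \<in> U" "(\<psi> has_derivative (\<lambda>v. G x \<bullet> v)) (at x)"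
    "\<Omega> \<inter> U = {y \<in> U. \<psi> y < 0}" "frontier \<Omega> \<inter> U = {y \<in> U. \<psi> y = 0}"
    by (rule C2_defining_fun_continuous[OF assms(1)]) (rule that; assumption)
  obtain U' where U': "open U'" "x \<in> U'" "(\<psi>' has_derivative (\<lambda>v. G' x \<bullet> v)) (at x)"
    "\<Omega> \<inter> U' = {y \<in> U'. \<psi>' y < 0}" "frontier \<Omega> \<inter> U' = {y \<in> U'. \<psi>' y = 0}"
    by (rule C2_defining_fun_continuous[OF assms(2)]) (rule that; assumption)
  have zero: "\<psi> x = 0" "\<psi>' x = 0" using assms(3) U U' by auto
  have line: "((\<lambda>t. f (x + t *\<^sub>R v)) has_real_derivative (D \<bullet> v)) (at 0)"
    if "(f has_derivative (\<lambda>v. D \<bullet> v)) (at x)" for f :: "real ^ 'a \<Rightarrow> real" and D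
  proof -
    have "((\<lambda>t. x + t *\<^sub>R v) has_derivative (\<lambda>t. t *\<^sub>R v)) (at 0)"
      by (auto intro!: derivative_eq_intros)
    from has_derivative_compose[OF this, of f "\<lambda>v. D \<bullet> v"] that show ?thesis
      by (simp add: has_field_derivative_def mult.commute[of "D \<bullet> v"] fun_eq_iff mult_commute_abs)
  qed
  obtain d1 where d1: "0 < d1" "\<And>h. 0 < h \<Longrightarrow> h < d1 \<Longrightarrow> \<psi> (x + h *\<^sub>R v) < 0"
    using DERIV_neg_dec_right[OF line[OF U(3)] assms(4)] zero by auto
  obtain d2 where d2: "0 < d2" "\<And>h. 0 < h \<Longrightarrow> h < d2 \<Longrightarrow> 0 < \<psi>' (x + h *\<^sub>R v)"
    using DERIV_pos_inc_right[OF line[OF U'(3)] pos] zero by auto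
  have "open (U \<inter> U')" "x \<in> U \<inter> U'" using U U' by auto
  then obtain r where r: "0 < r" "ball x r \<subseteq> U \<inter> U'" by (meson open_contains_ball)
  \<comment> \<open>Small enough for both one-sided sign conditions and for staying in
    \<open>U \<inter> U'\<close>; the summand \<open>1\<close> avoids a division by \<open>norm
    v = 0\<close>.\<close>
  define h where "h = min (min d1 d2) (r / (norm v + 1)) / 2"
  have nv: "0 < norm v + 1" by (simp add: add_nonneg_pos)
  have m: "0 < min (min d1 d2) (r / (norm v + 1))" using d1 d2 r nv by simp
  have half: "0 < y / 2" "y / 2 < y" if "0 < y" for y :: real using that by auto
  have h: "0 < h" "h < d1" "h < d2" "h < r / (norm v + 1)"
    using half[OF m] unfolding h_def by (auto simp del: min_less_iff_disj intro: less_le_trans)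
  then have "h * norm v < r" using nv by (simp add: field_simps)
  then have "x + h *\<^sub>R v \<in> U \<inter> U'" using r h by (auto simp: dist_norm)
  then have UU: "x + h *\<^sub>R v \<in> U" "x + h *\<^sub>R v \<in> U'" by auto
  then have "x + h *\<^sub>R v \<in> \<Omega>" using d1(2)[OF h(1,2)] U(4) by blast
  then have "\<psi>' (x + h *\<^sub>R v) < 0" using U'(4) UU by blast
  then show False using d2(2)[OF h(1,3)] by simp
qed

text \<open>Independence of the defining function: if two unit normals \<open>n\<close> and
  \<open>n'\<close> differed, the direction \<open>n' - n\<close> would decrease one defining
  function and increase the other.\<close>

lemma outward_normal_eq:
  assumes G: "C2_defining_fun \<Omega> x \<psi> G" and x: "x \<in> frontier \<Omega>"
  shows "outward_normal \<Omega> x = G x /\<^sub>R norm (G x)"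
proof -
  have eq: "G' x /\<^sub>R norm (G' x) = G x /\<^sub>R norm (G x)" if G': "C2_defining_fun \<Omega> x \<psi>' G'" for \<psi>' G'
  proof (rule ccontr)
    assume ne: "\<not> ?thesis"
    have nz: "G x \<noteq> 0" "G' x \<noteq> 0" by (rule C2_defining_fun_nonzero[OF G], rule C2_defining_fun_nonzero[OF G'])
    define n where "n = G x /\<^sub>R norm (G x)"
    define n' where "n' = G' x /\<^sub>R norm (G' x)"
    have n: "norm n = 1" "norm n' = 1" "G x = norm (G x) *\<^sub>R n" "G' x = norm (G' x) *\<^sub>R n'"
      using nz by (auto simp: n_def n'_def)
    have nn: "n \<bullet> n = 1" "n' \<bullet> n' = 1" using n(1,2) by (simp_all add: norm_eq_1)
    have "0 < (n' - n) \<bullet> (n' - n)" using ne by (simp add: n_def n'_def)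
    then have lt: "n \<bullet> n' < 1" using nn by (simp add: inner_diff inner_commute)
    have "G x \<bullet> (n' - n) = norm (G x) * (n \<bullet> n' - 1)"
      by (subst n(3)) (simp add: inner_diff_right nn right_diff_distrib)
    also have "\<dots> < 0" using nz lt by (simp add: mult_pos_neg)
    finally have "G' x \<bullet> (n' - n) \<le> 0" by (rule inward_direction_derivative_nonpos[OF G G' x])
    moreover have "G' x \<bullet> (n' - n) = norm (G' x) * (1 - n \<bullet> n')"
      by (subst n(4)) (simp add: inner_diff_right nn inner_commute right_diff_distrib)
    moreover have "0 < norm (G' x) * (1 - n \<bullet> n')" using nz lt by simp
    ultimately show False by linarith
  qed
  show ?thesis unfolding outward_normal_def
  proof (rule the_equality)
    show "\<exists>\<psi>' G'. C2_defining_fun \<Omega> x \<psi>' G' \<and> G x /\<^sub>R norm (G x) = G' x /\<^sub>R norm (G' x)"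
      by (rule exI[of _ \<psi>], rule exI[of _ G]) (simp add: G)
    fix \<nu> assume "\<exists>\<psi>' G'. C2_defining_fun \<Omega> x \<psi>' G' \<and> \<nu> = G' x /\<^sub>R norm (G' x)"
    then obtain \<psi>' G' where *: "C2_defining_fun \<Omega> x \<psi>' G'" "\<nu> = G' x /\<^sub>R norm (G' x)" by (elim exE conjE)
    show "\<nu> = G x /\<^sub>R norm (G x)" unfolding *(2) by (rule eq[OF *(1)])
  qed
qed

lemma continuous_on_outward_normal:
  assumes "C2_boundary \<Omega>"
  shows "continuous_on (frontier \<Omega>) (outward_normal \<Omega>)"
  unfolding continuous_on_eq_continuous_within
proof
  fix x assume x: "x \<in> frontier \<Omega>"
  obtain \<psi> G where G: "C2_defining_fun \<Omega> x \<psi> G" using assms x unfolding C2_boundary_def by blast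
  obtain U where U: "open U" "x \<in> U" "continuous_on U G" "G x \<noteq> 0"
    "\<And>y. y \<in> U \<Longrightarrow> G y \<noteq> 0 \<Longrightarrow> C2_defining_fun \<Omega> y \<psi> G"
    by (rule C2_defining_fun_continuous[OF G]) (rule that; assumption)
  have cont: "isCont G x" using U by (simp add: continuous_on_eq_continuous_at)
  have "\<forall>\<^sub>F y in at x. y \<in> U \<and> G y \<noteq> 0"
    using cont U(1,2,4) by (intro eventually_conj) (simp_all add: eventually_at_in_open' isCont_def tendsto_imp_eventually_ne)
  then have "\<forall>\<^sub>F y in at x within frontier \<Omega>. y \<in> U \<and> G y \<noteq> 0"
    by (rule filter_leD[OF at_le, rotated]) simp
  moreover have "\<forall>\<^sub>F y in at x within frontier \<Omega>. y \<in> frontier \<Omega>"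
    by (simp add: eventually_at_filter)
  ultimately have ev: "\<forall>\<^sub>F y in at x within frontier \<Omega>. G y /\<^sub>R norm (G y) = outward_normal \<Omega> y"
  proof eventually_elim
    case (elim y)
    then have "C2_defining_fun \<Omega> y \<psi> G" by (intro U(5)) auto
    then show ?case using elim by (simp only: outward_normal_eq)
  qed
  have "((\<lambda>y. G y /\<^sub>R norm (G y)) \<longlongrightarrow> G x /\<^sub>R norm (G x)) (at x within frontier \<Omega>)"
    using cont U(4) by (intro tendsto_intros) (auto simp: isCont_def intro: tendsto_within_subset)
  then show "continuous (at x within frontier \<Omega>) (outward_normal \<Omega>)"
    unfolding continuous_within outward_normal_eq[OF G x] by (rule Lim_transform_eventually[OF _ ev])
qed

text \<open>A direct substitute for the implicit function theorem: if the partial derivative in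
  direction \<open>i\<close> does not vanish at \<open>x\<close>, the mean value theorem between
  two zeros of the defining function bounds the difference of the coordinates \<open>i\<close> by
  that of the others.\<close>

lemma C2_boundary_locally_Lipschitz:
  fixes \<Omega> :: "(real ^ 'd) set"
  assumes G: "C2_defining_fun \<Omega> x \<psi> G"
  obtains r L i where "0 < r" "0 \<le> L"
    "\<And>y y'. y \<in> frontier \<Omega> \<inter> ball x r \<Longrightarrow> y' \<in> frontier \<Omega> \<inter> ball x r \<Longrightarrow>
       \<bar>y $ i - y' $ i\<bar> \<le> L * (\<Sum>k\<in>UNIV - {i}. \<bar>y $ k - y' $ k\<bar>)"
proof -
  obtain U where U: "open U" "x \<in> U" "continuous_on U G" "G x \<noteq> 0"
    "\<And>y. y \<in> U \<Longrightarrow> (\<psi> has_derivative (\<lambda>v. G y \<bullet> v)) (at y)"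
    "frontier \<Omega> \<inter> U = {y \<in> U. \<psi> y = 0}"
    by (rule C2_defining_fun_continuous[OF G]) (rule that; assumption)
  obtain i where i: "G x $ i \<noteq> 0" using U(4) by (auto simp: vec_eq_iff)
  define m where "m = \<bar>G x $ i\<bar> / 2"
  define M where "M = norm (G x) + m"
  have m: "0 < m" "0 \<le> M" using i by (auto simp: m_def M_def)
  have "isCont G x" using U by (simp add: continuous_on_eq_continuous_at)
  then obtain r1 where r1: "0 < r1" "\<And>y. dist y x < r1 \<Longrightarrow> dist (G y) (G x) < m"
    using m unfolding continuous_at_eps_delta by (metis)
  obtain r2 where r2: "0 < r2" "ball x r2 \<subseteq> U" using U by (auto simp: open_contains_ball)
  define r where "r = min r1 r2"
  have G_bounds: "m \<le> \<bar>G y $ i\<bar>" "\<bar>G y $ k\<bar> \<le> M" if "y \<in> ball x r" for y k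
  proof -
    have d: "norm (G y - G x) < m" using r1(2)[of y] that by (simp add: r_def dist_commute) (simp add: dist_norm norm_minus_commute)
    have "\<bar>G y $ i - G x $ i\<bar> < m" using component_le_norm_cart[of "G y - G x" i] d by simp
    then show "m \<le> \<bar>G y $ i\<bar>" unfolding m_def by linarith
    have "norm (G y) \<le> norm (G x) + norm (G y - G x)" by (metis add.commute diff_add_cancel norm_triangle_ineq)
    then show "\<bar>G y $ k\<bar> \<le> M" using component_le_norm_cart[of "G y" k] d by (simp add: M_def)
  qed
  show thesis
  proof
    show "0 < r" using r1 r2 by (simp add: r_def)
    show "0 \<le> M / m" using m by simp
    fix y y' assume y: "y \<in> frontier \<Omega> \<inter> ball x r" and y': "y' \<in> frontier \<Omega> \<inter> ball x r"
    have zero: "\<psi> y = 0" "\<psi> y' = 0" using y y' r2 U(6) by (auto simp: r_def)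
    have seg: "y' + t *\<^sub>R (y - y') \<in> ball x r" if "0 \<le> t" "t \<le> 1" for t
    proof -
      have "(1 - t) *\<^sub>R y' + t *\<^sub>R y \<in> ball x r"
        using y y' that by (intro convexD[OF convex_ball]) auto
      then show ?thesis by (simp add: algebra_simps)
    qed
    have der: "((\<lambda>t. \<psi> (y' + t *\<^sub>R (y - y'))) has_real_derivative (G (y' + t *\<^sub>R (y - y')) \<bullet> (y - y'))) (at t)"
      if "0 \<le> t" "t \<le> 1" for t
    proof -
      have 1: "((\<lambda>t. y' + t *\<^sub>R (y - y')) has_derivative (\<lambda>t. t *\<^sub>R (y - y'))) (at t)"
        by (auto intro!: derivative_eq_intros)
      have 2: "(\<psi> has_derivative (\<lambda>v. G (y' + t *\<^sub>R (y - y')) \<bullet> v)) (at (y' + t *\<^sub>R (y - y')))"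
        using U(5) seg[OF that] r2 by (auto simp: r_def)
      show ?thesis using has_derivative_compose[OF 1 2]
        by (simp add: has_field_derivative_def mult_commute_abs)
    qed
    obtain z where z: "0 < z" "z < 1" "\<psi> (y' + 1 *\<^sub>R (y - y')) - \<psi> (y' + 0 *\<^sub>R (y - y')) = (1 - 0) * (G (y' + z *\<^sub>R (y - y')) \<bullet> (y - y'))"
      using MVT2[of 0 1 "\<lambda>t. \<psi> (y' + t *\<^sub>R (y - y'))", OF _ der] by auto
    define g where "g = G (y' + z *\<^sub>R (y - y'))"
    have g: "m \<le> \<bar>g $ i\<bar>" "\<bar>g $ k\<bar> \<le> M" for k using G_bounds[OF seg] z by (auto simp: g_def)
    have "0 = g \<bullet> (y - y')" using z(3) zero by (simp add: g_def)
    also have "\<dots> = g $ i * (y $ i - y' $ i) + (\<Sum>k\<in>UNIV - {i}. g $ k * (y $ k - y' $ k))"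
      unfolding inner_vec_def by (subst sum.remove[of _ i]) auto
    finally have "\<bar>g $ i * (y $ i - y' $ i)\<bar> = \<bar>\<Sum>k\<in>UNIV - {i}. g $ k * (y $ k - y' $ k)\<bar>" by linarith
    also have "\<dots> \<le> (\<Sum>k\<in>UNIV - {i}. \<bar>g $ k * (y $ k - y' $ k)\<bar>)" by (rule sum_abs)
    also have "\<dots> \<le> (\<Sum>k\<in>UNIV - {i}. M * \<bar>y $ k - y' $ k\<bar>)"
      unfolding abs_mult using g by (intro sum_mono mult_right_mono) auto
    also have "\<dots> = M * (\<Sum>k\<in>UNIV - {i}. \<bar>y $ k - y' $ k\<bar>)" by (simp add: sum_distrib_left)
    finally have "m * \<bar>y $ i - y' $ i\<bar> \<le> M * (\<Sum>k\<in>UNIV - {i}. \<bar>y $ k - y' $ k\<bar>)"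
      using mult_right_mono[OF g(1), of "\<bar>y $ i - y' $ i\<bar>"] by (simp add: abs_mult)
    then show "\<bar>y $ i - y' $ i\<bar> \<le> M / m * (\<Sum>k\<in>UNIV - {i}. \<bar>y $ k - y' $ k\<bar>)"
      using m by (simp add: field_simps)
  qed
qed

lemma sets_surface_measure [measurable_cong]: "sets surface_measure = sets borel"
  by (simp add: surface_measure_def sets_hausdorff_measure)

lemma surface_measure_Lipschitz_finite:
  fixes S :: "(real ^ 'd) set"
  assumes "2 \<le> CARD('d)" "bounded S" "0 \<le> L" "S \<in> sets borel"
    and "\<And>y y'. y \<in> S \<Longrightarrow> y' \<in> S \<Longrightarrow> \<bar>y $ i - y' $ i\<bar> \<le> L * (\<Sum>k\<in>UNIV - {i}. \<bar>y $ k - y' $ k\<bar>)"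
  shows "emeasure surface_measure S < \<infinity>"
  using hausdorff_outer_Lipschitz_finite[OF assms(1-3,5)] assms(1,4)
  by (simp add: surface_measure_def emeasure_hausdorff_measure)

lemma surface_measure_frontier_finite:
  fixes \<Omega> :: "(real ^ 'd) set"
  assumes dim: "2 \<le> CARD('d)" and \<Omega>: "C2_boundary \<Omega>" "bounded \<Omega>"
  shows "emeasure surface_measure (frontier \<Omega>) < \<infinity>"
proof -
  have "\<forall>x\<in>frontier \<Omega>. \<exists>r>0. emeasure surface_measure (frontier \<Omega> \<inter> ball x r) < \<infinity>"
  proof
    fix x assume "x \<in> frontier \<Omega>"
    then obtain \<psi> G where G: "C2_defining_fun \<Omega> x \<psi> G" using \<Omega>(1) by (auto simp: C2_boundary_def)
    obtain r L i where r: "0 < r" "0 \<le> L"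
      "\<And>y y'. y \<in> frontier \<Omega> \<inter> ball x r \<Longrightarrow> y' \<in> frontier \<Omega> \<inter> ball x r \<Longrightarrow>
         \<bar>y $ i - y' $ i\<bar> \<le> L * (\<Sum>k\<in>UNIV - {i}. \<bar>y $ k - y' $ k\<bar>)"
      by (rule C2_boundary_locally_Lipschitz[OF G]) (rule that; assumption)
    have "emeasure surface_measure (frontier \<Omega> \<inter> ball x r) < \<infinity>"
      using r(3) by (intro surface_measure_Lipschitz_finite[OF dim _ r(2)]) (auto simp: bounded_Int)
    then show "\<exists>r>0. emeasure surface_measure (frontier \<Omega> \<inter> ball x r) < \<infinity>" using r(1) by blast
  qed
  then obtain r where r: "\<And>x. x \<in> frontier \<Omega> \<Longrightarrow> 0 < r x"
    "\<And>x. x \<in> frontier \<Omega> \<Longrightarrow> emeasure surface_measure (frontier \<Omega> \<inter> ball x (r x)) < \<infinity>" by metis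
  have "compact (frontier \<Omega>)" using \<Omega>(2) by (simp add: compact_frontier_bounded)
  moreover have "frontier \<Omega> \<subseteq> (\<Union>x\<in>frontier \<Omega>. ball x (r x))" using r(1) by force
  ultimately obtain T where T: "T \<subseteq> frontier \<Omega>" "finite T" "frontier \<Omega> \<subseteq> (\<Union>x\<in>T. ball x (r x))"
    using compactE_image[of "frontier \<Omega>" "frontier \<Omega>" "\<lambda>x. ball x (r x)"] by (metis open_ball)
  have "emeasure surface_measure (frontier \<Omega>) = emeasure surface_measure (\<Union>x\<in>T. frontier \<Omega> \<inter> ball x (r x))"
    using T(3) by (intro arg_cong[where f = "emeasure surface_measure"]) blast
  also have "\<dots> \<le> (\<Sum>x\<in>T. emeasure surface_measure (frontier \<Omega> \<inter> ball x (r x)))"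
    using T(2) by (intro emeasure_subadditive_finite) (auto simp: sets_surface_measure)
  also have "\<dots> < \<infinity>" using r(2) T(1) by (subst infinity_ennreal_def, subst ennreal_sum_less_top[OF T(2)]) auto
  finally show ?thesis .
qed

lemma surface_measure_frontier_pos:
  fixes \<Omega> :: "(real ^ 'd) set"
  assumes "2 \<le> CARD('d)" "open \<Omega>" "bounded \<Omega>" "\<Omega> \<noteq> {}"
  shows "0 < emeasure surface_measure (frontier \<Omega>)"
  using hausdorff_outer_frontier_pos[OF assms] assms(1)
  by (simp add: surface_measure_def emeasure_hausdorff_measure)

section \<open>Tensor-product polynomials and Gauss-Lobatto points\<close>

lemma finite_exponents: "finite {\<alpha> :: 'd::finite \<Rightarrow> nat. \<forall>i. \<alpha> i \<le> p}"
proof -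
  have "{\<alpha> :: 'd \<Rightarrow> nat. \<forall>i. \<alpha> i \<le> p} = PiE UNIV (\<lambda>_. {..p})" by (auto simp: PiE_def)
  then show ?thesis by (simp add: finite_PiE)
qed

lemma subspace_Qp: "subspace (Qp p :: (real ^ 'd::finite \<Rightarrow> real) set)"
proof (rule subspaceI)
  show "0 \<in> (Qp p :: (real ^ 'd \<Rightarrow> real) set)"
    by (auto simp: Qp_def intro!: exI[of _ "\<lambda>_. 0"])
  fix u v :: "real ^ 'd \<Rightarrow> real" and r :: real assume u: "u \<in> Qp p"
  then obtain a where a: "\<And>x. u x = (\<Sum>\<alpha> | \<forall>i. \<alpha> i \<le> p. a \<alpha> * (\<Prod>i\<in>UNIV. (x $ i) ^ \<alpha> i))"
    by (auto simp: Qp_def)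
  show "r *\<^sub>R u \<in> Qp p"
    by (auto simp: Qp_def scaleR_fun_def a sum_distrib_left mult.assoc intro!: exI[of _ "\<lambda>\<alpha>. r * a \<alpha>"])
  assume v: "v \<in> Qp p"
  then obtain b where b: "\<And>x. v x = (\<Sum>\<alpha> | \<forall>i. \<alpha> i \<le> p. b \<alpha> * (\<Prod>i\<in>UNIV. (x $ i) ^ \<alpha> i))"
    by (auto simp: Qp_def)
  show "u + v \<in> Qp p"
    by (auto simp: Qp_def a b sum.distrib distrib_right intro!: exI[of _ "\<lambda>\<alpha>. a \<alpha> + b \<alpha>"])
qed

lemma Qp_polynomial_function:
  assumes "q \<in> Qp p" shows "real_polynomial_function (q :: real ^ 'd::finite \<Rightarrow> real)"
proof -
  obtain a where "q = (\<lambda>x. \<Sum>\<alpha> | \<forall>i. \<alpha> i \<le> p. a \<alpha> * (\<Prod>i\<in>UNIV. (x $ i) ^ \<alpha> i))"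
    using assms by (auto simp: Qp_def)
  then show ?thesis
    by (auto intro!: real_polynomial_function_sum finite_exponents real_polynomial_function_prod
        real_polynomial_function.intros(2-4) real_polynomial_function_power
        real_polynomial_function.intros(1)[OF bounded_linear_vec_nth])
qed

lemma Qp_restrict_axis:
  fixes q :: "real ^ 'd::finite \<Rightarrow> real"
  assumes "q \<in> Qp p"
  shows "\<exists>P. degree P \<le> p \<and> (\<forall>t. q (\<chi> k. if k = i then t else x $ k) = poly P t)"
proof -
  obtain a where a: "\<And>x. q x = (\<Sum>\<alpha> | \<forall>i. \<alpha> i \<le> p. a \<alpha> * (\<Prod>i\<in>UNIV. (x $ i) ^ \<alpha> i))"
    using assms by (auto simp: Qp_def)
  define P where "P = (\<Sum>\<alpha> | \<forall>i. \<alpha> i \<le> p. monom (a \<alpha> * (\<Prod>k\<in>UNIV - {i}. (x $ k) ^ \<alpha> k)) (\<alpha> i))"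
  have "degree P \<le> p"
    unfolding P_def by (intro degree_sum_le finite_exponents) (auto intro: order_trans[OF degree_monom_le])
  moreover have "q (\<chi> k. if k = i then t else x $ k) = poly P t" for t
  proof -
    have "(\<Prod>k\<in>UNIV. ((\<chi> k. if k = i then t else x $ k) $ k) ^ \<alpha> k) = t ^ \<alpha> i * (\<Prod>k\<in>UNIV - {i}. (x $ k) ^ \<alpha> k)" for \<alpha>
      by (subst prod.remove[of _ i]) (auto intro!: prod.cong)
    then show ?thesis by (simp add: a P_def poly_sum poly_monom mult_ac)
  qed
  ultimately show ?thesis by blast
qed

text \<open>The coordinates are freed from the grid one at a time; in each coordinate the
  restriction is a univariate polynomial of degree at most \<open>p\<close> with more than
  \<open>p\<close> roots.\<close>

lemma Qp_unisolvence:
  fixes q :: "real ^ 'd::finite \<Rightarrow> real" and X :: "'d \<Rightarrow> real set"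
  assumes q: "q \<in> Qp p" and X: "\<And>i. p < card (X i)"
    and zero: "\<And>x. (\<And>i. x $ i \<in> X i) \<Longrightarrow> q x = 0"
  shows "q x = 0"
proof -
  have "\<forall>x. (\<forall>i. i \<notin> I \<longrightarrow> x $ i \<in> X i) \<longrightarrow> q x = 0" if "finite I" for I
    using that
  proof (induction I)
    case empty
    then show ?case using zero by simp
  next
    case (insert i I)
    show ?case
    proof (intro allI impI)
      fix x assume x: "\<forall>k. k \<notin> insert i I \<longrightarrow> x $ k \<in> X k"
      obtain P where P: "degree P \<le> p" "\<And>t. q (\<chi> k. if k = i then t else x $ k) = poly P t"
        using Qp_restrict_axis[OF q] by blast
      have "X i \<subseteq> {t. poly P t = 0}"
      proof
        fix t assume "t \<in> X i"
        then have "q (\<chi> k. if k = i then t else x $ k) = 0"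
          using insert.IH x by auto
        then show "t \<in> {t. poly P t = 0}" by (simp add: P)
      qed
      then have "P = 0"
        using card_mono[of "{t. poly P t = 0}" "X i"] X[of i] P(1) card_poly_roots_bound[of P] poly_roots_finite[of P]
        by (cases "P = 0") auto
      moreover have "(\<chi> k. if k = i then x $ i else x $ k) = x" by (simp add: vec_eq_iff)
      ultimately show "q x = 0" using P(2)[of "x $ i"] by simp
    qed
  qed
  from this[of UNIV] show ?thesis by simp
qed

lemma polynomial_function_dir_deriv:
  fixes q :: "'a::euclidean_space \<Rightarrow> real"
  assumes "real_polynomial_function q"
  shows "\<exists>q'. real_polynomial_function q' \<and> (\<forall>x t. ((\<lambda>t. q (x + t *\<^sub>R \<nu>)) has_real_derivative q' (x + t *\<^sub>R \<nu>)) (at t))"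
  using assms
proof induction
  case (linear f)
  interpret bounded_linear f by fact
  have "((\<lambda>t. f (x + t *\<^sub>R \<nu>)) has_real_derivative f \<nu>) (at t)" for x t
    by (auto simp: add scaleR intro!: derivative_eq_intros)
  then show ?case by (intro exI[of _ "\<lambda>_. f \<nu>"]) (auto intro: real_polynomial_function.intros(2-4))
next
  case (const c)
  show ?case by (intro exI[of _ "\<lambda>_. 0"]) (auto intro: real_polynomial_function.intros(2-4))
next
  case (add f g)
  then obtain f' g' where "real_polynomial_function f'" "real_polynomial_function g'"
    "\<forall>x t. ((\<lambda>t. f (x + t *\<^sub>R \<nu>)) has_real_derivative f' (x + t *\<^sub>R \<nu>)) (at t)"
    "\<forall>x t. ((\<lambda>t. g (x + t *\<^sub>R \<nu>)) has_real_derivative g' (x + t *\<^sub>R \<nu>)) (at t)" by blast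
  then show ?case
    by (intro exI[of _ "\<lambda>x. f' x + g' x"]) (auto intro!: real_polynomial_function.intros(2-4) DERIV_add)
next
  case (mult f g)
  then obtain f' g' where "real_polynomial_function f'" "real_polynomial_function g'"
    "\<forall>x t. ((\<lambda>t. f (x + t *\<^sub>R \<nu>)) has_real_derivative f' (x + t *\<^sub>R \<nu>)) (at t)"
    "\<forall>x t. ((\<lambda>t. g (x + t *\<^sub>R \<nu>)) has_real_derivative g' (x + t *\<^sub>R \<nu>)) (at t)" by blast
  then show ?case using mult.hyps
    by (intro exI[of _ "\<lambda>x. f' x * g x + g' x * f x"]) (auto intro!: real_polynomial_function.intros(2-4) DERIV_mult)
qed

lemma dir_deriv_0 [simp]: "dir_deriv 0 \<nu> q = q"
  by (simp add: dir_deriv_def fun_eq_iff)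

lemma has_dir_deriv:
  fixes q :: "real ^ 'd::finite \<Rightarrow> real"
  assumes "real_polynomial_function q"
  shows "((\<lambda>t. q (x + t *\<^sub>R \<nu>)) has_real_derivative dir_deriv 1 \<nu> q (x + t *\<^sub>R \<nu>)) (at t)"
    and "real_polynomial_function (dir_deriv 1 \<nu> q)"
proof -
  obtain q' where q': "real_polynomial_function q'"
    "\<And>x t. ((\<lambda>t. q (x + t *\<^sub>R \<nu>)) has_real_derivative q' (x + t *\<^sub>R \<nu>)) (at t)"
    using polynomial_function_dir_deriv[OF assms] by blast
  have "dir_deriv 1 \<nu> q = q'"
    using DERIV_imp_deriv[OF q'(2)[of _ 0]] by (simp add: dir_deriv_def fun_eq_iff)
  then show "((\<lambda>t. q (x + t *\<^sub>R \<nu>)) has_real_derivative dir_deriv 1 \<nu> q (x + t *\<^sub>R \<nu>)) (at t)"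
    "real_polynomial_function (dir_deriv 1 \<nu> q)" using q' by auto
qed

lemma dir_deriv_Suc:
  fixes q :: "real ^ 'd::finite \<Rightarrow> real"
  assumes "real_polynomial_function q"
  shows "dir_deriv (Suc k) \<nu> q = dir_deriv k \<nu> (dir_deriv 1 \<nu> q)"
proof
  fix x
  have "deriv (\<lambda>t. q (x + t *\<^sub>R \<nu>)) = (\<lambda>t. dir_deriv 1 \<nu> q (x + t *\<^sub>R \<nu>))"
    using DERIV_imp_deriv[OF has_dir_deriv(1)[OF assms]] by blast
  then show "dir_deriv (Suc k) \<nu> q x = dir_deriv k \<nu> (dir_deriv 1 \<nu> q) x"
    unfolding dir_deriv_def[of "Suc k"] dir_deriv_def[of k] funpow_Suc_right comp_def by (rule arg_cong)
qed

lemma polynomial_function_dir_deriv_iter: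
  fixes q :: "real ^ 'd::finite \<Rightarrow> real"
  assumes "real_polynomial_function q"
  shows "real_polynomial_function (dir_deriv k \<nu> q)"
  using assms by (induction k arbitrary: q) (simp_all add: dir_deriv_Suc has_dir_deriv(2) del: One_nat_def)

text \<open>Linearity needs differentiability, as \<open>deriv\<close> is not linear on
  arbitrary functions.\<close>

lemma dir_deriv_linear:
  fixes q r :: "real ^ 'd::finite \<Rightarrow> real"
  assumes "real_polynomial_function q" "real_polynomial_function r"
  shows "dir_deriv k \<nu> (a *\<^sub>R q + b *\<^sub>R r) = a *\<^sub>R dir_deriv k \<nu> q + b *\<^sub>R dir_deriv k \<nu> r"
  using assms
proof (induction k arbitrary: q r)
  case (Suc k)
  have poly: "real_polynomial_function (a *\<^sub>R q + b *\<^sub>R r)"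
    using Suc.prems unfolding scaleR_fun_def plus_fun_def by (auto intro!: real_polynomial_function.intros(2-4))
  have 1: "dir_deriv 1 \<nu> (a *\<^sub>R q + b *\<^sub>R r) = a *\<^sub>R dir_deriv 1 \<nu> q + b *\<^sub>R dir_deriv 1 \<nu> r"
  proof
    fix x
    have "((\<lambda>t. a * q (x + t *\<^sub>R \<nu>) + b * r (x + t *\<^sub>R \<nu>)) has_real_derivative
        a * dir_deriv 1 \<nu> q (x + 0 *\<^sub>R \<nu>) + b * dir_deriv 1 \<nu> r (x + 0 *\<^sub>R \<nu>)) (at 0)"
      using Suc.prems by (intro DERIV_add DERIV_cmult has_dir_deriv(1))
    from DERIV_imp_deriv[OF this] show "dir_deriv 1 \<nu> (a *\<^sub>R q + b *\<^sub>R r) x = (a *\<^sub>R dir_deriv 1 \<nu> q + b *\<^sub>R dir_deriv 1 \<nu> r) x"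
      unfolding dir_deriv_def[of 1 \<nu> "a *\<^sub>R q + b *\<^sub>R r"] by (simp add: scaleR_fun_def)
  qed
  show ?case
    unfolding dir_deriv_Suc[OF poly] dir_deriv_Suc[OF Suc.prems(1)] dir_deriv_Suc[OF Suc.prems(2)] 1
    using Suc.prems by (intro Suc.IH has_dir_deriv(2))
qed simp

lemma constant_on_box_if_gradient_zero:
  fixes q :: "real ^ 'd::finite \<Rightarrow> real"
  assumes q: "real_polynomial_function q"
    and zero: "\<And>x i. x \<in> box a b \<Longrightarrow> dir_deriv 1 (axis i 1) q x = 0" and ne: "box a b \<noteq> {}"
  obtains k where "\<And>x. x \<in> cbox a b \<Longrightarrow> q x = k"
proof -
  have "(q has_derivative (\<lambda>h. 0)) (at x)" if x: "x \<in> box a b" for x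
  proof -
    obtain D where D: "(q has_derivative D) (at x)"
      using differentiable_at_real_polynomial_function[OF q] by (auto simp: differentiable_def)
    then interpret D: bounded_linear D by (rule has_derivative_bounded_linear)
    have "D (axis i 1) = 0" for i
    proof -
      have "((\<lambda>t. x + t *\<^sub>R axis i 1) has_derivative (\<lambda>t. t *\<^sub>R axis i 1)) (at 0)"
        by (auto intro!: derivative_eq_intros)
      from has_derivative_compose[OF this, of q D] D
      have "((\<lambda>t. q (x + t *\<^sub>R axis i 1)) has_real_derivative D (axis i 1)) (at 0)"
        by (simp add: has_field_derivative_def D.scaleR mult_commute_abs)
      moreover have "((\<lambda>t. q (x + t *\<^sub>R axis i 1)) has_real_derivative dir_deriv 1 (axis i 1) q (x + 0 *\<^sub>R axis i 1)) (at 0)"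
        by (rule has_dir_deriv(1)[OF q])
      ultimately show ?thesis using zero[OF x, of i] by (auto dest: DERIV_unique)
    qed
    then have "D h = 0" for h
      using D.sum[of "\<lambda>i. (h $ i) *\<^sub>R axis i 1" UNIV] basis_expansion[of h]
      by (simp add: D.scaleR scalar_mult_eq_scaleR)
    then have "D = (\<lambda>h. 0)" by auto
    with D show ?thesis by simp
  qed
  then obtain k where k: "\<And>x. x \<in> box a b \<Longrightarrow> q x = k"
    using has_derivative_zero_constant[of "box a b" q] by (metis convex_box(2) has_derivative_at_withinI)
  have cont: "continuous_on (closure (box a b)) q"
    using continuous_real_polymonial_function[OF q] by (simp add: continuous_at_imp_continuous_on)
  have "q x = k" if "x \<in> cbox a b" for x
    using continuous_constant_on_closure[OF cont k] that ne by (simp add: closure_box)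
  then show thesis by (rule that)
qed

lemma Rolle_roots:
  fixes f :: "real poly"
  assumes "finite S" "S \<noteq> {}" "\<And>x. x \<in> S \<Longrightarrow> poly f x = 0"
  shows "\<exists>R. finite R \<and> card R = card S - 1 \<and> (\<forall>r\<in>R. Min S < r \<and> r < Max S \<and> poly (pderiv f) r = 0)"
  using assms
proof (induction S rule: finite_linorder_max_induct)
  case (insert b A)
  show ?case
  proof (cases "A = {}")
    case True
    then show ?thesis by auto
  next
    case False
    then obtain R where R: "finite R" "card R = card A - 1"
      "\<forall>r\<in>R. Min A < r \<and> r < Max A \<and> poly (pderiv f) r = 0"
      using insert.IH insert.prems by auto
    have m: "Max A \<in> A" "Min A \<in> A" using insert False by auto
    have lt: "Max A < b" "Min A < b" using insert.hyps m by auto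
    have "poly f b = 0" "poly f (Max A) = 0" using insert.prems m by auto
    then obtain z where z: "Max A < z" "z < b" "poly (pderiv f) z = 0"
      using poly_MVT[OF lt(1), of f] lt by auto
    have MM: "Min (insert b A) = Min A" "Max (insert b A) = b"
      using lt Min_insert[OF insert.hyps(1) False, of b] Max_insert[OF insert.hyps(1) False, of b] by simp_all
    have "Min A \<le> Max A" using insert.hyps False by simp
    then have "z \<notin> R" "Min A < z" using R z by auto
    moreover have "card A \<noteq> 0" "b \<notin> A" using insert.hyps False by auto
    moreover have "Suc (card A - Suc 0) = card A" using insert.hyps False by (simp add: card_gt_0_iff)
    moreover have "r < b" if "r \<in> R" for r using R(3) that lt by force
    ultimately show ?thesis using R z lt insert.hyps unfolding MM
      by (intro exI[of _ "insert z R"]) simp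
  qed
qed simp

lemma power_dvd_pderiv:
  fixes f q :: "real poly"
  assumes "q ^ Suc n dvd f" shows "q ^ n dvd pderiv f"
proof -
  obtain g where "f = q ^ Suc n * g" using assms by (auto simp: dvd_def)
  then have "pderiv f = q ^ n * (q * pderiv g + smult (of_nat (Suc n)) (pderiv q) * g)"
    by (simp only: pderiv_mult pderiv_power_Suc) (simp add: algebra_simps)
  then show ?thesis by simp
qed

text \<open>While \<open>k < p\<close>, the \<open>k\<close>-th derivative of \<open>(x\<^sup>2
  - 1) ^ p\<close> still vanishes at \<open>-1\<close> and \<open>1\<close>; together with its
  \<open>k\<close> interior roots, Rolle's theorem produces \<open>k + 1\<close> interior roots of
  the next derivative.\<close>

lemma Rodrigues_roots:
  assumes "k \<le> p"
  shows "([:-1, 0, 1:] :: real poly) ^ (p - k) dvd (pderiv ^^ k) ([:-1, 0, 1:] ^ p)"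
    and "\<exists>R. finite R \<and> card R = k \<and> (\<forall>r\<in>R. -1 < r \<and> r < 1 \<and> poly ((pderiv ^^ k) ([:-1, 0, 1:] ^ p)) (r::real) = 0)"
  using assms
proof (induction k)
  case (Suc k)
  define f where "f = (pderiv ^^ k) ([:-1, 0, 1:] ^ p :: real poly)"
  have f: "[:-1, 0, 1:] ^ Suc (p - Suc k) dvd f" if "Suc k \<le> p"
    using Suc.IH(1) that by (simp add: f_def Suc_diff_Suc del: power_Suc)
  {
    case 1
    then show ?case using power_dvd_pderiv[OF f] 1 by (simp add: f_def)
  next
    case 2
    obtain R where R: "finite R" "card R = k" "\<forall>r\<in>R. -1 < r \<and> r < 1 \<and> poly f r = 0"
      using Suc.IH(2) 2 by (auto simp: f_def)
    obtain g where g: "f = [:-1, 0, 1:] ^ Suc (p - Suc k) * g" using f 2 unfolding dvd_def by blast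
    have "poly f 1 = 0" "poly f (-1) = 0" unfolding g by simp_all
    then have roots: "poly f x = 0" if "x \<in> insert (-1) (insert 1 R)" for x using that R by auto
    have "-1 \<notin> insert 1 R" "1 \<notin> R" using R by auto
    then have card: "card (insert (-1) (insert 1 R)) = k + 2" using R by simp
    have MM: "Min (insert (-1) (insert 1 R)) = -1" "Max (insert (-1) (insert 1 R)) = 1"
      using R(1,3) by - (rule Min_eqI, force+, rule Max_eqI, force+)
    have "finite (insert (-1) (insert 1 R))" "insert (-1) (insert 1 R) \<noteq> {}" using R by auto
    from Rolle_roots[OF this roots]
    obtain R' where "finite R'" "card R' = card (insert (-1) (insert 1 R)) - 1"
      "\<forall>r\<in>R'. -1 < r \<and> r < 1 \<and> poly (pderiv f) r = 0" unfolding MM by blast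
    then show ?case using card by (intro exI[of _ R']) (auto simp: f_def)
  }
qed auto

lemma degree_pderiv_funpow: "degree ((pderiv ^^ k) f) = degree (f :: real poly) - k"
  by (induction k) (auto simp: degree_pderiv)

text \<open>Rolle's theorem gives \<open>p - 1\<close> roots of the derivative of the Legendre
  polynomial in \<open>(-1, 1)\<close>, and its degree \<open>p - 1\<close> leaves no room for
  others.\<close>

lemma gauss_lobatto_nodes:
  assumes "1 \<le> p"
  shows "finite (gauss_lobatto p)" "card (gauss_lobatto p) = p + 1" "gauss_lobatto p \<subseteq> {-1..1}"
proof -
  define f where "f = (pderiv ^^ p) ([:-1, 0, 1:] ^ p :: real poly)"
  obtain R where R: "finite R" "card R = p" "\<forall>r\<in>R. -1 < r \<and> r < 1 \<and> poly f r = 0"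
    using Rodrigues_roots(2)[of p p] by (auto simp: f_def)
  have "R \<noteq> {}" using R assms by auto
  with Rolle_roots[of R f] R obtain R' where R': "finite R'" "card R' = p - 1"
    "\<forall>r\<in>R'. Min R < r \<and> r < Max R \<and> poly (pderiv f) r = 0" by auto
  have in01: "-1 < Min R" "Max R < 1" using R \<open>R \<noteq> {}\<close> by auto
  define L where "L = pderiv (legendre p)"
  have L: "L = smult (1 / (2 ^ p * fact p)) (pderiv f)" by (simp add: L_def legendre_def f_def pderiv_smult)
  have "degree f = p" by (simp add: f_def degree_pderiv_funpow degree_power_eq)
  then have "pderiv f \<noteq> 0" using assms by (simp add: pderiv_eq_0_iff)
  then have L0: "L \<noteq> 0" "degree L = p - 1" using \<open>degree f = p\<close> by (simp_all add: L degree_pderiv)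
  have sub: "R' \<subseteq> {\<xi>. poly L \<xi> = 0}" using R' by (auto simp: L)
  have "card {\<xi>. poly L \<xi> = 0} \<le> card R'" using card_poly_roots_bound[OF L0(1)] L0 R' by simp
  then have eq: "R' = {\<xi>. poly L \<xi> = 0}"
    by (intro card_seteq poly_roots_finite L0 sub)
  have gl: "gauss_lobatto p = insert (-1) (insert 1 R')" by (auto simp: gauss_lobatto_def L_def[symmetric] eq)
  have R01: "-1 < r \<and> r < 1" if "r \<in> R'" for r using R'(3) in01 that by force
  then have "-1 \<notin> insert 1 R'" "1 \<notin> R'" by auto
  then show "card (gauss_lobatto p) = p + 1" using R' assms by (simp add: gl)
  show "finite (gauss_lobatto p)" using R' by (simp add: gl)
  show "gauss_lobatto p \<subseteq> {-1..1}" using R01 by (force simp: gl)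
qed

section \<open>Finite element functions and nodal bases on a background grid\<close>

lemma Qp_prod:
  fixes f :: "'d::finite \<Rightarrow> real poly"
  assumes "\<And>i. degree (f i) \<le> p"
  shows "(\<lambda>x. \<Prod>i\<in>UNIV. poly (f i) (x $ i)) \<in> Qp p"
proof -
  have eq: "PiE UNIV (\<lambda>_. {..p}) = {\<alpha> :: 'd \<Rightarrow> nat. \<forall>i. \<alpha> i \<le> p}" by (auto simp: PiE_def)
  have "(\<Prod>i\<in>UNIV. poly (f i) (x $ i)) =
      (\<Sum>\<alpha> | \<forall>i. \<alpha> i \<le> p. (\<Prod>i\<in>UNIV. coeff (f i) (\<alpha> i)) * (\<Prod>i\<in>UNIV. (x $ i) ^ \<alpha> i))" for x :: "real ^ 'd"
  proof -
    have "poly (f i) t = (\<Sum>k\<le>p. coeff (f i) k * t ^ k)" for i t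
      unfolding poly_altdef using assms[of i] by (intro sum.mono_neutral_left) (auto simp: coeff_eq_0)
    then have "(\<Prod>i\<in>UNIV. poly (f i) (x $ i)) = (\<Prod>i\<in>UNIV. \<Sum>k\<le>p. coeff (f i) k * (x $ i) ^ k)" by simp
    also have "\<dots> = (\<Sum>\<alpha>\<in>PiE UNIV (\<lambda>_. {..p}). \<Prod>i\<in>UNIV. coeff (f i) (\<alpha> i) * (x $ i) ^ \<alpha> i)"
      by (rule prod_sum_PiE) auto
    finally show ?thesis by (simp add: eq prod.distrib)
  qed
  then show ?thesis unfolding Qp_def by auto
qed

lemma finite_int_vectors:
  "finite {z :: int ^ 'd::finite. \<forall>i. a i \<le> z $ i \<and> z $ i \<le> b i}"
proof -
  have "{z :: int ^ 'd. \<forall>i. a i \<le> z $ i \<and> z $ i \<le> b i} \<subseteq> (\<lambda>f. \<chi> i. f i) ` PiE UNIV (\<lambda>i. {a i..b i})"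
  proof
    fix z :: "int ^ 'd" assume "z \<in> {z. \<forall>i. a i \<le> z $ i \<and> z $ i \<le> b i}"
    then have "(\<lambda>i. z $ i) \<in> PiE UNIV (\<lambda>i. {a i..b i})" by auto
    moreover have "z = (\<chi> i. z $ i)" by (simp add: vec_eq_iff)
    ultimately show "z \<in> (\<lambda>f. \<chi> i. f i) ` PiE UNIV (\<lambda>i. {a i..b i})" by blast
  qed
  moreover have "finite (PiE UNIV (\<lambda>i::'d. {a i..b i}))" by (intro finite_PiE) auto
  ultimately show ?thesis by (meson finite_imageI finite_subset)
qed

lemma sum_apply: "(\<Sum>a\<in>A. f a) x = (\<Sum>a\<in>A. (f a x :: 'b::comm_monoid_add))"
  by (induction A rule: infinite_finite_induct) auto

definition lagrange_basis :: "real set \<Rightarrow> real \<Rightarrow> real poly" where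
  "lagrange_basis X \<xi> = (\<Prod>\<eta>\<in>X - {\<xi>}. smult (1 / (\<xi> - \<eta>)) [:-\<eta>, 1:])"

lemma poly_lagrange_basis:
  assumes "finite X" "\<xi> \<in> X" "\<eta> \<in> X"
  shows "poly (lagrange_basis X \<xi>) \<eta> = (if \<xi> = \<eta> then 1 else 0)"
proof (cases "\<xi> = \<eta>")
  case True
  have "poly (smult (1 / (\<xi> - x)) [:- x, 1:]) \<xi> = 1" if "x \<noteq> \<xi>" for x
    using that by (simp add: divide_eq_1_iff flip: diff_divide_distrib)
  then have "poly (lagrange_basis X \<xi>) \<xi> = 1"
    unfolding lagrange_basis_def poly_prod by (intro prod.neutral) auto
  with True show ?thesis by simp
next
  case False
  then show ?thesis using assms by (auto simp: lagrange_basis_def poly_prod intro!: prod_zero)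
qed

lemma degree_lagrange_basis:
  assumes "finite X" "\<xi> \<in> X"
  shows "degree (lagrange_basis X \<xi>) \<le> card X - 1"
proof -
  have "degree (lagrange_basis X \<xi>) \<le> (\<Sum>\<eta>\<in>X - {\<xi>}. degree (smult (1 / (\<xi> - \<eta>)) [:-\<eta>, 1:]))"
    unfolding lagrange_basis_def using assms degree_prod_sum_le[of "X - {\<xi>}" "\<lambda>\<eta>. smult (1 / (\<xi> - \<eta>)) [:-\<eta>, 1:]"] by (simp add: comp_def)
  also have "\<dots> \<le> (\<Sum>\<eta>\<in>X - {\<xi>}. 1)" by (intro sum_mono) (auto intro: order_trans[OF degree_smult_le])
  finally show ?thesis using assms by simp
qed

lemma Qp_continuous_on:
  fixes q :: "real ^ 'd::finite \<Rightarrow> real"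
  assumes "q \<in> Qp p" shows "continuous_on S q"
proof -
  have "isCont q x" for x
    by (rule continuous_real_polymonial_function[OF Qp_polynomial_function[OF assms]])
  then show ?thesis by (simp add: continuous_at_imp_continuous_on)
qed

text \<open>What follows from geometry alone is kept apart from the stability estimates, so that
  the same facts are available at level \<open>l - 1\<close> for the coarse space.\<close>

locale cutfem_level =
  fixes c :: "('d::finite) cut_config" and p l :: nat
  assumes valid: "valid_config c" and C2: "C2_boundary (region c)"
    and dim: "2 \<le> CARD('d)" and degree: "1 \<le> p"
begin

abbreviation "h \<equiv> mesh_size c l"

lemma h_pos: "0 < h"
  using valid by (simp add: mesh_size_def valid_config_def)

definition cell_interior :: "int ^ 'd \<Rightarrow> (real ^ 'd) set" where
  "cell_interior z = box (vertex c l z) (vertex c l (\<chi> i. z $ i + 1))"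

lemma mem_cell: "x \<in> cell c l z \<longleftrightarrow>
   (\<forall>i. of_int (z $ i) \<le> (x $ i - origin c $ i) / h \<and> (x $ i - origin c $ i) / h \<le> of_int (z $ i) + 1)"
  using h_pos by (simp add: cell_def mem_box_cart vertex_def field_simps)

lemma mem_cell_interior: "x \<in> cell_interior z \<longleftrightarrow>
   (\<forall>i. of_int (z $ i) < (x $ i - origin c $ i) / h \<and> (x $ i - origin c $ i) / h < of_int (z $ i) + 1)"
  using h_pos by (simp add: cell_interior_def mem_box_cart vertex_def field_simps)

lemma cell_interior_subset: "cell_interior z \<subseteq> cell c l z"
  by (auto simp: mem_cell mem_cell_interior less_imp_le)

lemma cell_interior_unique: "x \<in> cell_interior z \<Longrightarrow> x \<in> cell c l z' \<Longrightarrow> z' = z"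
proof -
  assume x: "x \<in> cell_interior z" "x \<in> cell c l z'"
  have "z' $ i = z $ i" for i
  proof -
    have "of_int (z $ i) < (real_of_int (z' $ i) + 1)" "real_of_int (z' $ i) < of_int (z $ i) + 1"
      using x unfolding mem_cell mem_cell_interior by (meson le_less_trans less_le_trans)+
    then show ?thesis by linarith
  qed
  then show ?thesis by (simp add: vec_eq_iff)
qed

lemma cell_interior_nonempty: "cell_interior z \<noteq> {}"
proof -
  have "(\<chi> i. origin c $ i + h * (of_int (z $ i) + 1 / 2)) \<in> cell_interior z"
    using h_pos by (simp add: mem_cell_interior)
  then show ?thesis by blast
qed

lemma closed_cell: "closed (cell c l z)" and compact_cell: "compact (cell c l z)"
  by (simp_all add: cell_def closed_cbox)

lemma closure_cell_interior: "closure (cell_interior z) = cell c l z"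
  using cell_interior_nonempty[of z] by (simp add: cell_interior_def cell_def closure_box)

lemma finite_cells_meeting:
  assumes "bounded S" shows "finite {z. cell c l z \<inter> S \<noteq> {}}"
proof -
  obtain B where B: "\<And>x. x \<in> S \<Longrightarrow> norm x \<le> B" using assms by (auto simp: bounded_iff)
  have "{z. cell c l z \<inter> S \<noteq> {}} \<subseteq>
      {z. \<forall>i. \<lfloor>(- B - origin c $ i) / h\<rfloor> - 1 \<le> z $ i \<and> z $ i \<le> \<lceil>(B - origin c $ i) / h\<rceil>}"
  proof
    fix z assume "z \<in> {z. cell c l z \<inter> S \<noteq> {}}"
    then obtain x where x: "x \<in> cell c l z" "x \<in> S" by auto
    have "\<lfloor>(- B - origin c $ i) / h\<rfloor> - 1 \<le> z $ i \<and> z $ i \<le> \<lceil>(B - origin c $ i) / h\<rceil>" for i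
    proof -
      have "\<bar>x $ i\<bar> \<le> B" using B[OF x(2)] component_le_norm_cart[of x i] by linarith
      then have "(- B - origin c $ i) / h \<le> (x $ i - origin c $ i) / h" "(x $ i - origin c $ i) / h \<le> (B - origin c $ i) / h"
        using h_pos by (auto intro!: divide_right_mono)
      moreover have "of_int (z $ i) \<le> (x $ i - origin c $ i) / h" "(x $ i - origin c $ i) / h \<le> of_int (z $ i) + 1"
        using x(1) by (auto simp: mem_cell)
      ultimately show ?thesis by linarith
    qed
    then show "z \<in> {z. \<forall>i. \<lfloor>(- B - origin c $ i) / h\<rfloor> - 1 \<le> z $ i \<and> z $ i \<le> \<lceil>(B - origin c $ i) / h\<rceil>}" by blast
  qed
  then show ?thesis by (rule finite_subset) (rule finite_int_vectors)
qed

lemma region_bounded: "bounded (region c)" and region_open: "open (region c)"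
  and region_connected: "connected (region c)" and region_nonempty: "region c \<noteq> {}"
  using valid by (auto simp: valid_config_def)

lemma frontier_compact: "compact (frontier (region c))"
  using region_bounded by (simp add: compact_frontier_bounded)

lemma finite_active_cells: "finite (active_cells c l)"
  unfolding active_cells_def by (rule finite_cells_meeting[OF region_bounded])

lemma finite_cut_cells: "finite (cut_cells c l)"
  unfolding cut_cells_def by (rule finite_cells_meeting) (simp add: frontier_compact compact_imp_bounded)

lemma vertex_in_cell: "vertex c l j \<in> cell c l z \<longleftrightarrow> (\<forall>i. z $ i \<le> j $ i \<and> j $ i \<le> z $ i + 1)"
proof -
  have "(vertex c l j $ i - origin c $ i) / h = of_int (j $ i)" for i
    using h_pos by (simp add: vertex_def)
  then have "vertex c l j \<in> cell c l z \<longleftrightarrow>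
      (\<forall>i. real_of_int (z $ i) \<le> real_of_int (j $ i) \<and> real_of_int (j $ i) \<le> real_of_int (z $ i) + 1)"
    by (simp add: mem_cell)
  also have "\<dots> \<longleftrightarrow> (\<forall>i. z $ i \<le> j $ i \<and> j $ i \<le> z $ i + 1)"
    by (intro all_cong1) linarith
  finally show ?thesis .
qed

lemma finite_adm_vertices: "finite (adm_vertices c l)"
proof -
  have "adm_vertices c l \<subseteq> active_cells c l \<union>
      (\<Union>z\<in>cut_cells c l. {j. \<forall>i. z $ i \<le> j $ i \<and> j $ i \<le> z $ i + 1})"
  proof
    fix j assume j: "j \<in> adm_vertices c l"
    have own: "vertex c l j \<in> cell c l j" by (simp add: vertex_in_cell)
    consider "vertex c l j \<in> region c" | z where "z \<in> cut_cells c l" "vertex c l j \<in> cell c l z"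
      using j unfolding adm_vertices_def by blast
    then show "j \<in> active_cells c l \<union> (\<Union>z\<in>cut_cells c l. {j. \<forall>i. z $ i \<le> j $ i \<and> j $ i \<le> z $ i + 1})"
    proof cases
      case 1
      then have "j \<in> active_cells c l" using own unfolding active_cells_def by blast
      then show ?thesis by (rule UnI1)
    next
      case 2
      then show ?thesis unfolding vertex_in_cell by (intro UnI2 UN_I[of z]) simp_all
    qed
  qed
  moreover have "finite (\<Union>z\<in>cut_cells c l. {j. \<forall>i. z $ i \<le> j $ i \<and> j $ i \<le> z $ i + 1})"
    by (intro finite_UN_I finite_cut_cells finite_int_vectors)
  ultimately show ?thesis using finite_active_cells by (meson finite_Un finite_subset)
qed

lemma closed_active_region: "closed (active_region c l)"
  unfolding active_region_def using finite_active_cells closed_cell by auto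

lemma compact_active_region: "compact (active_region c l)"
  unfolding active_region_def using finite_active_cells compact_cell by auto

lemma region_subset_active: "region c \<subseteq> active_region c l"
proof
  fix x assume x: "x \<in> region c"
  define z where "z = (\<chi> i. \<lfloor>(x $ i - origin c $ i) / h\<rfloor>)"
  have "x \<in> cell c l z" unfolding mem_cell z_def by (simp add: less_imp_le)
  then show "x \<in> active_region c l" using x by (auto simp: active_region_def active_cells_def)
qed

lemma frontier_subset_active: "frontier (region c) \<subseteq> active_region c l"
  using closure_minimal[OF region_subset_active closed_active_region] by (auto simp: frontier_def)

definition cell_node :: "int ^ 'd \<Rightarrow> real ^ 'd \<Rightarrow> real ^ 'd" where
  "cell_node z \<xi> = vertex c l z + h *\<^sub>R (\<chi> i. (1 + \<xi> $ i) / 2)"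

text \<open>The point with reference coordinate \<open>\<xi>\<close> in the interval
  \<open>k\<close> of the grid on axis \<open>i\<close>.\<close>

definition axis_node :: "'d \<Rightarrow> int \<Rightarrow> real \<Rightarrow> real" where
  "axis_node i k \<xi> = origin c $ i + h * (of_int k + (1 + \<xi>) / 2)"

lemma cell_node_component: "cell_node z \<xi> $ i = axis_node i (z $ i) (\<xi> $ i)"
  by (simp add: cell_node_def axis_node_def vertex_def algebra_simps)

lemma nodes_eq: "nodes c p l = {cell_node z \<xi> | z \<xi>. z \<in> active_cells c l \<and> (\<forall>i. \<xi> $ i \<in> gauss_lobatto p)}"
  by (simp add: nodes_def cell_node_def)

lemma cell_node_in_cell: "(\<And>i. \<xi> $ i \<in> gauss_lobatto p) \<Longrightarrow> cell_node z \<xi> \<in> cell c l z"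
proof -
  assume "\<And>i. \<xi> $ i \<in> gauss_lobatto p"
  then have "-1 \<le> \<xi> $ i" "\<xi> $ i \<le> 1" for i using gauss_lobatto_nodes(3)[OF degree] by force+
  then have "0 \<le> 1 + \<xi> $ i" "1 + \<xi> $ i \<le> 2" for i by (smt (verit))+
  moreover have "(axis_node i k t - origin c $ i) / h = of_int k + (1 + t) / 2" for i k t
    using h_pos by (simp add: axis_node_def)
  ultimately show ?thesis by (simp add: mem_cell cell_node_component)
qed

lemma axis_node_inj: "axis_node i k \<xi> = axis_node i k \<eta> \<longleftrightarrow> \<xi> = \<eta>"
  using h_pos by (simp add: axis_node_def)

lemma Qp_zero_if_zero_at_nodes:
  assumes q: "q \<in> Qp p" and zero: "\<And>\<xi>. (\<And>i. \<xi> $ i \<in> gauss_lobatto p) \<Longrightarrow> q (cell_node z \<xi>) = 0"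
  shows "q = 0"
proof
  fix x
  define X where "X = (\<lambda>i. axis_node i (z $ i) ` gauss_lobatto p)"
  have "card (X i) = p + 1" for i
    unfolding X_def using gauss_lobatto_nodes(2)[OF degree] by (subst card_image) (auto intro: inj_onI simp: axis_node_inj)
  then have card: "p < card (X i)" for i by simp
  have "q y = 0" if "\<And>i. y $ i \<in> X i" for y
  proof -
    have "\<exists>\<xi>\<in>gauss_lobatto p. y $ i = axis_node i (z $ i) \<xi>" for i using that[of i] unfolding X_def by blast
    then obtain f where f: "\<And>i. f i \<in> gauss_lobatto p" "\<And>i. y $ i = axis_node i (z $ i) (f i)" by metis
    then have "y = cell_node z (\<chi> i. f i)" by (simp add: vec_eq_iff cell_node_component)
    then show ?thesis using zero[of "\<chi> i. f i"] f by simp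
  qed
  then have "q x = 0" by (rule Qp_unisolvence[OF q card])
  then show "q x = 0 x" by simp
qed

lemma Qp_eq_if_eq_on_cell:
  assumes "q \<in> Qp p" "r \<in> Qp p" "\<And>x. x \<in> cell c l z \<Longrightarrow> q x = r x"
  shows "q = r"
proof -
  have "q - r \<in> Qp p" using assms by (intro subspace_diff[OF subspace_Qp])
  then have "q - r = 0" by (rule Qp_zero_if_zero_at_nodes[of _ z]) (simp add: assms(3) cell_node_in_cell)
  then show ?thesis by simp
qed

abbreviation V :: "(real ^ 'd \<Rightarrow> real) set" where "V \<equiv> fe_space c p l"

lemma cell_poly_eqI:
  assumes "q \<in> Qp p" "\<And>x. x \<in> cell c l z \<Longrightarrow> q x = u x"
  shows "cell_poly c p l u z = q"
  unfolding cell_poly_def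
proof (rule the_equality)
  show "q \<in> Qp p \<and> (\<forall>x\<in>cell c l z. q x = u x)" using assms by blast
  fix r assume r: "r \<in> Qp p \<and> (\<forall>x\<in>cell c l z. r x = u x)"
  show "r = q" by (rule Qp_eq_if_eq_on_cell[of _ _ z]) (use r assms in auto)
qed

lemma cell_poly:
  assumes "u \<in> V" "z \<in> active_cells c l"
  shows "cell_poly c p l u z \<in> Qp p" "x \<in> cell c l z \<Longrightarrow> cell_poly c p l u z x = u x"
proof -
  obtain q where q: "q \<in> Qp p" "\<forall>x\<in>cell c l z. u x = q x" using assms by (auto simp: fe_space_def)
  then have "cell_poly c p l u z = q" by (intro cell_poly_eqI) auto
  then show "cell_poly c p l u z \<in> Qp p" "x \<in> cell c l z \<Longrightarrow> cell_poly c p l u z x = u x" using q by auto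
qed

lemma subspace_V: "subspace V"
proof (rule subspaceI)
  have "(0 :: real ^ 'd \<Rightarrow> real) \<in> Qp p" using subspace_Qp by (rule subspace_0)
  then show "0 \<in> V" by (auto simp: fe_space_def zero_fun_def)
  fix u v :: "real ^ 'd \<Rightarrow> real" and r :: real assume u: "u \<in> V"
  {
    assume v: "v \<in> V"
    show "u + v \<in> V"
      unfolding fe_space_def mem_Collect_eq
    proof (intro conjI ballI allI impI)
      show "continuous_on (active_region c l) (u + v)"
        using u v unfolding plus_fun_def by (intro continuous_on_add) (auto simp: fe_space_def)
      fix z assume z: "z \<in> active_cells c l"
      show "\<exists>q\<in>Qp p. \<forall>x\<in>cell c l z. (u + v) x = q x"
        using cell_poly[OF u z] cell_poly[OF v z] subspace_add[OF subspace_Qp]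
        by (intro bexI[of _ "cell_poly c p l u z + cell_poly c p l v z"]) auto
    qed (use u v in \<open>auto simp: fe_space_def\<close>)
  }
  show "r *\<^sub>R u \<in> V"
    unfolding fe_space_def mem_Collect_eq
  proof (intro conjI ballI allI impI)
    show "continuous_on (active_region c l) (r *\<^sub>R u)"
      using u unfolding scaleR_fun_def by (intro continuous_on_scaleR continuous_on_const) (auto simp: fe_space_def)
    fix z assume z: "z \<in> active_cells c l"
    show "\<exists>q\<in>Qp p. \<forall>x\<in>cell c l z. (r *\<^sub>R u) x = q x"
      using cell_poly[OF u z] subspace_scale[OF subspace_Qp]
      by (intro bexI[of _ "r *\<^sub>R cell_poly c p l u z"]) (auto simp: scaleR_fun_def)
  qed (use u in \<open>auto simp: fe_space_def scaleR_fun_def\<close>)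
qed

lemma cell_poly_linear:
  assumes "u \<in> V" "v \<in> V" "z \<in> active_cells c l"
  shows "cell_poly c p l (a *\<^sub>R u + b *\<^sub>R v) z = a *\<^sub>R cell_poly c p l u z + b *\<^sub>R cell_poly c p l v z"
  using cell_poly[OF assms(1,3)] cell_poly[OF assms(2,3)]
  by (intro cell_poly_eqI subspace_add subspace_scale subspace_Qp) (auto simp: scaleR_fun_def)

lemma fe_eqI:
  assumes "u \<in> V" "v \<in> V" "\<And>z x. z \<in> active_cells c l \<Longrightarrow> x \<in> cell c l z \<Longrightarrow> u x = v x"
  shows "u = v"
proof
  fix x show "u x = v x"
    using assms by (cases "x \<in> active_region c l") (auto simp: active_region_def fe_space_def)
qed

text \<open>Assigning to each point of the active mesh one cell that contains it decomposes a
  finite element function into truncated monomials. These are discontinuous, so they span a larger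
  space, but a finite spanning set is all that the orthogonal projections need.\<close>

lemma fe_space_finite_dimensional: "\<exists>B. finite B \<and> V \<subseteq> span B"
proof -
  define sel where "sel = (\<lambda>x. SOME z. z \<in> active_cells c l \<and> x \<in> cell c l z)"
  have sel: "sel x \<in> active_cells c l" "x \<in> cell c l (sel x)" if "x \<in> active_region c l" for x
    using that someI_ex[of "\<lambda>z. z \<in> active_cells c l \<and> x \<in> cell c l z"] by (auto simp: sel_def active_region_def)
  define b where "b = (\<lambda>z \<alpha> (x::real^'d). if x \<in> active_region c l \<and> sel x = z then \<Prod>i\<in>UNIV. (x $ i) ^ (\<alpha> i :: nat) else 0)"
  define I where "I = {\<alpha> :: 'd \<Rightarrow> nat. \<forall>i. \<alpha> i \<le> p}"
  define B where "B = (\<lambda>(z, \<alpha>). b z \<alpha>) ` (active_cells c l \<times> I)"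
  have "u \<in> span B" if u: "u \<in> V" for u
  proof -
    have "\<forall>z\<in>active_cells c l. \<exists>a. \<forall>x\<in>cell c l z. u x = (\<Sum>\<alpha>\<in>I. a \<alpha> * (\<Prod>i\<in>UNIV. (x $ i) ^ \<alpha> i))"
      using u unfolding fe_space_def Qp_def I_def by fastforce
    then obtain a where a: "\<And>z x. z \<in> active_cells c l \<Longrightarrow> x \<in> cell c l z \<Longrightarrow> u x = (\<Sum>\<alpha>\<in>I. a z \<alpha> * (\<Prod>i\<in>UNIV. (x $ i) ^ \<alpha> i))"
      by metis
    have "u x = (\<Sum>z\<in>active_cells c l. \<Sum>\<alpha>\<in>I. a z \<alpha> *\<^sub>R b z \<alpha>) x" for x
    proof (cases "x \<in> active_region c l")
      case True
      have "(\<Sum>z\<in>active_cells c l. \<Sum>\<alpha>\<in>I. a z \<alpha> *\<^sub>R b z \<alpha>) x = (\<Sum>z\<in>active_cells c l. \<Sum>\<alpha>\<in>I. a z \<alpha> * b z \<alpha> x)"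
        by (simp add: sum_apply scaleR_fun_def)
      also have "\<dots> = (\<Sum>z\<in>active_cells c l. if z = sel x then \<Sum>\<alpha>\<in>I. a z \<alpha> * (\<Prod>i\<in>UNIV. (x $ i) ^ \<alpha> i) else 0)"
        using True by (intro sum.cong) (auto simp: b_def)
      also have "\<dots> = u x"
        using finite_active_cells sel[OF True] a[of "sel x" x] by (simp add: sum.delta)
      finally show ?thesis by simp
    next
      case False
      then show ?thesis using u by (simp add: sum_apply scaleR_fun_def b_def fe_space_def)
    qed
    then have "u = (\<Sum>z\<in>active_cells c l. \<Sum>\<alpha>\<in>I. a z \<alpha> *\<^sub>R b z \<alpha>)" by blast
    also have "\<dots> \<in> span B"
      by (intro span_sum span_scale span_base) (auto simp: B_def)
    finally show ?thesis .
  qed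
  moreover have "finite B" unfolding B_def I_def using finite_active_cells finite_exponents by auto
  ultimately show ?thesis by blast
qed

text \<open>The polynomial on interval \<open>k\<close> of axis \<open>i\<close> of the
  one-dimensional nodal function for the node at coordinate \<open>t\<close>. At most one
  \<open>\<xi>\<close> contributes; if \<open>t\<close> is not a node of the interval, the sum is
  empty and the polynomial zero.\<close>

definition axis_basis :: "'d \<Rightarrow> int \<Rightarrow> real \<Rightarrow> real poly" where
  "axis_basis i k t = (\<Sum>\<xi> | \<xi> \<in> gauss_lobatto p \<and> axis_node i k \<xi> = t.
     pcompose (lagrange_basis (gauss_lobatto p) \<xi>) [:- 2 * origin c $ i / h - 2 * of_int k - 1, 2 / h:])"

lemma axis_basis_node:
  assumes "\<eta> \<in> gauss_lobatto p"
  shows "poly (axis_basis i k t) (axis_node i k \<eta>) = (if axis_node i k \<eta> = t then 1 else 0)"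
proof -
  have aff: "poly [:- 2 * origin c $ i / h - 2 * of_int k - 1, 2 / h:] (axis_node i k \<eta>) = \<eta>"
    using h_pos by (simp add: axis_node_def field_simps)
  have fin: "finite (gauss_lobatto p)" by (rule gauss_lobatto_nodes(1)[OF degree])
  have "poly (axis_basis i k t) (axis_node i k \<eta>) =
      (\<Sum>\<xi> | \<xi> \<in> gauss_lobatto p \<and> axis_node i k \<xi> = t. if \<xi> = \<eta> then 1 else 0)"
    unfolding axis_basis_def poly_sum poly_pcompose aff
    by (intro sum.cong) (auto simp: poly_lagrange_basis[OF fin _ assms])
  also have "\<dots> = (if axis_node i k \<eta> = t then 1 else 0)"
    using fin assms by (simp add: sum.delta)
  finally show ?thesis .
qed

lemma degree_axis_basis: "degree (axis_basis i k t) \<le> p"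
proof -
  have fin: "finite (gauss_lobatto p)" "card (gauss_lobatto p) = p + 1"
    using gauss_lobatto_nodes[OF degree] by auto
  have "degree (pcompose (lagrange_basis (gauss_lobatto p) \<xi>) [:a, 2 / h:]) \<le> p"
    if "\<xi> \<in> gauss_lobatto p" for \<xi> a
    using degree_pcompose_le[of "lagrange_basis (gauss_lobatto p) \<xi>" "[:a, 2 / h:]"]
      degree_lagrange_basis[OF fin(1) that] fin(2) h_pos by simp
  then show ?thesis unfolding axis_basis_def using fin by (intro degree_sum_le) auto
qed

text \<open>Neighbouring intervals share only an endpoint, which is a node of both because
  \<open>-1\<close> and \<open>1\<close> are Gauss-Lobatto points.\<close>

lemma axis_basis_consistent:
  assumes "of_int k \<le> (s - origin c $ i) / h" "(s - origin c $ i) / h \<le> of_int k + 1"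
    "of_int k' \<le> (s - origin c $ i) / h" "(s - origin c $ i) / h \<le> of_int k' + 1"
  shows "poly (axis_basis i k t) s = poly (axis_basis i k' t) s"
proof -
  have GL: "1 \<in> gauss_lobatto p" "-1 \<in> gauss_lobatto p" by (auto simp: gauss_lobatto_def)
  have endpoint: "poly (axis_basis i k t) s = poly (axis_basis i k' t) s"
    if "k' = k + 1" "(s - origin c $ i) / h = of_int k'" for k k'
  proof -
    have s: "s = axis_node i k 1" "s = axis_node i k' (-1)"
      using that h_pos by (simp_all add: axis_node_def field_simps)
    show ?thesis using axis_basis_node[OF GL(1), of i k t] axis_basis_node[OF GL(2), of i k' t] s by simp
  qed
  have "real_of_int k \<le> of_int k' + 1" "real_of_int k' \<le> of_int k + 1" using assms by linarith+
  then consider "k = k'" | "k' = k + 1" | "k = k' + 1" by linarith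
  then show ?thesis
  proof cases
    case 2
    then show ?thesis using assms by (intro endpoint) auto
  next
    case 3
    then show ?thesis using assms by (intro endpoint[symmetric]) auto
  qed simp
qed

lemma fe_zero_if_zero_at_nodes:
  assumes u: "u \<in> V" and z: "z \<in> active_cells c l"
    and zero: "\<And>y. y \<in> nodes c p l \<Longrightarrow> y \<in> cell c l z \<Longrightarrow> u y = 0"
  shows "cell_poly c p l u z = 0"
proof (rule Qp_zero_if_zero_at_nodes[OF cell_poly(1)[OF u z]])
  fix \<xi> :: "real ^ 'd" assume \<xi>: "\<And>i. \<xi> $ i \<in> gauss_lobatto p"
  then have "cell_node z \<xi> \<in> cell c l z" "cell_node z \<xi> \<in> nodes c p l"
    using z cell_node_in_cell by (auto simp: nodes_eq)
  then show "cell_poly c p l u z (cell_node z \<xi>) = 0" using cell_poly(2)[OF u z] zero by simp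
qed

text \<open>The nodal function is a product of one-dimensional ones. These depend on the
  coordinates of a cell separately, so the agreement on common faces follows from agreement at
  interval endpoints.\<close>

lemma nodal_basis_exists: "\<exists>v\<in>V. \<forall>y\<in>nodes c p l. v y = (if y = x then 1 else 0)"
proof -
  define sel where "sel = (\<lambda>x. SOME z. z \<in> active_cells c l \<and> x \<in> cell c l z)"
  have sel: "sel y \<in> active_cells c l" "y \<in> cell c l (sel y)" if "y \<in> active_region c l" for y
    using that someI_ex[of "\<lambda>z. z \<in> active_cells c l \<and> y \<in> cell c l z"] by (auto simp: sel_def active_region_def)
  define q where "q = (\<lambda>z (y::real^'d). \<Prod>i\<in>UNIV. poly (axis_basis i (z $ i) (x $ i)) (y $ i))"
  have qQ: "q z \<in> Qp p" for z unfolding q_def by (rule Qp_prod) (rule degree_axis_basis)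
  define v where "v = (\<lambda>y. if y \<in> active_region c l then q (sel y) y else 0)"
  have consistent: "q z y = q z' y" if "y \<in> cell c l z" "y \<in> cell c l z'" for y z z'
    unfolding q_def using that by (intro prod.cong axis_basis_consistent) (auto simp: mem_cell)
  have v: "v y = q z y" if "z \<in> active_cells c l" "y \<in> cell c l z" for z y
  proof -
    have y: "y \<in> active_region c l" using that by (auto simp: active_region_def)
    show ?thesis unfolding v_def using y consistent[OF sel(2)[OF y] that(2)] by simp
  qed
  have cont: "continuous_on (cell c l z) v" if z: "z \<in> active_cells c l" for z
    using Qp_continuous_on[OF qQ, of "cell c l z" z] by (rule continuous_on_eq) (simp add: v[OF z])
  have "continuous_on (active_region c l) v"
    unfolding active_region_def
    by (rule continuous_on_closed_Union[of "active_cells c l" "cell c l" v, OF finite_active_cells closed_cell cont])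
  then have "v \<in> V"
    unfolding fe_space_def mem_Collect_eq
  proof (intro conjI ballI allI impI)
    fix z assume z: "z \<in> active_cells c l"
    show "\<exists>q\<in>Qp p. \<forall>x\<in>cell c l z. v x = q x"
      by (rule bexI[OF _ qQ[of z]]) (simp add: v[OF z])
  qed (simp_all add: v_def)
  moreover have "v y = (if y = x then 1 else 0)" if "y \<in> nodes c p l" for y
  proof -
    obtain z \<xi> where y: "y = cell_node z \<xi>" "z \<in> active_cells c l" "\<And>i. \<xi> $ i \<in> gauss_lobatto p"
      using \<open>y \<in> nodes c p l\<close> unfolding nodes_eq by blast
    have "v y = q z y" using y by (intro v) (auto intro: cell_node_in_cell)
    also have "\<dots> = (\<Prod>i\<in>UNIV. if y $ i = x $ i then 1 else 0)"
      unfolding q_def y(1) cell_node_component by (intro prod.cong refl axis_basis_node y)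
    also have "\<dots> = (if y = x then 1 else 0)" by (auto simp: vec_eq_iff)
    finally show ?thesis .
  qed
  ultimately show ?thesis by blast
qed

lemma nodal_basis:
  shows "nodal_basis c p l x \<in> V"
    and "y \<in> nodes c p l \<Longrightarrow> nodal_basis c p l x y = (if y = x then 1 else 0)"
proof -
  obtain v where v: "v \<in> V" "\<forall>y\<in>nodes c p l. v y = (if y = x then 1 else 0)"
    using nodal_basis_exists by blast
  have "nodal_basis c p l x = v"
    unfolding nodal_basis_def
  proof (rule the_equality)
    show "v \<in> V \<and> (\<forall>y\<in>nodes c p l. v y = (if y = x then 1 else 0))" using v by blast
    fix w assume w: "w \<in> V \<and> (\<forall>y\<in>nodes c p l. w y = (if y = x then 1 else 0))"
    have d: "w - v \<in> V" using w v subspace_V by (simp add: subspace_diff)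
    show "w = v"
    proof (rule fe_eqI)
      fix z y assume z: "z \<in> active_cells c l" "y \<in> cell c l z"
      have "cell_poly c p l (w - v) z = 0"
        by (rule fe_zero_if_zero_at_nodes[OF d z(1)]) (simp add: w v(2))
      then show "w y = v y" using cell_poly(2)[OF d z] by simp
    qed (simp_all add: w v(1))
  qed
  then show "nodal_basis c p l x \<in> V"
    "y \<in> nodes c p l \<Longrightarrow> nodal_basis c p l x y = (if y = x then 1 else 0)" by (simp_all add: v)
qed

text \<open>All nodes of such a cell differ from \<open>x\<close>, so the polynomial vanishes at
  all of them.\<close>

lemma nodal_basis_support:
  assumes "z \<in> active_cells c l" "x \<notin> cell c l z"
  shows "cell_poly c p l (nodal_basis c p l x) z = 0"
proof (rule fe_zero_if_zero_at_nodes[OF nodal_basis(1) assms(1)])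
  fix y assume "y \<in> nodes c p l" "y \<in> cell c l z"
  then show "nodal_basis c p l x y = 0" using assms(2) by (auto simp: nodal_basis(2))
qed

text \<open>Both kinds of local spaces turn an inclusion of point sets into membership of cells:
  an interior point of a cell lies in no other cell.\<close>

lemma cell_in_patch_if_subset:
  assumes z: "z \<in> active_cells c l" and sub: "cell c l z \<subseteq> patch c l j"
  shows "z \<in> patch_cells c l j"
proof -
  obtain y where y: "y \<in> cell_interior z" using cell_interior_nonempty by blast
  then obtain z' where "z' \<in> patch_cells c l j" "y \<in> cell c l z'"
    using sub cell_interior_subset[of z] unfolding patch_def by blast
  then show ?thesis using cell_interior_unique[OF y] by metis
qed

lemma cell_in_patch_if_interior:
  assumes z: "z \<in> active_cells c l" "x \<in> cell c l z" and x: "x \<in> interior (full_patch c l j)"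
  shows "z \<in> patch_cells c l j"
proof -
  have "x \<in> closure (cell_interior z)" using z by (simp add: closure_cell_interior)
  then have "interior (full_patch c l j) \<inter> cell_interior z \<noteq> {}"
    using x open_interior open_Int_closure_eq_empty by blast
  then obtain y where y: "y \<in> cell_interior z" "y \<in> full_patch c l j" using interior_subset by blast
  then obtain z' where "vertex c l j \<in> cell c l z'" "y \<in> cell c l z'" by (auto simp: full_patch_def)
  then show ?thesis using cell_interior_unique[OF y(1)] z by (auto simp: patch_cells_def)
qed

lemma local_space_subspace: "subspace (local_space \<kappa> c p l j)"
  by (simp add: local_space_def)

lemma local_space_subset: "local_space \<kappa> c p l j \<subseteq> V"
  unfolding local_space_def by (rule span_minimal[OF _ subspace_V]) (auto intro: nodal_basis)

text \<open>Stated for the cell polynomials rather than for the functions, as gradients and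
  jumps are formed from them.\<close>

lemma local_space_support:
  assumes u: "u \<in> local_space \<kappa> c p l j" and z: "z \<in> active_cells c l" "z \<notin> patch_cells c l j"
  shows "cell_poly c p l u z = 0"
proof -
  define K where "K = {u \<in> V. cell_poly c p l u z = 0}"
  have "subspace K"
  proof (rule subspaceI)
    have "cell_poly c p l 0 z = 0" by (rule cell_poly_eqI) (auto intro: subspace_0[OF subspace_Qp])
    then show "0 \<in> K" using subspace_0[OF subspace_V] by (simp add: K_def)
    fix u v :: "real ^ 'd \<Rightarrow> real" and r :: real assume u: "u \<in> K"
    show "v \<in> K \<Longrightarrow> u + v \<in> K"
      using u cell_poly_linear[of u v z 1 1] z subspace_add[OF subspace_V] by (auto simp: K_def)
    show "r *\<^sub>R u \<in> K"
      using u cell_poly_linear[of u u z r 0] z subspace_scale[OF subspace_V] by (auto simp: K_def)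
  qed
  moreover have "nodal_basis c p l x \<in> K"
    if "x \<in> nodes c p l" "case \<kappa> of Dirichlet \<Rightarrow> x \<in> interior (full_patch c l j) | Full_Residual \<Rightarrow> node_patch c l x \<subseteq> patch c l j" for x
  proof -
    have "x \<notin> cell c l z"
    proof
      assume x: "x \<in> cell c l z"
      have "z \<in> patch_cells c l j"
      proof (cases \<kappa>)
        case Dirichlet
        then show ?thesis using that(2) cell_in_patch_if_interior[OF z(1) x] by simp
      next
        case Full_Residual
        then have "cell c l z \<subseteq> patch c l j" using that(2) x z(1) by (auto simp: node_patch_def)
        then show ?thesis by (rule cell_in_patch_if_subset[OF z(1)])
      qed
      then show False using z(2) by simp
    qed
    then show ?thesis using nodal_basis_support[OF z(1)] nodal_basis(1) by (simp add: K_def)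
  qed
  ultimately have "local_space \<kappa> c p l j \<subseteq> K"
    unfolding local_space_def by (intro span_minimal) auto
  then show ?thesis using u by (auto simp: K_def)
qed

end

text \<open>An active fine cell lies in its parent cell, which is then active as well, so that a
  coarse function restricts to one polynomial on each fine cell.\<close>

lemma (in cutfem_level) coarse_space:
  assumes l: "1 \<le> l"
  shows "subspace (coarse_space c p l)" "coarse_space c p l \<subseteq> V"
proof -
  interpret coarse: cutfem_level c p "l - 1" using valid C2 dim degree by unfold_locales
  have H: "mesh_size c (l - 1) = 2 * h" using l by (cases l) (auto simp: mesh_size_def)
  define par where "par = (\<lambda>z :: int ^ 'd. \<chi> i. z $ i div 2)"
  have par: "cell c l z \<subseteq> cell c (l - 1) (par z)" for z
  proof
    fix x assume x: "x \<in> cell c l z"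
    have "of_int (par z $ i) \<le> (x $ i - origin c $ i) / (2 * h) \<and> (x $ i - origin c $ i) / (2 * h) \<le> of_int (par z $ i) + 1" for i
    proof -
      have "2 * (z $ i div 2) \<le> z $ i" "z $ i + 1 \<le> 2 * (z $ i div 2) + 2" by linarith+
      then have "2 * real_of_int (z $ i div 2) \<le> of_int (z $ i)" "real_of_int (z $ i) + 1 \<le> 2 * of_int (z $ i div 2) + 2"
        by linarith+
      moreover have "of_int (z $ i) \<le> (x $ i - origin c $ i) / h" "(x $ i - origin c $ i) / h \<le> of_int (z $ i) + 1"
        using x by (auto simp: mem_cell)
      moreover have "(x $ i - origin c $ i) / (2 * h) = (x $ i - origin c $ i) / h / 2" by simp
      ultimately show ?thesis unfolding par_def vec_lambda_beta by (intro conjI; linarith)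
    qed
    then show "x \<in> cell c (l - 1) (par z)" unfolding coarse.mem_cell H by blast
  qed
  have par_active: "par z \<in> active_cells c (l - 1)" if "z \<in> active_cells c l" for z
    using that par[of z] by (auto simp: active_cells_def)
  have sub: "active_region c l \<subseteq> active_region c (l - 1)"
    using par par_active unfolding active_region_def by blast
  show "subspace (coarse_space c p l)"
    unfolding coarse_space_def
  proof (rule subspaceI)
    have "prolongation c l 0 = 0" by (auto simp: prolongation_def)
    then show "0 \<in> prolongation c l ` fe_space c p (l - 1)" using subspace_0[OF coarse.subspace_V] by (metis image_eqI)
    fix x y :: "real ^ 'd \<Rightarrow> real" and r :: real
    assume "x \<in> prolongation c l ` fe_space c p (l - 1)"
    then obtain u where u: "x = prolongation c l u" "u \<in> fe_space c p (l - 1)" by auto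
    have "prolongation c l (r *\<^sub>R u) = r *\<^sub>R x" by (auto simp: prolongation_def scaleR_fun_def u)
    then show "r *\<^sub>R x \<in> prolongation c l ` fe_space c p (l - 1)"
      using subspace_scale[OF coarse.subspace_V u(2)] by (metis image_eqI)
    assume "y \<in> prolongation c l ` fe_space c p (l - 1)"
    then obtain v where v: "y = prolongation c l v" "v \<in> fe_space c p (l - 1)" by auto
    have "prolongation c l (u + v) = x + y" by (auto simp: prolongation_def u v)
    then show "x + y \<in> prolongation c l ` fe_space c p (l - 1)"
      using subspace_add[OF coarse.subspace_V u(2) v(2)] by (metis image_eqI)
  qed
  show "coarse_space c p l \<subseteq> V"
  proof
    fix w assume "w \<in> coarse_space c p l"
    then obtain u where u: "w = prolongation c l u" "u \<in> fe_space c p (l - 1)" by (auto simp: coarse_space_def)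
    have eq: "w x = u x" if "x \<in> active_region c l" for x using that by (simp add: u prolongation_def)
    show "w \<in> V"
      unfolding fe_space_def mem_Collect_eq
    proof (intro conjI ballI allI impI)
      have "continuous_on (active_region c l) u"
        using u(2) sub by (auto simp: fe_space_def intro: continuous_on_subset)
      then show "continuous_on (active_region c l) w" by (rule continuous_on_eq) (simp add: eq)
      fix z assume z: "z \<in> active_cells c l"
      have "w x = cell_poly c p (l - 1) u (par z) x" if "x \<in> cell c l z" for x
      proof -
        have "x \<in> active_region c l" using that z by (auto simp: active_region_def)
        then show ?thesis using eq coarse.cell_poly(2)[OF u(2) par_active[OF z]] par[of z] that by auto
      qed
      then show "\<exists>q\<in>Qp p. \<forall>x\<in>cell c l z. w x = q x"
        using coarse.cell_poly(1)[OF u(2) par_active[OF z]] by blast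
    qed (simp add: u prolongation_def)
  qed
qed

section \<open>The discrete form as an inner product\<close>

text \<open>Bounded and Borel on \<open>S\<close>. All forms are integrals of products of such
  functions over sets of finite measure, and the class is closed under linear combinations and
  products, so that one integrability argument serves them all.\<close>

definition tame :: "'a::topological_space set \<Rightarrow> ('a \<Rightarrow> real) \<Rightarrow> bool" where
  "tame S f \<longleftrightarrow> S \<in> sets borel \<and> (\<lambda>x. indicator S x * f x) \<in> borel_measurable borel \<and> (\<exists>B. \<forall>x\<in>S. \<bar>f x\<bar> \<le> B)"

lemma tame_measurable: "tame S f \<Longrightarrow> (\<lambda>x. indicator S x * f x) \<in> borel_measurable borel"
  by (simp add: tame_def)

lemma tame_linear:
  assumes "tame S f" "tame S g" shows "tame S (\<lambda>x. a * f x + b * g x)"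
proof -
  obtain B C where "\<forall>x\<in>S. \<bar>f x\<bar> \<le> B" "\<forall>x\<in>S. \<bar>g x\<bar> \<le> C" using assms by (auto simp: tame_def)
  then have "\<bar>a * f x + b * g x\<bar> \<le> \<bar>a\<bar> * B + \<bar>b\<bar> * C" if "x \<in> S" for x
    using that by (intro order_trans[OF abs_triangle_ineq] add_mono) (auto simp: abs_mult intro!: mult_left_mono)
  moreover have "(\<lambda>x. indicator S x * (a * f x + b * g x)) \<in> borel_measurable borel"
  proof -
    have *: "(\<lambda>x. indicator S x * (a * f x + b * g x)) = (\<lambda>x. a * (indicator S x * f x) + b * (indicator S x * g x))"
      by (auto simp: algebra_simps)
    show ?thesis unfolding *
      by (rule borel_measurable_add[OF borel_measurable_times[OF borel_measurable_const tame_measurable[OF assms(1)]]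
            borel_measurable_times[OF borel_measurable_const tame_measurable[OF assms(2)]]])
  qed
  ultimately show ?thesis using assms by (auto simp: tame_def)
qed

lemma tame_mult:
  assumes "tame S f" "tame S g" shows "tame S (\<lambda>x. f x * g x)"
proof -
  obtain B C where BC: "\<forall>x\<in>S. \<bar>f x\<bar> \<le> B" "\<forall>x\<in>S. \<bar>g x\<bar> \<le> C" using assms by (auto simp: tame_def)
  then have "\<bar>f x * g x\<bar> \<le> \<bar>B\<bar> * \<bar>C\<bar>" if "x \<in> S" for x
    using that by (auto simp: abs_mult intro!: mult_mono)
  moreover have "(\<lambda>x. indicator S x * (f x * g x)) \<in> borel_measurable borel"
  proof -
    have *: "(\<lambda>x. indicator S x * (f x * g x)) = (\<lambda>x. (indicator S x * f x) * (indicator S x * g x))"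
      by (auto simp: indicator_def)
    show ?thesis unfolding *
      by (rule borel_measurable_times[OF tame_measurable[OF assms(1)] tame_measurable[OF assms(2)]])
  qed
  ultimately show ?thesis using assms by (auto simp: tame_def)
qed

lemma tame_sum: "(\<And>i. i \<in> I \<Longrightarrow> tame S (f i)) \<Longrightarrow> S \<in> sets borel \<Longrightarrow> tame S (\<lambda>x. \<Sum>i\<in>I. f i x)"
proof (induction I rule: infinite_finite_induct)
  case (insert i I)
  then show ?case using tame_linear[of S "f i" "\<lambda>x. \<Sum>i\<in>I. f i x" 1 1] by simp
qed (auto simp: tame_def)

lemma tame_subset: "tame S f \<Longrightarrow> T \<subseteq> S \<Longrightarrow> T \<in> sets borel \<Longrightarrow> tame T f"
proof -
  assume *: "tame S f" "T \<subseteq> S" "T \<in> sets borel"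
  have eq: "(\<lambda>x. indicator T x * f x) = (\<lambda>x. indicator T x * (indicator S x * f x))"
    using *(2) by (auto simp: indicator_def fun_eq_iff)
  have "(\<lambda>x. indicator T x * f x) \<in> borel_measurable borel"
    unfolding eq
    by (rule borel_measurable_times[OF _ tame_measurable[OF *(1)]]) (use *(3) in simp)
  then show ?thesis using * unfolding tame_def by blast
qed

lemma tame_continuous:
  fixes f :: "'a::euclidean_space \<Rightarrow> real"
  assumes "compact S" "continuous_on S f" shows "tame S f"
proof -
  have "bounded (f ` S)" using assms compact_continuous_image compact_imp_bounded by blast
  then have "\<exists>B. \<forall>x\<in>S. \<bar>f x\<bar> \<le> B" by (auto simp: bounded_iff)
  moreover have "(\<lambda>x. indicator S x * f x) \<in> borel_measurable borel"
    using borel_measurable_continuous_on_indicator[OF borel_closed[OF compact_imp_closed[OF assms(1)]] assms(2)] by simp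
  ultimately show ?thesis using borel_closed[OF compact_imp_closed[OF assms(1)]] unfolding tame_def by blast
qed

lemma tame_integrable:
  assumes f: "tame S f" and M: "sets M = sets borel" "emeasure M S < \<infinity>"
  shows "set_integrable M S f"
proof -
  obtain B where B: "\<forall>x\<in>S. \<bar>f x\<bar> \<le> B" using f by (auto simp: tame_def)
  have "integrable M (\<lambda>x. indicator S x *\<^sub>R (indicator S x * f x))"
    using f M B by (intro integrableI_bounded_set_indicator[of _ _ _ B])
      (auto simp: tame_def indicator_def measurable_cong_sets[OF M(1) refl])
  moreover have "(\<lambda>x. indicator S x *\<^sub>R (indicator S x * f x)) = (\<lambda>x. indicator S x *\<^sub>R f x)"
    by (auto simp: indicator_def)
  ultimately show ?thesis by (simp add: set_integrable_def)
qed

lemma tame_integral_linear: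
  assumes "tame S f" "tame S g" "tame S k" and M: "sets M = sets borel" "emeasure M S < \<infinity>"
  shows "(LINT x:S|M. (a * f x + b * g x) * k x) = a * (LINT x:S|M. f x * k x) + b * (LINT x:S|M. g x * k x)"
proof -
  have "set_integrable M S (\<lambda>x. f x * k x)" "set_integrable M S (\<lambda>x. g x * k x)"
    using assms by (auto intro!: tame_integrable tame_mult)
  then have "(LINT x:S|M. a * (f x * k x) + b * (g x * k x)) = a * (LINT x:S|M. f x * k x) + b * (LINT x:S|M. g x * k x)"
    by (subst set_integral_add) auto
  then show ?thesis by (simp add: algebra_simps)
qed

context cutfem_level
begin

abbreviation active where "active \<equiv> active_cells c l"
abbreviation \<Gamma> where "\<Gamma> \<equiv> frontier (region c)"

lemma boundary_measure: "0 < emeasure surface_measure \<Gamma>" "emeasure surface_measure \<Gamma> < \<infinity>"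
  using surface_measure_frontier_pos[OF dim region_open region_bounded region_nonempty]
    surface_measure_frontier_finite[OF dim C2 region_bounded] by auto

lemma active_region_measure: "S \<subseteq> active_region c l \<Longrightarrow> S \<in> sets borel \<Longrightarrow> emeasure lborel S < \<infinity>"
  using emeasure_mono[of S "active_region c l" lborel] emeasure_bounded_finite[OF compact_imp_bounded[OF compact_active_region]]
    closed_active_region by (auto intro: le_less_trans)

definition cell_deriv :: "(real ^ 'd \<Rightarrow> real) \<Rightarrow> nat \<Rightarrow> 'd \<Rightarrow> int ^ 'd \<Rightarrow> real ^ 'd \<Rightarrow> real" where
  "cell_deriv u k i z = dir_deriv k (axis i 1) (cell_poly c p l u z)"

lemma cell_deriv_continuous: "u \<in> V \<Longrightarrow> z \<in> active \<Longrightarrow> continuous_on S (cell_deriv u k i z)"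
proof -
  assume "u \<in> V" "z \<in> active"
  then have "real_polynomial_function (cell_deriv u k i z)"
    unfolding cell_deriv_def by (intro polynomial_function_dir_deriv_iter Qp_polynomial_function[OF cell_poly(1)])
  then have "isCont (cell_deriv u k i z) x" for x by (rule continuous_real_polymonial_function)
  then show ?thesis by (simp add: continuous_at_imp_continuous_on)
qed

lemma cell_deriv_linear:
  assumes "u \<in> V" "v \<in> V" "z \<in> active"
  shows "cell_deriv (a *\<^sub>R u + b *\<^sub>R v) k i z x = a * cell_deriv u k i z x + b * cell_deriv v k i z x"
  unfolding cell_deriv_def cell_poly_linear[OF assms]
    dir_deriv_linear[OF Qp_polynomial_function[OF cell_poly(1)[OF assms(1,3)]]
      Qp_polynomial_function[OF cell_poly(1)[OF assms(2,3)]]]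
  by (simp add: scaleR_fun_def)

lemma cell_deriv_zero: "cell_poly c p l u z = 0 \<Longrightarrow> cell_deriv u k i z x = 0"
proof -
  assume *: "cell_poly c p l u z = 0"
  have "dir_deriv k (axis i 1) (0 *\<^sub>R 0 + 0 *\<^sub>R 0 :: real ^ 'd \<Rightarrow> real) =
      0 *\<^sub>R dir_deriv k (axis i 1) 0 + 0 *\<^sub>R dir_deriv k (axis i 1) 0"
    using Qp_polynomial_function[OF subspace_0[OF subspace_Qp[of 0]]] by (intro dir_deriv_linear)
  then show ?thesis unfolding cell_deriv_def * by simp
qed

text \<open>Written with indicators, the averaged gradient is visibly a Borel function.\<close>

lemma fe_grad_component:
  "fe_grad c p l u x $ i = (\<Sum>z\<in>active. indicator (cell c l z) x * cell_deriv u 1 i z x) /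
     (\<Sum>z\<in>active. indicator (cell c l z) x)"
proof -
  have 1: "(\<Sum>z\<in>{z \<in> active. x \<in> cell c l z}. f z) = (\<Sum>z\<in>active. indicator (cell c l z) x * f z)" for f :: "int ^ 'd \<Rightarrow> real"
    by (rule sum.mono_neutral_cong_left) (auto simp: finite_active_cells)
  have "real (card {z \<in> active. x \<in> cell c l z}) = (\<Sum>z\<in>active. indicator (cell c l z) x)"
    using 1[of "\<lambda>_. 1"] by simp
  moreover have "(\<Sum>z\<in>{z \<in> active. x \<in> cell c l z}. \<chi> i. cell_deriv u 1 i z x) $ i
      = (\<Sum>z\<in>active. indicator (cell c l z) x * cell_deriv u 1 i z x)"
    by (simp add: 1)
  ultimately show ?thesis
    unfolding fe_grad_def Let_def cell_deriv_def[symmetric] by (simp add: divide_inverse mult.commute)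
qed

lemma fe_grad_linear:
  assumes "u \<in> V" "v \<in> V"
  shows "fe_grad c p l (a *\<^sub>R u + b *\<^sub>R v) x = a *\<^sub>R fe_grad c p l u x + b *\<^sub>R fe_grad c p l v x"
proof -
  have "(\<Sum>z\<in>active. indicator (cell c l z) x * cell_deriv (a *\<^sub>R u + b *\<^sub>R v) 1 i z x) =
      a * (\<Sum>z\<in>active. indicator (cell c l z) x * cell_deriv u 1 i z x)
      + b * (\<Sum>z\<in>active. indicator (cell c l z) x * cell_deriv v 1 i z x)" for i
    unfolding sum_distrib_left sum.distrib[symmetric] using assms
    by (intro sum.cong) (auto simp: cell_deriv_linear algebra_simps)
  then show ?thesis
    by (simp add: vec_eq_iff fe_grad_component add_divide_distrib)
qed

lemma fe_grad_zero_off_support: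
  assumes "\<And>z. z \<in> active \<Longrightarrow> x \<in> cell c l z \<Longrightarrow> cell_poly c p l u z = 0"
  shows "fe_grad c p l u x = 0"
proof -
  have "(\<Sum>z\<in>active. indicator (cell c l z) x * cell_deriv u 1 i z x) = 0" for i
    using assms cell_deriv_zero by (intro sum.neutral) (auto simp: indicator_def)
  then show ?thesis by (simp add: vec_eq_iff fe_grad_component)
qed

lemma fe_grad_cell_interior:
  assumes z: "z \<in> active" "x \<in> cell_interior z"
  shows "fe_grad c p l u x $ i = cell_deriv u 1 i z x"
proof -
  have ind: "indicator (cell c l z') x = (if z' = z then 1 else 0 :: real)" if "z' \<in> active" for z'
    using cell_interior_unique[OF z(2)] cell_interior_subset z(2) by (auto simp: indicator_def)
  have "(\<Sum>z'\<in>active. indicator (cell c l z') x * f z') = f z" for f :: "int ^ 'd \<Rightarrow> real"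
    using finite_active_cells z(1) by (simp add: ind sum.delta if_distrib[of "\<lambda>t. t * _"] cong: if_cong)
  from this[of "\<lambda>z. cell_deriv u 1 i z x"] this[of "\<lambda>_. 1"] show ?thesis
    by (simp add: fe_grad_component)
qed

lemma tame_fe: "u \<in> V \<Longrightarrow> tame (active_region c l) u"
  by (intro tame_continuous compact_active_region) (simp add: fe_space_def)

lemma tame_fe_grad:
  assumes u: "u \<in> V"
  shows "tame (active_region c l) (\<lambda>x. fe_grad c p l u x $ i)"
proof -
  have t: "tame (cell c l z) (cell_deriv u 1 i z)" if "z \<in> active" for z
    using cell_deriv_continuous[OF u that] compact_cell by (rule tame_continuous[rotated])
  then have "\<forall>z\<in>active. \<exists>B. \<forall>x\<in>cell c l z. \<bar>cell_deriv u 1 i z x\<bar> \<le> B" unfolding tame_def by blast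
  then obtain B where B: "\<And>z x. z \<in> active \<Longrightarrow> x \<in> cell c l z \<Longrightarrow> \<bar>cell_deriv u 1 i z x\<bar> \<le> B z" by metis
  define n where "n = (\<lambda>x. \<Sum>z\<in>active. indicator (cell c l z) x :: real)"
  define s where "s = (\<lambda>x. \<Sum>z\<in>active. indicator (cell c l z) x * cell_deriv u 1 i z x)"
  have [measurable]: "cell c l z \<in> sets borel" for z using closed_cell by auto
  have n: "n \<in> borel_measurable borel" unfolding n_def by measurable
  have s: "s \<in> borel_measurable borel" unfolding s_def using t by (intro borel_measurable_sum) (simp add: tame_def)
  have eq: "(\<lambda>x. fe_grad c p l u x $ i) = (\<lambda>x. s x / n x)" by (simp add: fe_grad_component s_def n_def)
  have "\<bar>s x / n x\<bar> \<le> (\<Sum>z\<in>active. \<bar>B z\<bar>)" if x: "x \<in> active_region c l" for x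
  proof -
    obtain z where z: "z \<in> active" "x \<in> cell c l z" using x by (auto simp: active_region_def)
    have "1 = (indicator (cell c l z) x :: real)" using z by simp
    also have "\<dots> \<le> n x" unfolding n_def using z finite_active_cells by (intro member_le_sum) auto
    finally have n1: "1 \<le> n x" .
    have "\<bar>s x\<bar> \<le> (\<Sum>z\<in>active. \<bar>indicator (cell c l z) x * cell_deriv u 1 i z x\<bar>)" unfolding s_def by (rule sum_abs)
    also have "\<dots> \<le> (\<Sum>z\<in>active. \<bar>B z\<bar>)"
      using B by (intro sum_mono) (auto simp: indicator_def intro: order_trans[OF _ abs_ge_self])
    finally have "\<bar>s x\<bar> \<le> (\<Sum>z\<in>active. \<bar>B z\<bar>)" .
    moreover have "\<bar>s x / n x\<bar> \<le> \<bar>s x\<bar>" using n1 by (simp add: divide_le_eq abs_mult mult_le_cancel_left1)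
    ultimately show ?thesis by linarith
  qed
  moreover have "(\<lambda>x. indicator (active_region c l) x * (s x / n x)) \<in> borel_measurable borel"
    using n s closed_active_region by (intro borel_measurable_times borel_measurable_divide borel_measurable_indicator) auto
  moreover have "active_region c l \<in> sets borel" using closed_active_region by auto
  ultimately show ?thesis unfolding eq tame_def by blast
qed

lemma tame_normal_deriv:
  assumes u: "u \<in> V" shows "tame \<Gamma> (fe_normal_deriv c p l u)"
proof -
  have "tame \<Gamma> (\<lambda>x. outward_normal (region c) x $ i * fe_grad c p l u x $ i)" for i
  proof (intro tame_mult)
    show "tame \<Gamma> (\<lambda>x. outward_normal (region c) x $ i)"
      using continuous_on_outward_normal[OF C2] frontier_compact
      by (intro tame_continuous continuous_on_component)
    show "tame \<Gamma> (\<lambda>x. fe_grad c p l u x $ i)"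
      by (rule tame_subset[OF tame_fe_grad[OF u] frontier_subset_active]) simp
  qed
  then have "tame \<Gamma> (\<lambda>x. \<Sum>i\<in>UNIV. outward_normal (region c) x $ i * fe_grad c p l u x $ i)"
    by (intro tame_sum) auto
  then show ?thesis by (simp add: fe_normal_deriv_def[abs_def] inner_vec_def)
qed

lemma tame_fe_boundary: "u \<in> V \<Longrightarrow> tame \<Gamma> u"
  by (rule tame_subset[OF tame_fe frontier_subset_active]) auto

lemma normal_deriv_linear:
  "u \<in> V \<Longrightarrow> v \<in> V \<Longrightarrow> fe_normal_deriv c p l (a *\<^sub>R u + b *\<^sub>R v) x
     = a * fe_normal_deriv c p l u x + b * fe_normal_deriv c p l v x"
  by (simp add: fe_normal_deriv_def fe_grad_linear inner_add_right)

lemma L2_Gamma_linear: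
  assumes "tame \<Gamma> f" "tame \<Gamma> g" "tame \<Gamma> k"
  shows "L2_Gamma c (\<lambda>x. a * f x + b * g x) k = a * L2_Gamma c f k + b * L2_Gamma c g k"
  unfolding L2_Gamma_def using assms
  by (rule tame_integral_linear) (use boundary_measure(2) in \<open>auto simp: sets_surface_measure\<close>)

lemma L2_Gamma_sym: "L2_Gamma c f g = L2_Gamma c g f"
  by (simp add: L2_Gamma_def mult.commute)

lemma grad_form_components:
  assumes "u \<in> V" "v \<in> V" "S \<subseteq> active_region c l" "S \<in> sets borel"
  shows "grad_form c p l S u v = (\<Sum>i\<in>UNIV. LINT x:S|lborel. fe_grad c p l u x $ i * fe_grad c p l v x $ i)"
proof -
  have "set_integrable lborel S (\<lambda>x. fe_grad c p l u x $ i * fe_grad c p l v x $ i)" for i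
    using assms active_region_measure[OF assms(3,4)]
    by (intro tame_integrable tame_mult tame_subset[OF tame_fe_grad]) auto
  then show ?thesis
    unfolding grad_form_def inner_vec_def inner_real_def set_lebesgue_integral_def set_integrable_def scaleR_sum_right
    by (intro Bochner_Integration.integral_sum)
qed

lemma grad_form_linear:
  assumes "u \<in> V" "v \<in> V" "w \<in> V" "S \<subseteq> active_region c l" "S \<in> sets borel"
  shows "grad_form c p l S (a *\<^sub>R u + b *\<^sub>R v) w = a * grad_form c p l S u w + b * grad_form c p l S v w"
proof -
  have V: "a *\<^sub>R u + b *\<^sub>R v \<in> V" using assms subspace_V by (intro subspace_add subspace_scale)
  have "(LINT x:S|lborel. (a * fe_grad c p l u x $ i + b * fe_grad c p l v x $ i) * fe_grad c p l w x $ i) =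
      a * (LINT x:S|lborel. fe_grad c p l u x $ i * fe_grad c p l w x $ i)
      + b * (LINT x:S|lborel. fe_grad c p l v x $ i * fe_grad c p l w x $ i)" for i
    using assms active_region_measure[OF assms(4,5)]
    by (intro tame_integral_linear tame_subset[OF tame_fe_grad]) auto
  then show ?thesis
    by (simp add: grad_form_components[OF V assms(3-5)] grad_form_components[OF assms(1,3-5)]
        grad_form_components[OF assms(2,3-5)] fe_grad_linear[OF assms(1,2)] sum.distrib sum_distrib_left)
qed

lemma grad_form_sym: "grad_form c p l S u v = grad_form c p l S v u"
  by (simp add: grad_form_def inner_commute)

lemma face_compact: "compact (face c l F)"
  by (cases F) (simp add: face_def compact_Int compact_cell)

text \<open>A face lies in a hyperplane orthogonal to \<open>axis i 1\<close>, which is the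
  Lipschitz case with constant \<open>0\<close>.\<close>

lemma face_measure: "emeasure surface_measure (face c l F) < \<infinity>"
proof (cases F)
  case (Pair z i)
  have "y $ i = origin c $ i + h * (of_int (z $ i) + 1)" if "y \<in> face c l F" for y
  proof -
    have "(y $ i - origin c $ i) / h \<le> of_int (z $ i) + 1" "of_int ((z + axis i 1) $ i) \<le> (y $ i - origin c $ i) / h"
      using that unfolding Pair face_def prod.case Int_iff mem_cell by blast+
    then have "(y $ i - origin c $ i) / h = of_int (z $ i) + 1" by (simp add: axis_def)
    then show ?thesis using h_pos by (simp add: field_simps)
  qed
  then show ?thesis
    using face_compact[of F]
    by (intro surface_measure_Lipschitz_finite[OF dim _ order_refl, where i = i])
       (auto simp: compact_imp_bounded compact_imp_closed)
qed

lemma normal_jump_eq: "normal_jump c p l k (z, i) u x = cell_deriv u k i (z + axis i 1) x - cell_deriv u k i z x"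
  by (simp add: normal_jump_def cell_deriv_def)

lemma normal_jump_linear:
  assumes "u \<in> V" "v \<in> V" "F \<in> ghost_faces c l"
  shows "normal_jump c p l k F (a *\<^sub>R u + b *\<^sub>R v) x = a * normal_jump c p l k F u x + b * normal_jump c p l k F v x"
  using assms by (cases F) (auto simp: ghost_faces_def normal_jump_eq cell_deriv_linear algebra_simps)

lemma tame_normal_jump:
  assumes "u \<in> V" "F \<in> ghost_faces c l"
  shows "tame (face c l F) (normal_jump c p l k F u)"
proof (rule tame_continuous[OF face_compact])
  obtain z i where F: "F = (z, i)" by force
  have "normal_jump c p l k F u = (\<lambda>x. cell_deriv u k i (z + axis i 1) x - cell_deriv u k i z x)"
    by (simp add: F normal_jump_eq fun_eq_iff)
  then show "continuous_on (face c l F) (normal_jump c p l k F u)"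
    using assms by (auto simp: F ghost_faces_def intro!: continuous_on_diff cell_deriv_continuous)
qed

lemma ghost_form_linear:
  assumes "u \<in> V" "v \<in> V" "w \<in> V"
  shows "ghost_form c p \<gamma> l (a *\<^sub>R u + b *\<^sub>R v) w = a * ghost_form c p \<gamma> l u w + b * ghost_form c p \<gamma> l v w"
proof -
  have "(LINT x:face c l F|surface_measure. normal_jump c p l k F (a *\<^sub>R u + b *\<^sub>R v) x * normal_jump c p l k F w x) =
      a * (LINT x:face c l F|surface_measure. normal_jump c p l k F u x * normal_jump c p l k F w x)
      + b * (LINT x:face c l F|surface_measure. normal_jump c p l k F v x * normal_jump c p l k F w x)"
    if "F \<in> ghost_faces c l" for F k
    unfolding normal_jump_linear[OF assms(1,2) that] using assms that face_measure[of F]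
    by (intro tame_integral_linear tame_normal_jump) (auto simp: sets_surface_measure)
  then show ?thesis
    unfolding ghost_form_def by (simp add: sum_distrib_left sum.distrib algebra_simps)
qed

lemma ghost_form_sym: "ghost_form c p \<gamma> l u v = ghost_form c p \<gamma> l v u"
  by (simp add: ghost_form_def mult.commute)

lemma nitsche_form_sym: "nitsche_form c p \<gamma>D l u v = nitsche_form c p \<gamma>D l v u"
  unfolding nitsche_form_def grad_form_sym[of _ u v] L2_Gamma_sym[of "fe_normal_deriv c p l u" v]
    L2_Gamma_sym[of u v] L2_Gamma_sym[of u "fe_normal_deriv c p l v"] by simp

lemma nitsche_form_linear:
  assumes "u \<in> V" "v \<in> V" "w \<in> V"
  shows "nitsche_form c p \<gamma>D l (a *\<^sub>R u + b *\<^sub>R v) w = a * nitsche_form c p \<gamma>D l u w + b * nitsche_form c p \<gamma>D l v w"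
proof -
  have 1: "fe_normal_deriv c p l (a *\<^sub>R u + b *\<^sub>R v) = (\<lambda>x. a * fe_normal_deriv c p l u x + b * fe_normal_deriv c p l v x)"
    using assms by (auto simp: normal_deriv_linear)
  have 2: "a *\<^sub>R u + b *\<^sub>R v = (\<lambda>x. a * u x + b * v x)" by (auto simp: scaleR_fun_def)
  have 3: "grad_form c p l (region c) (a *\<^sub>R u + b *\<^sub>R v) w = a * grad_form c p l (region c) u w + b * grad_form c p l (region c) v w"
    using assms region_open by (intro grad_form_linear region_subset_active) auto
  have 4: "L2_Gamma c (fe_normal_deriv c p l (a *\<^sub>R u + b *\<^sub>R v)) w
      = a * L2_Gamma c (fe_normal_deriv c p l u) w + b * L2_Gamma c (fe_normal_deriv c p l v) w"
    unfolding 1 using assms by (intro L2_Gamma_linear tame_normal_deriv tame_fe_boundary)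
  have 5: "L2_Gamma c (a *\<^sub>R u + b *\<^sub>R v) k = a * L2_Gamma c u k + b * L2_Gamma c v k" if "tame \<Gamma> k" for k
    unfolding 2 using assms that by (intro L2_Gamma_linear tame_fe_boundary[OF assms(1)] tame_fe_boundary[OF assms(2)])
  show ?thesis
    unfolding nitsche_form_def 3 4 5[OF tame_fe_boundary[OF assms(3)]] 5[OF tame_normal_deriv[OF assms(3)]]
    by (simp add: algebra_simps)
qed

lemma A_form_linear:
  assumes "u \<in> V" "v \<in> V" "w \<in> V"
  shows "A_form c p \<gamma> \<gamma>D l (a *\<^sub>R u + b *\<^sub>R v) w = a * A_form c p \<gamma> \<gamma>D l u w + b * A_form c p \<gamma> \<gamma>D l v w"
  unfolding A_form_def nitsche_form_linear[OF assms] ghost_form_linear[OF assms] by (simp add: algebra_simps)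

lemma A_form_sym: "A_form c p \<gamma> \<gamma>D l u v = A_form c p \<gamma> \<gamma>D l v u"
  unfolding A_form_def nitsche_form_sym[of _ u v] ghost_form_sym[of _ u v] ..

lemma grad_form_nonneg: "0 \<le> grad_form c p l S u u"
  unfolding grad_form_def set_lebesgue_integral_def by (intro Bochner_Integration.integral_nonneg) (auto simp: indicator_def)

lemma L2_Gamma_nonneg: "0 \<le> L2_Gamma c f f"
  unfolding L2_Gamma_def set_lebesgue_integral_def by (intro Bochner_Integration.integral_nonneg) (auto simp: indicator_def)

lemma ghost_form_nonneg: "0 \<le> \<gamma> \<Longrightarrow> 0 \<le> ghost_form c p \<gamma> l u u"
  unfolding ghost_form_def set_lebesgue_integral_def using h_pos
  by (intro mult_nonneg_nonneg sum_nonneg Bochner_Integration.integral_nonneg divide_nonneg_nonneg) (auto simp: indicator_def)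

lemma grad_form_zero:
  assumes u: "u \<in> V" and S: "S \<subseteq> active_region c l" "S \<in> sets borel" and zero: "grad_form c p l S u u \<le> 0"
  shows "AE x in lborel. x \<in> S \<longrightarrow> fe_grad c p l u x = 0"
proof -
  have "tame S (\<lambda>x. \<Sum>i\<in>UNIV. fe_grad c p l u x $ i * fe_grad c p l u x $ i)"
    using S by (intro tame_sum tame_mult tame_subset[OF tame_fe_grad[OF u]]) auto
  then have "set_integrable lborel S (\<lambda>x. fe_grad c p l u x \<bullet> fe_grad c p l u x)"
    using active_region_measure[OF S] unfolding inner_vec_def inner_real_def by (intro tame_integrable) auto
  moreover have "(LINT x|lborel. indicator S x *\<^sub>R (fe_grad c p l u x \<bullet> fe_grad c p l u x)) = 0"
    using zero grad_form_nonneg[of S u] unfolding grad_form_def set_lebesgue_integral_def by linarith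
  ultimately have "AE x in lborel. indicator S x *\<^sub>R (fe_grad c p l u x \<bullet> fe_grad c p l u x) = 0"
    unfolding set_integrable_def by (subst (asm) integral_nonneg_eq_0_iff_AE) (auto simp: indicator_def)
  then show ?thesis by eventually_elim (auto simp: indicator_def)
qed

text \<open>A continuous piecewise constant function takes finitely many values, so it is
  constant on the connected set \<open>\<Omega>\<close>, and every active cell meets
  \<open>\<Omega>\<close>.\<close>

lemma constant_if_energy_zero:
  assumes u: "u \<in> V" and zero: "grad_form c p l (region c) u u \<le> 0" "grad_form c p l (active_region c l - region c) u u \<le> 0"
  obtains k where "\<And>x. x \<in> active_region c l \<Longrightarrow> u x = k"
proof -
  have "AE x in lborel. x \<in> region c \<longrightarrow> fe_grad c p l u x = 0"
    using region_subset_active region_open zero by (intro grad_form_zero[OF u]) auto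
  moreover have "AE x in lborel. x \<in> active_region c l - region c \<longrightarrow> fe_grad c p l u x = 0"
    using closed_active_region region_open zero by (intro grad_form_zero[OF u]) auto
  ultimately have AE0: "AE x in lborel. x \<in> active_region c l \<longrightarrow> fe_grad c p l u x = 0"
    by eventually_elim auto
  have zero_deriv: "cell_deriv u 1 i z x = 0" if z: "z \<in> active" and x: "x \<in> cell_interior z" for z i x
  proof (rule ccontr)
    assume nz: "cell_deriv u 1 i z x \<noteq> 0"
    \<comment> \<open>A nonzero derivative would persist on a nonempty open set, which is not
      negligible.\<close>
    define T where "T = {y \<in> cell_interior z. cell_deriv u 1 i z y \<noteq> 0}"
    have "T = cell_interior z \<inter> cell_deriv u 1 i z -` (- {0})" by (auto simp: T_def)
    then have T: "open T" "T \<noteq> {}"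
      using nz x continuous_open_preimage[OF cell_deriv_continuous[OF u z, of "cell_interior z"], of "- {0}" 1 i]
      by (auto simp: cell_interior_def T_def)
    have "AE y in lborel. y \<notin> T"
      using AE0
    proof eventually_elim
      case (elim y)
      show ?case
      proof
        assume y: "y \<in> T"
        then have "y \<in> active_region c l" using z cell_interior_subset[of z] by (auto simp: T_def active_region_def)
        then have "fe_grad c p l u y $ i = 0" using elim by simp
        then show False using fe_grad_cell_interior[OF z, of y u i] y by (simp add: T_def)
      qed
    qed
    then have "T \<in> null_sets lborel" using T(1) by (subst AE_iff_null_sets) auto
    then have "negligible T" by (simp add: negligible_iff_null_sets null_sets_completionI)
    then show False using open_not_negligible[OF T] by blast
  qed
  have "\<exists>k. \<forall>x\<in>cell c l z. u x = k" if z: "z \<in> active" for z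
  proof -
    obtain k where k: "\<And>x. x \<in> cell c l z \<Longrightarrow> cell_poly c p l u z x = k"
    proof (rule constant_on_box_if_gradient_zero[of "cell_poly c p l u z" "vertex c l z" "vertex c l (\<chi> i. z $ i + 1)"])
      show "real_polynomial_function (cell_poly c p l u z)" by (rule Qp_polynomial_function[OF cell_poly(1)[OF u z]])
      show "box (vertex c l z) (vertex c l (\<chi> i. z $ i + 1)) \<noteq> {}"
        using cell_interior_nonempty[of z] by (simp add: cell_interior_def)
      show "dir_deriv 1 (axis i 1) (cell_poly c p l u z) x = 0" if "x \<in> box (vertex c l z) (vertex c l (\<chi> i. z $ i + 1))" for x i
        using zero_deriv[OF z, of x i] that by (simp add: cell_deriv_def cell_interior_def)
    qed (auto simp: cell_def)
    then show ?thesis using cell_poly(2)[OF u z] by auto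
  qed
  then obtain k where k: "\<And>z x. z \<in> active \<Longrightarrow> x \<in> cell c l z \<Longrightarrow> u x = k z" by metis
  have "u ` region c \<subseteq> k ` active"
    using k region_subset_active unfolding active_region_def by fast
  then have fin: "finite (u ` region c)" using finite_active_cells by (meson finite_imageI finite_subset)
  have "continuous_on (region c) u"
    using u region_subset_active by (auto simp: fe_space_def intro: continuous_on_subset)
  then have "u constant_on region c"
    using continuous_finite_range_constant[OF region_connected _ fin] by blast
  then obtain K where K: "\<And>x. x \<in> region c \<Longrightarrow> u x = K" by (auto simp: constant_on_def)
  have "u x = K" if "x \<in> active_region c l" for x
  proof -
    obtain z where z: "z \<in> active" "x \<in> cell c l z" using \<open>x \<in> active_region c l\<close> by (auto simp: active_region_def)
    then obtain y where "y \<in> cell c l z" "y \<in> region c" by (auto simp: active_cells_def)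
    then show ?thesis using k[OF z(1)] K z(2) by metis
  qed
  then show thesis by (rule that)
qed

end

text \<open>Coercivity controls the energy inside \<open>\<Omega>\<close> and the ghost penalty,
  and \<open>extension\<close> carries this control to the parts of cut cells outside
  \<open>\<Omega>\<close>.\<close>

locale stable_level = cutfem_level +
  fixes \<gamma> \<gamma>D cA CE :: real
  assumes \<gamma>: "0 < \<gamma>" and cA: "0 < cA" and CE: "0 < CE"
    and coercive: "\<And>v. v \<in> fe_space c p l \<Longrightarrow> cA * (N_norm c p \<gamma> l v)\<^sup>2 \<le> A_form c p \<gamma> \<gamma>D l v v"
    and extension: "\<And>v. v \<in> fe_space c p l \<Longrightarrow> grad_form c p l (active_region c l - region c) v v
          \<le> CE * (grad_form c p l (region c) v v + ghost_form c p \<gamma> l v v)"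
begin

abbreviation A where "A \<equiv> A_form c p \<gamma> \<gamma>D l"

text \<open>All four terms of \<open>N_norm\<close> are nonnegative, so each may be
  dropped.\<close>

lemma A_lower:
  assumes "v \<in> V"
  shows "cA * (grad_form c p l (region c) v v + L2_Gamma c v v / h + ghost_form c p \<gamma> l v v) \<le> A v v"
    and "cA * ghost_form c p \<gamma> l v v \<le> A v v"
proof -
  define X where "X = grad_form c p l (region c) v v
           + h * L2_Gamma c (fe_normal_deriv c p l v) (fe_normal_deriv c p l v)
           + L2_Gamma c v v / h + ghost_form c p \<gamma> l v v"
  have parts: "0 \<le> grad_form c p l (region c) v v" "0 \<le> h * L2_Gamma c (fe_normal_deriv c p l v) (fe_normal_deriv c p l v)"
    "0 \<le> L2_Gamma c v v / h" "0 \<le> ghost_form c p \<gamma> l v v"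
    using h_pos \<gamma> grad_form_nonneg L2_Gamma_nonneg ghost_form_nonneg by (auto intro: less_imp_le)
  have "(N_norm c p \<gamma> l v)\<^sup>2 = X" using parts by (simp add: N_norm_def X_def)
  then have *: "cA * X \<le> A v v" using coercive[OF assms] by simp
  have "cA * (grad_form c p l (region c) v v + L2_Gamma c v v / h + ghost_form c p \<gamma> l v v) \<le> cA * X"
    "cA * ghost_form c p \<gamma> l v v \<le> cA * X"
    using parts cA by (auto simp: X_def intro!: mult_left_mono)
  then show "cA * (grad_form c p l (region c) v v + L2_Gamma c v v / h + ghost_form c p \<gamma> l v v) \<le> A v v"
    "cA * ghost_form c p \<gamma> l v v \<le> A v v" using * by linarith+
qed

text \<open>Zero energy makes \<open>v\<close> a constant \<open>k\<close> with \<open>k\<^sup>2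
  |\<Gamma>| = 0\<close>; the positive measure of \<open>\<Gamma>\<close> is what excludes nonzero
  constants.\<close>

lemma A_positive:
  assumes v: "v \<in> V" "v \<noteq> 0" shows "0 < A v v"
proof (rule ccontr)
  assume "\<not> 0 < A v v"
  then have "cA * (grad_form c p l (region c) v v + L2_Gamma c v v / h + ghost_form c p \<gamma> l v v) \<le> 0"
    using A_lower(1)[OF v(1)] by linarith
  then have sum0: "grad_form c p l (region c) v v + L2_Gamma c v v / h + ghost_form c p \<gamma> l v v \<le> 0"
    using cA by (simp add: mult_le_0_iff)
  have parts: "0 \<le> grad_form c p l (region c) v v" "0 \<le> L2_Gamma c v v / h" "0 \<le> ghost_form c p \<gamma> l v v"
    using h_pos \<gamma> grad_form_nonneg L2_Gamma_nonneg ghost_form_nonneg by (auto intro: less_imp_le)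
  have zero: "grad_form c p l (region c) v v = 0" "L2_Gamma c v v / h = 0" "ghost_form c p \<gamma> l v v = 0"
    using sum0 parts by linarith+
  have "grad_form c p l (active_region c l - region c) v v \<le> 0" using extension[OF v(1)] zero by simp
  then obtain k where k: "\<And>x. x \<in> active_region c l \<Longrightarrow> v x = k"
    using constant_if_energy_zero[OF v(1)] zero(1) by (metis order_refl)
  have "L2_Gamma c v v = (LINT x:\<Gamma>|surface_measure. k * k)"
    unfolding L2_Gamma_def using k frontier_subset_active by (intro set_lebesgue_integral_cong) (auto simp: sets_surface_measure)
  also have "\<dots> = measure surface_measure \<Gamma> * (k * k)"
    using boundary_measure(2) by (subst set_integral_const) (auto simp: sets_surface_measure)
  finally have "measure surface_measure \<Gamma> * (k * k) = 0" using zero(2) h_pos by simp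
  moreover have "0 < measure surface_measure \<Gamma>"
    using boundary_measure by (simp add: measure_def enn2real_positive_iff)
  ultimately have "k = 0" by simp
  have "v x = 0" for x
    using k \<open>k = 0\<close> v(1) by (cases "x \<in> active_region c l") (auto simp: fe_space_def)
  then show False using v(2) by auto
qed

lemma inner_product: "inner_product_on V A"
proof
  show "subspace V" by (rule subspace_V)
  fix u v w :: "real ^ 'a \<Rightarrow> real" and r :: real
  show "u \<in> V \<Longrightarrow> v \<in> V \<Longrightarrow> w \<in> V \<Longrightarrow> A (u + v) w = A u w + A v w"
    using A_form_linear[of u v w _ _ 1 1] by simp
  show "u \<in> V \<Longrightarrow> w \<in> V \<Longrightarrow> A (r *\<^sub>R u) w = r * A u w"
    using A_form_linear[of u u w _ _ r 0] by simp
  show "A u w = A w u" by (rule A_form_sym)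
  show "v \<in> V \<Longrightarrow> v \<noteq> 0 \<Longrightarrow> 0 < A v v" by (rule A_positive)
qed

end

section \<open>Patches of one colour and the sweep\<close>

text \<open>The set of admissible constants is closed and bounded below, so its least element
  exists and \<open>LEAST\<close> denotes it.\<close>

lemma Least_bound_le:
  fixes M :: real and X Y :: "'a \<Rightarrow> 'b \<Rightarrow> real"
  assumes "1 \<le> M" "\<And>a b. Q a b \<Longrightarrow> X a b \<le> M * Y a b"
  shows "(LEAST \<omega>. 1 \<le> \<omega> \<and> (\<forall>a b. Q a b \<longrightarrow> X a b \<le> \<omega> * Y a b)) \<le> M"
proof -
  define S where "S = {\<omega>. 1 \<le> \<omega> \<and> (\<forall>a b. Q a b \<longrightarrow> X a b \<le> \<omega> * Y a b)}"
  have MS: "M \<in> S" using assms by (simp add: S_def)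
  have bdd: "bdd_below S" unfolding S_def by (rule bdd_belowI[of _ 1]) simp
  have "S = {1..} \<inter> (\<Inter>(a, b)\<in>{(a, b). Q a b}. {\<omega>. X a b \<le> \<omega> * Y a b})"
    by (auto simp: S_def)
  also have "closed \<dots>"
    by (intro closed_Int closed_atLeast closed_INT) (auto intro!: closed_Collect_le continuous_intros)
  finally have "Inf S \<in> S" using MS bdd by (intro closed_contains_Inf) auto
  then have "(LEAST \<omega>. \<omega> \<in> S) = Inf S"
    by (rule Least_equality) (rule cInf_lower[OF _ bdd])
  also have "\<dots> \<le> M" using MS bdd by (rule cInf_lower)
  finally show ?thesis by (simp add: S_def)
qed

lemma sum_square_le_few_nonzero:
  fixes f :: "'i \<Rightarrow> real"
  assumes "finite J" "K \<subseteq> J" "card K \<le> n" "\<And>j. j \<in> J - K \<Longrightarrow> f j = 0"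
  shows "(\<Sum>j\<in>J. f j)\<^sup>2 \<le> real n * (\<Sum>j\<in>J. (f j)\<^sup>2)"
proof -
  have "(\<Sum>j\<in>J. f j) = (\<Sum>j\<in>K. 1 * f j)"
    using assms by (intro sum.mono_neutral_cong_right) auto
  then have "(\<Sum>j\<in>J. f j)\<^sup>2 \<le> (\<Sum>j\<in>K. 1\<^sup>2) * (\<Sum>j\<in>K. (f j)\<^sup>2)"
    using Cauchy_Schwarz_ineq_sum[of "\<lambda>_. 1" f K] by simp
  also have "\<dots> = real (card K) * (\<Sum>j\<in>K. (f j)\<^sup>2)" by simp
  also have "\<dots> \<le> real n * (\<Sum>j\<in>J. (f j)\<^sup>2)"
    using assms by (intro mult_mono sum_mono2 sum_nonneg) auto
  finally show ?thesis .
qed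

context cutfem_level
begin

text \<open>Along each axis a cell has only two vertex indices, and they differ in
  parity.\<close>

lemma same_color_patches_disjoint:
  assumes "vertex_color j = vertex_color j'" "z \<in> patch_cells c l j" "z \<in> patch_cells c l j'"
  shows "j = j'"
proof -
  have "j $ i = j' $ i" for i
  proof -
    have "odd (j $ i) = odd (j' $ i)" using assms(1) by (simp add: vertex_color_def vec_eq_iff)
    moreover have "z $ i \<le> j $ i" "j $ i \<le> z $ i + 1" "z $ i \<le> j' $ i" "j' $ i \<le> z $ i + 1"
      using assms(2,3) by (auto simp: patch_cells_def vertex_in_cell)
    ultimately show ?thesis by presburger
  qed
  then show ?thesis by (simp add: vec_eq_iff)
qed

lemma AE_cell_interior:
  "AE x in lborel. x \<in> active_region c l \<longrightarrow> (\<exists>z\<in>active. x \<in> cell_interior z)"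
proof -
  have "AE x in lborel. x \<notin> cell c l z - cell_interior z" for z
  proof -
    have "negligible (cell c l z - cell_interior z)"
      unfolding cell_def cell_interior_def by (rule negligible_frontier_interval)
    then have "cell c l z - cell_interior z \<in> null_sets lborel"
      using closed_cell[of z] by (subst (asm) negligible_iff_null_sets, subst (asm) null_sets_completion_iff)
        (auto simp: cell_interior_def)
    then show ?thesis by (rule AE_not_in)
  qed
  then have "AE x in lborel. \<forall>z\<in>active. x \<notin> cell c l z - cell_interior z"
    using finite_active_cells by (intro AE_finite_allI) auto
  then show ?thesis by eventually_elim (auto simp: active_region_def)
qed

text \<open>On \<open>\<Gamma>\<close> the products vanish at every point: a nonzero gradient of
  one function requires a cell of its patch that contains the point, and on that cell the other
  function is zero. The volume term vanishes only almost everywhere, since averaged gradients of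
  both functions may be nonzero on a common cell boundary.\<close>

lemma nitsche_form_disjoint_patches:
  assumes u: "u \<in> local_space \<kappa> c p l j" and v: "v \<in> local_space \<kappa> c p l j'"
    and disj: "patch_cells c l j \<inter> patch_cells c l j' = {}"
  shows "nitsche_form c p \<gamma>D l u v = 0"
proof -
  have uV: "u \<in> V" and vV: "v \<in> V" using u v local_space_subset by auto
  have vanish: "w x = 0" if "w \<in> local_space \<kappa> c p l i" "z \<in> active" "x \<in> cell c l z" "z \<notin> patch_cells c l i" for w i z x
  proof -
    have "w \<in> V" using that(1) local_space_subset by auto
    from cell_poly(2)[OF this that(2,3)] local_space_support[OF that(1,2,4)] show ?thesis by simp
  qed
  have grad: "fe_grad c p l w x = 0" if "w \<in> local_space \<kappa> c p l i" "\<forall>z\<in>active. x \<in> cell c l z \<longrightarrow> z \<notin> patch_cells c l i" for w i x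
    using that local_space_support by (intro fe_grad_zero_off_support) auto
  have mixed: "w x * fe_normal_deriv c p l w' x = 0"
    if "w \<in> local_space \<kappa> c p l i" "w' \<in> local_space \<kappa> c p l i'" "patch_cells c l i \<inter> patch_cells c l i' = {}" for w w' i i' x
  proof (cases "\<forall>z\<in>active. x \<in> cell c l z \<longrightarrow> z \<notin> patch_cells c l i'")
    case True
    then show ?thesis using grad[OF that(2)] by (simp add: fe_normal_deriv_def)
  next
    case False
    then show ?thesis using vanish[OF that(1)] that(3) by (metis disjoint_iff mult_zero_left)
  qed
  have product: "u x * v x = 0" if "x \<in> \<Gamma>" for x
  proof -
    obtain z where "z \<in> active" "x \<in> cell c l z"
      using subsetD[OF frontier_subset_active \<open>x \<in> \<Gamma>\<close>] unfolding active_region_def by blast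
    then show ?thesis using vanish[OF u] vanish[OF v] disj by (metis disjoint_iff mult_zero_left mult_zero_right)
  qed
  have zero: "L2_Gamma c f g = 0" if "\<And>x. x \<in> \<Gamma> \<Longrightarrow> f x * g x = 0" for f g
  proof -
    have "(\<lambda>x. indicator \<Gamma> x *\<^sub>R (f x * g x)) = (\<lambda>x. 0)" using that by (auto simp: indicator_def fun_eq_iff)
    then show ?thesis unfolding L2_Gamma_def set_lebesgue_integral_def by simp
  qed
  have "grad_form c p l (region c) u v = 0"
  proof -
    have "AE x in lborel. indicator (region c) x *\<^sub>R (fe_grad c p l u x \<bullet> fe_grad c p l v x) = 0"
      using AE_cell_interior
    proof eventually_elim
      case (elim x)
      show ?case
      proof (cases "x \<in> region c")
        case True
        then obtain z where z: "z \<in> active" "x \<in> cell_interior z" using elim region_subset_active by blast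
        have only: "z' = z" if "x \<in> cell c l z'" for z' using cell_interior_unique[OF z(2) that] .
        have "fe_grad c p l u x = 0 \<or> fe_grad c p l v x = 0"
          using grad[OF u] grad[OF v] only disj by (metis disjoint_iff)
        then show ?thesis by auto
      qed simp
    qed
    then show ?thesis unfolding grad_form_def set_lebesgue_integral_def by (rule integral_eq_zero_AE)
  qed
  moreover have "L2_Gamma c (fe_normal_deriv c p l u) v = 0"
    using mixed[OF v u] disj by (intro zero) (auto simp: mult.commute)
  moreover have "L2_Gamma c u (fe_normal_deriv c p l v) = 0"
    using mixed[OF u v disj] by (intro zero)
  moreover have "L2_Gamma c u v = 0" using product by (intro zero)
  ultimately show ?thesis by (simp add: nitsche_form_def)
qed

lemma finite_color_class: "finite (color_class c l col)"
  unfolding color_class_def using finite_adm_vertices by simp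

lemma V_sum: "(\<And>j. j \<in> J \<Longrightarrow> u j \<in> V) \<Longrightarrow> (\<Sum>j\<in>J. u j) \<in> V"
  using subspace_V by (rule subspace_sum)

lemma nitsche_form_sum:
  assumes "\<And>j. j \<in> J \<Longrightarrow> u j \<in> V" "w \<in> V"
  shows "nitsche_form c p \<gamma>D l (\<Sum>j\<in>J. u j) w = (\<Sum>j\<in>J. nitsche_form c p \<gamma>D l (u j) w)"
  using assms
proof (induction J rule: infinite_finite_induct)
  case (insert j J)
  have IH: "nitsche_form c p \<gamma>D l (sum u J) w = (\<Sum>j\<in>J. nitsche_form c p \<gamma>D l (u j) w)"
    using insert by auto
  have eq: "nitsche_form c p \<gamma>D l (u j + sum u J) w = nitsche_form c p \<gamma>D l (u j) w + nitsche_form c p \<gamma>D l (sum u J) w"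
    using nitsche_form_linear[of "u j" "sum u J" w \<gamma>D 1 1] insert.prems V_sum[of J u] by simp
  show ?case unfolding sum.insert[OF insert.hyps(1,2)] eq IH ..
qed (use nitsche_form_linear[of w w w \<gamma>D 0 0] in auto)

lemma nitsche_form_color_class:
  assumes u: "\<And>j. j \<in> color_class c l col \<Longrightarrow> u j \<in> local_space \<kappa> c p l j"
  shows "nitsche_form c p \<gamma>D l (\<Sum>j\<in>color_class c l col. u j) (\<Sum>j\<in>color_class c l col. u j)
     = (\<Sum>j\<in>color_class c l col. nitsche_form c p \<gamma>D l (u j) (u j))"
proof -
  define J where "J = color_class c l col"
  have J: "finite J" by (simp add: J_def finite_color_class)
  have uV: "u j \<in> V" if "j \<in> J" for j using u[of j] that local_space_subset by (auto simp: J_def)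
  have cross: "nitsche_form c p \<gamma>D l (u j) (u j') = (if j' = j then nitsche_form c p \<gamma>D l (u j) (u j) else 0)"
    if "j \<in> J" "j' \<in> J" for j j'
  proof (cases "j' = j")
    case False
    then have "patch_cells c l j \<inter> patch_cells c l j' = {}"
      using same_color_patches_disjoint[of j j'] that by (auto simp: J_def color_class_def)
    then show ?thesis using nitsche_form_disjoint_patches[of "u j" \<kappa> j "u j'" j'] u that False by (simp add: J_def)
  qed simp
  have "nitsche_form c p \<gamma>D l (u j) (\<Sum>j\<in>J. u j) = nitsche_form c p \<gamma>D l (u j) (u j)" if j: "j \<in> J" for j
  proof -
    have "nitsche_form c p \<gamma>D l (u j) (\<Sum>j\<in>J. u j) = (\<Sum>j'\<in>J. nitsche_form c p \<gamma>D l (u j) (u j'))"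
      unfolding nitsche_form_sym[of _ "u j"] using uV j by (intro nitsche_form_sum)
    also have "\<dots> = (\<Sum>j'\<in>J. if j' = j then nitsche_form c p \<gamma>D l (u j) (u j) else 0)"
      by (intro sum.cong refl cross j)
    also have "\<dots> = nitsche_form c p \<gamma>D l (u j) (u j)" using J j by (simp add: sum.delta)
    finally show ?thesis .
  qed
  then show ?thesis unfolding J_def[symmetric] using uV by (subst nitsche_form_sum) (auto intro: V_sum)
qed

lemma normal_jump_sum:
  assumes "\<And>j. j \<in> J \<Longrightarrow> u j \<in> V" "F \<in> ghost_faces c l"
  shows "normal_jump c p l k F (\<Sum>j\<in>J. u j) x = (\<Sum>j\<in>J. normal_jump c p l k F (u j) x)"
  using assms
proof (induction J rule: infinite_finite_induct)
  case (insert j J)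
  have IH: "normal_jump c p l k F (sum u J) x = (\<Sum>j\<in>J. normal_jump c p l k F (u j) x)"
    using insert by auto
  have eq: "normal_jump c p l k F (u j + sum u J) x = normal_jump c p l k F (u j) x + normal_jump c p l k F (sum u J) x"
    using normal_jump_linear[of "u j" "sum u J" F k 1 1 x] insert.prems V_sum[of J u] by simp
  show ?case unfolding sum.insert[OF insert.hyps(1,2)] eq IH ..
qed (use normal_jump_linear[of 0 0 F k 0 0 x] subspace_0[OF subspace_V] in auto)

lemma normal_jump_off_patch:
  assumes u: "u \<in> local_space \<kappa> c p l j" and F: "(z, i) \<in> ghost_faces c l"
    and off: "z \<notin> patch_cells c l j" "z + axis i 1 \<notin> patch_cells c l j"
  shows "normal_jump c p l k (z, i) u x = 0"
  using F local_space_support[OF u _ off(1)] local_space_support[OF u _ off(2)]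
  by (simp add: normal_jump_eq cell_deriv_zero ghost_faces_def)

text \<open>A ghost face lies between two cells, and each cell belongs to at most one patch of
  the colour. So at most two of the jumps on it are nonzero.\<close>

lemma ghost_form_color_class:
  assumes u: "\<And>j. j \<in> color_class c l col \<Longrightarrow> u j \<in> local_space \<kappa> c p l j" and \<gamma>: "0 \<le> \<gamma>"
  shows "ghost_form c p \<gamma> l (\<Sum>j\<in>color_class c l col. u j) (\<Sum>j\<in>color_class c l col. u j)
     \<le> 2 * (\<Sum>j\<in>color_class c l col. ghost_form c p \<gamma> l (u j) (u j))"
proof -
  define J where "J = color_class c l col"
  have J: "finite J" by (simp add: J_def finite_color_class)
  have uV: "u j \<in> V" if "j \<in> J" for j using u[of j] that local_space_subset by (auto simp: J_def)
  define I where "I = (\<lambda>F k w. LINT x:face c l F|surface_measure. normal_jump c p l k F w x * normal_jump c p l k F w x)"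
  have face: "I F k (\<Sum>j\<in>J. u j) \<le> 2 * (\<Sum>j\<in>J. I F k (u j))" if F: "F \<in> ghost_faces c l" for F k
  proof -
    obtain z i where Fz: "F = (z, i)" by force
    define K where "K = {j \<in> J. z \<in> patch_cells c l j} \<union> {j \<in> J. z + axis i 1 \<in> patch_cells c l j}"
    have one: "card {j \<in> J. z' \<in> patch_cells c l j} \<le> 1" for z'
    proof -
      have "a = b" if "a \<in> {j \<in> J. z' \<in> patch_cells c l j}" "b \<in> {j \<in> J. z' \<in> patch_cells c l j}" for a b
        using same_color_patches_disjoint[of a b z'] that by (simp add: J_def color_class_def)
      then show ?thesis using J by (simp add: card_le_Suc0_iff_eq)
    qed
    have "card K \<le> 2" unfolding K_def
      using card_Un_le[of "{j \<in> J. z \<in> patch_cells c l j}" "{j \<in> J. z + axis i 1 \<in> patch_cells c l j}"]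
        one[of z] one[of "z + axis i 1"] by linarith
    then have sq: "(normal_jump c p l k F (\<Sum>j\<in>J. u j) x)\<^sup>2 \<le> 2 * (\<Sum>j\<in>J. (normal_jump c p l k F (u j) x)\<^sup>2)" for x
    proof -
      have zero: "normal_jump c p l k F (u j) x = 0" if "j \<in> J - K" for j
        unfolding Fz using that u F by (intro normal_jump_off_patch[of "u j" \<kappa> j]) (auto simp: Fz K_def J_def)
      have "normal_jump c p l k F (\<Sum>j\<in>J. u j) x = (\<Sum>j\<in>J. normal_jump c p l k F (u j) x)"
        using uV F by (intro normal_jump_sum)
      then show ?thesis
        using sum_square_le_few_nonzero[OF J _ \<open>card K \<le> 2\<close> zero] by (auto simp: K_def)
    qed
    have int: "set_integrable surface_measure (face c l F) (\<lambda>x. normal_jump c p l k F w x * normal_jump c p l k F w x)"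
      if "w \<in> V" for w
      using that F face_measure[of F] by (intro tame_integrable tame_mult tame_normal_jump) (auto simp: sets_surface_measure)
    have "I F k (\<Sum>j\<in>J. u j) \<le> (LINT x:face c l F|surface_measure. 2 * (\<Sum>j\<in>J. normal_jump c p l k F (u j) x * normal_jump c p l k F (u j) x))"
      unfolding I_def
    proof (rule set_integral_mono)
      show "set_integrable surface_measure (face c l F) (\<lambda>x. normal_jump c p l k F (\<Sum>j\<in>J. u j) x * normal_jump c p l k F (\<Sum>j\<in>J. u j) x)"
        by (intro int V_sum uV)
      show "set_integrable surface_measure (face c l F) (\<lambda>x. 2 * (\<Sum>j\<in>J. normal_jump c p l k F (u j) x * normal_jump c p l k F (u j) x))"
      proof (rule set_integrable_mult_right)
        show "set_integrable surface_measure (face c l F) (\<lambda>x. \<Sum>j\<in>J. normal_jump c p l k F (u j) x * normal_jump c p l k F (u j) x)"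
          unfolding set_integrable_def scaleR_sum_right
          by (intro Bochner_Integration.integrable_sum int[unfolded set_integrable_def] uV)
      qed
    qed (use sq in \<open>simp add: power2_eq_square\<close>)
    also have "\<dots> = 2 * (\<Sum>j\<in>J. I F k (u j))"
    proof -
      have "(LINT x:face c l F|surface_measure. (\<Sum>j\<in>J. normal_jump c p l k F (u j) x * normal_jump c p l k F (u j) x)) = (\<Sum>j\<in>J. I F k (u j))"
        using int uV unfolding I_def set_lebesgue_integral_def set_integrable_def scaleR_sum_right
        by (intro Bochner_Integration.integral_sum) auto
      then show ?thesis by simp
    qed
    finally show ?thesis .
  qed
  define m where "m = (\<lambda>k. h ^ (2 * k - 1) / (fact k)\<^sup>2)"
  have m: "0 \<le> m k" for k using h_pos by (simp add: m_def)
  have ghost: "ghost_form c p \<gamma> l w w = \<gamma> * (\<Sum>F\<in>ghost_faces c l. \<Sum>k=1..p. m k * I F k w)" for w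
    by (simp add: ghost_form_def m_def I_def)
  have "ghost_form c p \<gamma> l (\<Sum>j\<in>J. u j) (\<Sum>j\<in>J. u j)
      \<le> \<gamma> * (\<Sum>F\<in>ghost_faces c l. \<Sum>k=1..p. m k * (2 * (\<Sum>j\<in>J. I F k (u j))))"
    unfolding ghost using \<gamma> m face by (intro mult_left_mono sum_mono)
  also have "\<dots> = 2 * (\<gamma> * (\<Sum>F\<in>ghost_faces c l. \<Sum>k=1..p. \<Sum>j\<in>J. m k * I F k (u j)))"
    by (simp add: sum_distrib_left mult.left_commute)
  also have "(\<Sum>F\<in>ghost_faces c l. \<Sum>k=1..p. \<Sum>j\<in>J. m k * I F k (u j))
      = (\<Sum>F\<in>ghost_faces c l. \<Sum>j\<in>J. \<Sum>k=1..p. m k * I F k (u j))"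
    by (intro sum.cong refl sum.swap)
  also have "\<dots> = (\<Sum>j\<in>J. \<Sum>F\<in>ghost_faces c l. \<Sum>k=1..p. m k * I F k (u j))"
    by (rule sum.swap)
  also have "2 * (\<gamma> * \<dots>) = 2 * (\<Sum>j\<in>J. ghost_form c p \<gamma> l (u j) (u j))"
    unfolding ghost by (simp only: sum_distrib_left)
  finally show ?thesis by (simp only: J_def)
qed

lemma ghost_form_interior_patch:
  assumes u: "u \<in> local_space \<kappa> c p l j" and j: "\<not> cut_or_collar c l j"
  shows "ghost_form c p \<gamma> l u u = 0"
proof -
  have "normal_jump c p l k F u x = 0" if F: "F \<in> ghost_faces c l" for F k x
  proof -
    obtain z i where Fz: "F = (z, i)" by force
    have "F \<in> faces_of_cell z" "F \<in> faces_of_cell (z + axis i 1)" by (auto simp: Fz faces_of_cell_def)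
    then have "z \<notin> patch_cells c l j" "z + axis i 1 \<notin> patch_cells c l j"
      using j F unfolding cut_or_collar_def by blast+
    then show ?thesis using normal_jump_off_patch[OF u] F by (simp add: Fz)
  qed
  then show ?thesis by (simp add: ghost_form_def set_lebesgue_integral_def)
qed

lemma fe_space_nontrivial: "\<exists>v\<in>V. v \<noteq> 0"
proof
  define v where "v = (\<lambda>x. if x \<in> active_region c l then 1 else 0 :: real)"
  have one: "(\<lambda>x. 1) \<in> (Qp p :: (real ^ 'd \<Rightarrow> real) set)" using Qp_prod[of "\<lambda>_. 1" p] by simp
  show "v \<in> V"
    unfolding fe_space_def mem_Collect_eq
  proof (intro conjI ballI allI impI)
    show "continuous_on (active_region c l) v" by (rule continuous_on_eq[OF continuous_on_const[of _ 1]]) (simp add: v_def)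
    show "\<exists>q\<in>Qp p. \<forall>x\<in>cell c l z. v x = q x" if "z \<in> active" for z
      using that by (intro bexI[OF _ one]) (auto simp: v_def active_region_def)
  qed (simp add: v_def)
  obtain x where "x \<in> region c" using region_nonempty by blast
  then have "v x = 1" using region_subset_active by (auto simp: v_def)
  then show "v \<noteq> 0" by auto
qed

end

context stable_level
begin

lemma A_nonneg: "v \<in> V \<Longrightarrow> 0 \<le> A v v"
  using inner_product_on.A_nonneg[OF inner_product] .

lemma A_norm_square: "v \<in> V \<Longrightarrow> (A_norm c p \<gamma> \<gamma>D l v)\<^sup>2 = A v v"
  using A_nonneg by (simp add: A_norm_def)

text \<open>The ghost penalty exceeds its additive value by at most one copy of
  \<open>ghost_form\<close> per patch. Coercivity turns this into \<open>1 / cA\<close> copies of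
  the energy on the damped patches; on the others it is zero.\<close>

lemma color_class_stability:
  assumes \<theta>: "0 < \<theta>" and u: "\<And>j. j \<in> color_class c l col \<Longrightarrow> u j \<in> local_space \<kappa> c p l j"
  shows "A (\<Sum>j\<in>color_class c l col. u j) (\<Sum>j\<in>color_class c l col. u j)
    \<le> max 1 ((1 + 1 / cA) * \<theta>) * (\<Sum>j\<in>color_class c l col. inverse (damping c l \<theta> j) * A (u j) (u j))"
proof -
  define J where "J = color_class c l col"
  define M where "M = max 1 ((1 + 1 / cA) * \<theta>)"
  have M: "1 \<le> M" "(1 + 1 / cA) * \<theta> \<le> M" by (simp_all add: M_def)
  have "A (\<Sum>j\<in>J. u j) (\<Sum>j\<in>J. u j)
      \<le> (\<Sum>j\<in>J. nitsche_form c p \<gamma>D l (u j) (u j)) + 2 * (\<Sum>j\<in>J. ghost_form c p \<gamma> l (u j) (u j))"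
    unfolding A_form_def J_def using nitsche_form_color_class[OF u] ghost_form_color_class[OF u] \<gamma> by simp
  also have "\<dots> = (\<Sum>j\<in>J. A (u j) (u j) + ghost_form c p \<gamma> l (u j) (u j))"
    by (simp add: A_form_def sum.distrib sum_distrib_left)
  also have "\<dots> \<le> (\<Sum>j\<in>J. M * (inverse (damping c l \<theta> j) * A (u j) (u j)))"
  proof (rule sum_mono)
    fix j assume j: "j \<in> J"
    then have uj: "u j \<in> local_space \<kappa> c p l j" using u by (simp add: J_def)
    then have V: "u j \<in> V" using local_space_subset by blast
    show "A (u j) (u j) + ghost_form c p \<gamma> l (u j) (u j) \<le> M * (inverse (damping c l \<theta> j) * A (u j) (u j))"
    proof (cases "cut_or_collar c l j")
      case True
      have "ghost_form c p \<gamma> l (u j) (u j) \<le> A (u j) (u j) / cA"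
        using A_lower(2)[OF V] cA by (simp add: field_simps)
      then have "A (u j) (u j) + ghost_form c p \<gamma> l (u j) (u j) \<le> (1 + 1 / cA) * A (u j) (u j)"
        by (simp add: algebra_simps)
      also have "\<dots> = ((1 + 1 / cA) * \<theta>) * (inverse \<theta> * A (u j) (u j))" using \<theta> by simp
      also have "\<dots> \<le> M * (inverse \<theta> * A (u j) (u j))"
        using M A_nonneg[OF V] \<theta> by (intro mult_right_mono) auto
      finally show ?thesis using True by (simp add: damping_def)
    next
      case False
      then show ?thesis using ghost_form_interior_patch[OF uj] mult_right_mono[OF M(1) A_nonneg[OF V]]
        by (simp add: damping_def)
    qed
  qed
  also have "\<dots> = M * (\<Sum>j\<in>J. inverse (damping c l \<theta> j) * A (u j) (u j))" by (simp add: sum_distrib_left)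
  finally show ?thesis by (simp add: J_def M_def)
qed

lemma local_stability_const_le:
  assumes \<theta>: "0 < \<theta>"
  shows "local_stability_const \<kappa> c p \<gamma> \<gamma>D \<theta> l \<le> max 1 ((1 + 1 / cA) * \<theta>)"
  unfolding local_stability_const_def
proof (rule Least_bound_le[where M = "max 1 ((1 + 1 / cA) * \<theta>)"
      and Q = "\<lambda>col u. \<forall>j\<in>color_class c l col. u j \<in> local_space \<kappa> c p l j"
      and X = "\<lambda>col u. (A_norm c p \<gamma> \<gamma>D l (\<Sum>j\<in>color_class c l col. u j))\<^sup>2"
      and Y = "\<lambda>col u. \<Sum>j\<in>color_class c l col. inverse (damping c l \<theta> j) * (A_norm c p \<gamma> \<gamma>D l (u j))\<^sup>2"])
  fix col and u :: "int ^ 'a \<Rightarrow> real ^ 'a \<Rightarrow> real"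
  assume u: "\<forall>j\<in>color_class c l col. u j \<in> local_space \<kappa> c p l j"
  then have uV: "u j \<in> V" if "j \<in> color_class c l col" for j using that local_space_subset by blast
  have eq: "(\<Sum>j\<in>color_class c l col. inverse (damping c l \<theta> j) * (A_norm c p \<gamma> \<gamma>D l (u j))\<^sup>2)
      = (\<Sum>j\<in>color_class c l col. inverse (damping c l \<theta> j) * A (u j) (u j))"
    by (intro sum.cong refl) (simp add: A_norm_square uV)
  have sum: "(A_norm c p \<gamma> \<gamma>D l (\<Sum>j\<in>color_class c l col. u j))\<^sup>2
      = A (\<Sum>j\<in>color_class c l col. u j) (\<Sum>j\<in>color_class c l col. u j)"
    by (intro A_norm_square V_sum uV)
  show "(A_norm c p \<gamma> \<gamma>D l (\<Sum>j\<in>color_class c l col. u j))\<^sup>2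
         \<le> max 1 ((1 + 1 / cA) * \<theta>) * (\<Sum>j\<in>color_class c l col.
                  inverse (damping c l \<theta> j) * (A_norm c p \<gamma> \<gamma>D l (u j))\<^sup>2)"
    unfolding eq sum by (rule color_class_stability[OF \<theta>]) (use u in blast)
qed simp

text \<open>The bound \<open>\<theta> \<le> cA / (1 + cA)\<close> is exactly \<open>(1 + 1 / cA)
  * \<theta> \<le> 1\<close>, which makes the local-stability constant \<open>1\<close>.\<close>

lemma E_semi_contraction:
  assumes \<theta>: "0 < \<theta>" "\<theta> \<le> cA / (1 + cA)" and l: "1 \<le> l"
    and cols: "distinct cols" "set cols = UNIV" and Csd: "0 < Csd" and v: "v \<in> V"
    and v0: "v0 \<in> coarse_space c p l" and w: "\<And>j. j \<in> adm_vertices c l \<Longrightarrow> w j \<in> local_space \<kappa> c p l j"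
    and dec: "v = v0 + (\<Sum>j\<in>adm_vertices c l. w j)"
    and bound: "A v0 v0 + (\<Sum>j\<in>adm_vertices c l. A (w j) (w j)) \<le> Csd * A v v"
  defines "E \<equiv> E_semi \<kappa> c p \<gamma> \<gamma>D \<theta> cols l"
  shows "E v \<in> V" and "A (E v) (E v) \<le> (1 - \<theta> / ((2 * 4 ^ CARD('a) + 1) * Csd)) * A v v"
proof -
  obtain B where B: "finite B" "V \<subseteq> span B" using fe_space_finite_dimensional by blast
  interpret ip: finite_inner_product V A B
    using inner_product B by (simp add: finite_inner_product_def finite_inner_product_axioms_def)
  have \<theta>1: "\<theta> \<le> 1"
  proof -
    have "cA / (1 + cA) \<le> 1" using cA by simp
    then show ?thesis using \<theta> by linarith
  qed
  have "(1 + 1 / cA) * \<theta> \<le> (1 + 1 / cA) * (cA / (1 + cA))" using \<theta> cA by (intro mult_left_mono) auto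
  also have "\<dots> = 1"
  proof -
    have "1 + 1 / cA = (1 + cA) / cA" using cA by (simp add: field_simps)
    then show ?thesis using cA by simp
  qed
  finally have M: "max 1 ((1 + 1 / cA) * \<theta>) = 1" by simp
  have proj: "A_proj c p \<gamma> \<gamma>D l S = ip.orth_proj S" for S
    by (simp add: fun_eq_iff A_proj_def ip.orth_proj_def)
  have E: "E = foldr (\<lambda>col E. (\<lambda>v. v - (\<Sum>j\<in>color_class c l col. damping c l \<theta> j *\<^sub>R ip.orth_proj (local_space \<kappa> c p l j) v)) \<circ> E)
      cols (\<lambda>v. v - ip.orth_proj (coarse_space c p l) v)"
    unfolding E_def E_semi_def color_step_def[abs_def] proj ..
  have group: "(\<Sum>col\<in>set cols. \<Sum>j\<in>color_class c l col. f j) = (\<Sum>j\<in>adm_vertices c l. f j)" for f :: "int ^ 'a \<Rightarrow> 'z::comm_monoid_add"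
    unfolding color_class_def cols(2) by (rule sum.group[OF finite_adm_vertices]) auto
  have stab: "A (\<Sum>j\<in>color_class c l col. u j) (\<Sum>j\<in>color_class c l col. u j)
      \<le> (\<Sum>j\<in>color_class c l col. inverse (damping c l \<theta> j) * A (u j) (u j))"
    if "\<forall>j\<in>color_class c l col. u j \<in> local_space \<kappa> c p l j" for col u
    using color_class_stability[OF \<theta>(1), of col u \<kappa>] that M by simp
  have damp: "\<theta> \<le> damping c l \<theta> j" "damping c l \<theta> j \<le> 1" for j using \<theta>1 by (auto simp: damping_def)
  have wc: "j \<in> color_class c l col \<Longrightarrow> w j \<in> local_space \<kappa> c p l j" for col j
    using w by (simp add: color_class_def)
  have dec': "v = v0 + (\<Sum>col\<in>set cols. \<Sum>j\<in>color_class c l col. w j)"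
    using dec unfolding group .
  have bound': "A v0 v0 + (\<Sum>col\<in>set cols. \<Sum>j\<in>color_class c l col. A (w j) (w j)) \<le> Csd * A v v"
    using bound unfolding group .
  note S = ip.multiplicative_Schwarz[of "local_space \<kappa> c p l" "coarse_space c p l" \<theta> "damping c l \<theta>" "color_class c l" v v0 w cols Csd,
      OF local_space_subspace local_space_subset coarse_space[OF l] damp \<theta>(1) stab v v0 wc dec' bound' Csd cols(1)]
  show "E v \<in> V" using S(1) unfolding E .
  \<comment> \<open>There are \<open>2\<^sup>d\<close> parity vectors, so the abstract
    constant \<open>2 N\<^sup>2 + 1\<close> becomes \<open>2 \<cdot> 4\<^sup>d +
    1\<close>.\<close>
  have "length cols = 2 ^ CARD('a)"
    using distinct_card[OF cols(1)] cols(2) by (simp add: card_UNIV_bool)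
  then have "(real (length cols))\<^sup>2 = 4 ^ CARD('a)"
    by (simp add: power2_eq_square power_mult_distrib[symmetric])
  then show "A (E v) (E v) \<le> (1 - \<theta> / ((2 * 4 ^ CARD('a) + 1) * Csd)) * A v v"
    using S(2) unfolding E by simp
qed

end

lemma stable_level_intro:
  fixes c :: "('d::finite) cut_config"
  assumes "CARD('d) = 2 \<or> CARD('d) = 3" "1 \<le> p" "valid_config c" "geometric_assumption c" "0 < \<gamma>"
    and "cutfem_stability \<C> p \<gamma> \<gamma>D cA CA CE" "c \<in> \<C>" "l \<le> finest c"
  shows "stable_level c p l \<gamma> \<gamma>D cA CE"
proof
  show "valid_config c" "1 \<le> p" "0 < \<gamma>" by fact+
  show "C2_boundary (region c)" using assms(4) by (simp add: geometric_assumption_def)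
  show "2 \<le> CARD('d)" using assms(1) by auto
  show "0 < cA" "0 < CE" using assms(6) by (simp_all add: cutfem_stability_def)
  fix v assume v: "v \<in> fe_space c p l"
  show "cA * (N_norm c p \<gamma> l v)\<^sup>2 \<le> A_form c p \<gamma> \<gamma>D l v v"
    "grad_form c p l (active_region c l - region c) v v
      \<le> CE * (grad_form c p l (region c) v v + ghost_form c p \<gamma> l v v)"
    using assms(6-8) v unfolding cutfem_stability_def by blast+
qed

theorem corollary4:
  fixes \<C> :: "('d::finite) cut_config set"
    and p :: nat and \<gamma> \<gamma>D cA CA CE Csd \<theta> :: real
    and \<kappa> :: patch_kind and cols :: "(bool ^ 'd) list"
  assumes dim: "CARD('d) = 2 \<or> CARD('d) = 3"
    and degree: "p \<ge> 1"
    and config: "\<forall>c\<in>\<C>. valid_config c"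
    and geometry: "\<forall>c\<in>\<C>. geometric_assumption c"
    and ghost_param: "0 < \<gamma>" "\<gamma> \<le> 1"
    and stability: "cutfem_stability \<C> p \<gamma> \<gamma>D cA CA CE"
    and covering: "\<forall>c\<in>\<C>. covering_assumption \<kappa> c p"
    and decomposition: "stable_decomposition \<kappa> \<C> p \<gamma> \<gamma>D Csd"
    and theta: "0 < \<theta>" "\<theta> < 1"
    and color_order: "distinct cols" "set cols = UNIV"
  shows "(\<forall>c\<in>\<C>. \<forall>l\<in>{1..finest c}.
            local_stability_const \<kappa> c p \<gamma> \<gamma>D \<theta> l \<le> max 1 ((1 + 1 / cA) * \<theta>)) \<and>
         (\<theta> \<le> cA / (1 + cA) \<longrightarrow>
            (\<forall>c\<in>\<C>. \<forall>l\<in>{1..finest c}.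
               (A_opnorm c p \<gamma> \<gamma>D l (E_semi \<kappa> c p \<gamma> \<gamma>D \<theta> cols l))\<^sup>2
                 \<le> 1 - \<theta> / ((2 * 4 ^ CARD('d) + 1) * Csd))) \<and>
         is_arg_min (\<lambda>t. 1 - t / ((2 * 4 ^ CARD('d) + 1) * Csd))
           (\<lambda>t. 0 < t \<and> t < 1 \<and> t \<le> cA / (1 + cA)) (cA / (1 + cA))"
proof (intro conjI impI ballI)
  have cA: "0 < cA" using stability by (simp add: cutfem_stability_def)
  have Csd: "0 < Csd" using decomposition by (simp add: stable_decomposition_def)
  have level: "stable_level c p l \<gamma> \<gamma>D cA CE" if "c \<in> \<C>" "l \<in> {1..finest c}" for c l
    using that config geometry by (intro stable_level_intro[OF dim degree _ _ ghost_param(1) stability]) auto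
  show "local_stability_const \<kappa> c p \<gamma> \<gamma>D \<theta> l \<le> max 1 ((1 + 1 / cA) * \<theta>)"
    if "c \<in> \<C>" "l \<in> {1..finest c}" for c l
    using stable_level.local_stability_const_le[OF level[OF that] theta(1)] .
  show "is_arg_min (\<lambda>t. 1 - t / ((2 * 4 ^ CARD('d) + 1) * Csd))
           (\<lambda>t. 0 < t \<and> t < 1 \<and> t \<le> cA / (1 + cA)) (cA / (1 + cA))"
  proof -
    have "0 < (2 * 4 ^ CARD('d) + 1) * Csd" using Csd by (simp add: add_pos_pos)
    then have "\<not> 1 - t / ((2 * 4 ^ CARD('d) + 1) * Csd) < 1 - cA / (1 + cA) / ((2 * 4 ^ CARD('d) + 1) * Csd)"
      if "t \<le> cA / (1 + cA)" for t
      using divide_right_mono[OF that, of "(2 * 4 ^ CARD('d) + 1) * Csd"] by simp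
    moreover have "0 < cA / (1 + cA)" "cA / (1 + cA) < 1" using cA by auto
    ultimately show ?thesis unfolding is_arg_min_def by blast
  qed
  fix c l assume small: "\<theta> \<le> cA / (1 + cA)" and c: "c \<in> \<C>" and l: "l \<in> {1..finest c}"
  interpret stable_level c p l \<gamma> \<gamma>D cA CE by (rule level[OF c l])
  define E where "E = E_semi \<kappa> c p \<gamma> \<gamma>D \<theta> cols l"
  define K where "K = 1 - \<theta> / ((2 * 4 ^ CARD('d) + 1) * Csd)"
  have E: "E v \<in> V \<and> A (E v) (E v) \<le> K * A v v" if v: "v \<in> V" for v
  proof -
    obtain v0 w where vw: "v0 \<in> coarse_space c p l" "\<And>j. j \<in> adm_vertices c l \<Longrightarrow> w j \<in> local_space \<kappa> c p l j"
      "v = v0 + (\<Sum>j\<in>adm_vertices c l. w j)"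
      "(A_norm c p \<gamma> \<gamma>D l v0)\<^sup>2 + (\<Sum>j\<in>adm_vertices c l. (A_norm c p \<gamma> \<gamma>D l (w j))\<^sup>2) \<le> Csd * (A_norm c p \<gamma> \<gamma>D l v)\<^sup>2"
      using decomposition c l v unfolding stable_decomposition_def by blast
    have l1: "1 \<le> l" using l by simp
    have "v0 \<in> V" using vw(1) coarse_space(2)[OF l1] by blast
    moreover have "w j \<in> V" if "j \<in> adm_vertices c l" for j using vw(2)[OF that] local_space_subset by blast
    ultimately have "A v0 v0 + (\<Sum>j\<in>adm_vertices c l. A (w j) (w j)) \<le> Csd * A v v"
      using vw(4) v by (simp add: A_norm_square)
    from E_semi_contraction[OF theta(1) small l1 color_order Csd v vw(1,2,3) this]
    show ?thesis by (simp add: E_def K_def)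
  qed
  \<comment> \<open>A nonzero function shows that the supremum in the operator norm is over a
    nonempty set and that \<open>K\<close> is nonnegative.\<close>
  obtain e where e: "e \<in> V" "e \<noteq> 0" using fe_space_nontrivial by blast
  have "0 \<le> K * A e e" using E[OF e(1)] A_nonneg[of "E e"] by linarith
  then have K: "0 \<le> K" using A_positive[OF e] by (simp add: zero_le_mult_iff)
  define q where "q = (\<lambda>v. A_norm c p \<gamma> \<gamma>D l (E v) / A_norm c p \<gamma> \<gamma>D l v)"
  have q: "0 \<le> q v" "q v \<le> sqrt K" if "v \<in> V - {0}" for v
  proof -
    have pos: "0 < A v v" using that A_positive by auto
    have "sqrt (A (E v) (E v)) \<le> sqrt (K * A v v)" using E[of v] that by simp
    then show "q v \<le> sqrt K" using pos by (simp add: q_def A_norm_def real_sqrt_mult divide_le_eq)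
    show "0 \<le> q v" using E[of v] that A_nonneg pos by (auto simp: q_def A_norm_def)
  qed
  have eV: "e \<in> V - {0}" using e by simp
  have "A_opnorm c p \<gamma> \<gamma>D l E = (SUP v\<in>V - {0}. q v)" by (simp add: A_opnorm_def q_def)
  moreover have "(SUP v\<in>V - {0}. q v) \<le> sqrt K" using eV q(2) by (intro cSUP_least) auto
  moreover have "0 \<le> (SUP v\<in>V - {0}. q v)"
  proof -
    have "q e \<le> (SUP v\<in>V - {0}. q v)" using eV q(2) by (intro cSUP_upper) (auto simp: bdd_above_def)
    then show ?thesis using q(1)[OF eV] by linarith
  qed
  ultimately have "(A_opnorm c p \<gamma> \<gamma>D l E)\<^sup>2 \<le> (sqrt K)\<^sup>2" by (simp add: power_mono)
  then show "(A_opnorm c p \<gamma> \<gamma>D l (E_semi \<kappa> c p \<gamma> \<gamma>D \<theta> cols l))\<^sup>2 \<le> 1 - \<theta> / ((2 * 4 ^ CARD('d) + 1) * Csd)"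
    using K by (simp add: E_def K_def)
qed

end
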